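(* In the model described in the context (transmitter density $\lambda_{PH}$, wall frequency $\lambda_w$, path-loss exponent $\beta$, path-loss constant $\kappa$, penetration loss $K\in[0,1)$, disc radius $R_D$, maximum number of walls $N_{max}$), let $l_N(r)=\kappa r^\beta/K^N$, let $L^{(0)}=\min_N\{\min_{n\in\Psi_N}\{l_N(r^{(n)})\}\}$ be the minimum path loss, and let the multi-user interference be $$\mathcal{I}_{MU}=\sum_{N=0}^{N_{max}}\sum_{n\in\Psi_N}\frac{h^{(n)}}{l_N(r^{(n)})}\,\mathbb{1}\{l_N(r^{(n)})>L^{(0)}\}.$$ Assume that the minimum path loss is given and equal to $L^{(0)}$. For $\eta\in\mathbb{R}_+$ consider the functions $$\chi_\eta(\lambda_w)=\lambda_w^\eta\left[\frac{2^{\frac{\eta}{2}}\sqrt{\pi}\,\Gamma\left(\frac{\eta+1}{2}\right)}{\Gamma\left(\frac{\eta+2}{2}\right)}-\frac{\sqrt{2}\;{}_2F_1\left(\frac12,\frac{\eta+1}{2};\frac{\eta+3}{2};\frac12\right)}{\eta+1}\right],$$ and define $$\Delta_{\eta,N}(\omega;L^{(0)})=\left(\frac{L^{(0)}K^N}{\kappa}\right)^{\frac{\eta+2}{\beta}}\left(1-{}_2F_1\left(1,-\tfrac{\eta+2}{\beta};1-\tfrac{\eta+2}{\beta};\tfrac{j\omega}{L^{(0)}}\right)\right)-R_D^{\eta+2}\left(1-{}_2F_1\left(1,-\tfrac{\eta+2}{\beta};1-\tfrac{\eta+2}{\beta};\tfrac{j\omega K^N}{R_D^\beta\kappa}\right)\right).$$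 Then (by the Gil-Pelaez inversion theorem) the CDF of $\mathcal{I}_{MU}$ is given by $$F_{\mathcal{I}_{MU}}(z;L^{(0)})=\Pr\{\mathcal{I}_{MU}\le z\mid L^{(0)}\}=\frac12-\int_0^\infty\frac{1}{\pi\omega}\,\mathrm{Im}\left\{e^{-j\omega z}\prod_{N=0}^{N_{max}}\Phi_N(\omega;L^{(0)})\right\}d\omega,$$ where $$\Phi_N(\omega;L^{(0)})=\begin{cases}\displaystyle\exp\left\{\frac{4\lambda_{PH}}{N!}\sum_{\eta=N}^{\infty}\frac{(-1)^{\eta-N}\chi_\eta(\lambda_w)}{(\eta-N)!\,(\eta+2)}\,\Delta_{\eta,N}(\omega;L^{(0)})\right\} & \text{if } L^{(0)}<\dfrac{R_D^\beta\kappa}{K^N},\\[2ex] 1 & \text{if } L^{(0)}\ge\dfrac{R_D^\beta\kappa}{K^N}\end{cases}$$ (sum over integers $\eta\ge N$) is the characteristic function of the multi-user interference produced by the transmitters whose signals are subject to the attenuation of $N$ obstacles to reach the receiver, i.e. by the points of $\Psi_N$.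
   Context: Model. Transmitters ("power heads") are located in a circular region of radius $R_D$ centred at the origin of $\mathbb{R}^2$, according to a homogeneous Poisson point process of density $\lambda_{PH}$; the receiver is at the origin, and $r^{(n)}$ is the distance of the transmitter $n$ from the receiver. Walls are generated by a Manhattan Poisson line process of frequency $\lambda_w$ on each axis. The transmitter process is decomposed into inhomogeneous Poisson point processes $\Psi_N$, assumed independent, where $\Psi_N$ collects the transmitters whose signal crosses $N$ walls; in polar coordinates $(r,\theta)$ its density with respect to $r\,dr\,d\theta$ is $$\lambda_N(r,\theta)=\lambda_{PH}P_N(r,\theta),\qquad P_N(r,\theta)=\frac{(\lambda_w r|\cos\theta|+\lambda_w r|\sin\theta|)^N}{N!}\exp\{-(\lambda_w r|\cos\theta|+\lambda_w r|\sin\theta|)\}.$$ $N_{max}$ is the maximum number of obstacles that can be encountered in the circular region of radius $R_D$. The $h^{(n)}$ (gains of the interfering links) are exponentially distributed random variables with unit variance, independent of each other and of the $\Psi_N$. Notation: $j=\sqrt{-1}$; $\mathbb{1}\{\cdot\}$ is the indicator function; $\Gamma(\cdot)$ is the Gamma function; ${}_2F_1$ is the Gaussian hypergeometric function.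
   Formalization: The CDF formula is stated for z ≠ 0 only (at z = 0 the interference has an atom and the right-hand side gives half its mass), and where (η+2)/β is a positive integer, so that Δ is undefined as written, Δ is taken as its continuous extension in β. *)

theory Defs
  imports "HOL-Probability.Probability" "HOL-Complex_Analysis.Complex_Analysis"
begin

section \<open>The Gaussian hypergeometric function\<close>

text \<open>
  Power series in the open unit disc; elsewhere the value of the analytic continuation of that
  series to the plane cut along \<open>[1, \<infinity>)\<close> (principal branch). The continuation is
  unique because the cut plane is connected. No value is specified on the cut.
\<close>

definition hypergeo_2F1 :: "complex \<Rightarrow> complex \<Rightarrow> complex \<Rightarrow> complex \<Rightarrow> complex" where
  "hypergeo_2F1 a b c z =
     (if norm z < 1 then eval_fps (fps_hypergeo [a, b] [c] 1) z
      else (THE v. \<exists>f. f holomorphic_on (- (complex_of_real ` {1..})) \<and>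
                       (\<forall>y\<in>ball 0 1. f y = eval_fps (fps_hypergeo [a, b] [c] 1) y) \<and>
                       f z = v))"


section \<open>Point processes\<close>

text \<open>
  Points carry labels in \<^typ>\<open>nat\<close>: in the outcome \<open>w\<close> the process consists of the
  points \<open>pos n w\<close> with \<open>n \<in> \<Psi> w\<close>. Labels let other quantities (such as link gains) be
  attached to points; the point process itself is described by its counts alone.
\<close>

definition point_count :: "('w \<Rightarrow> nat set) \<Rightarrow> (nat \<Rightarrow> 'w \<Rightarrow> 'p) \<Rightarrow> 'p set \<Rightarrow> 'w \<Rightarrow> nat" where
  "point_count \<Psi> pos B w = card {n \<in> \<Psi> w. pos n w \<in> B}"

text \<open>
  Poisson point process with a finite intensity measure \<open>\<Lambda>\<close>. The law of the counts is
  written out because \<^const>\<open>poisson_pmf\<close> requires a positive rate, and \<open>B\<close> may be a null set.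
\<close>

definition poisson_process ::
  "'w measure \<Rightarrow> 'p::topological_space measure \<Rightarrow> ('w \<Rightarrow> nat set) \<Rightarrow> (nat \<Rightarrow> 'w \<Rightarrow> 'p) \<Rightarrow> bool" where
  "poisson_process M \<Lambda> \<Psi> pos \<longleftrightarrow>
     finite_measure \<Lambda> \<and>
     (\<forall>n. {w \<in> space M. n \<in> \<Psi> w} \<in> sets M) \<and>
     (\<forall>n. pos n \<in> borel_measurable M) \<and>
     (\<forall>w\<in>space M. finite (\<Psi> w)) \<and>
     (\<forall>B\<in>sets borel. \<forall>k.
        measure M {w \<in> space M. point_count \<Psi> pos B w = k} =
          measure \<Lambda> B ^ k / fact k * exp (- measure \<Lambda> B)) \<and>
     (\<forall>B::nat \<Rightarrow> 'p set. range B \<subseteq> sets borel \<and> disjoint_family B \<longrightarrow>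
        prob_space.indep_vars M (\<lambda>_. count_space UNIV) (\<lambda>i. point_count \<Psi> pos (B i)) UNIV)"

text \<open>The events generated by a point process, i.e. by its counts in Borel sets.\<close>

definition process_events ::
  "'w measure \<Rightarrow> ('w \<Rightarrow> nat set) \<Rightarrow> (nat \<Rightarrow> 'w \<Rightarrow> 'p::topological_space) \<Rightarrow> 'w set set" where
  "process_events M \<Psi> pos =
     sigma_sets (space M) {{w \<in> space M. point_count \<Psi> pos B w = k} | B k. B \<in> sets borel}"


section \<open>Conditioning on a random variable\<close>

definition sigma_gen :: "'w measure \<Rightarrow> ('w \<Rightarrow> ereal) \<Rightarrow> 'w measure" where
  "sigma_gen M L = vimage_algebra (space M) L borel"

definition cond_cdf :: "'w measure \<Rightarrow> ('w \<Rightarrow> real) \<Rightarrow> ('w \<Rightarrow> ereal) \<Rightarrow> real \<Rightarrow> 'w \<Rightarrow> real" where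
  "cond_cdf M X L z = real_cond_exp M (sigma_gen M L) (indicator {w \<in> space M. X w \<le> z})"

definition cond_char :: "'w measure \<Rightarrow> ('w \<Rightarrow> real) \<Rightarrow> ('w \<Rightarrow> ereal) \<Rightarrow> real \<Rightarrow> 'w \<Rightarrow> complex" where
  "cond_char M X L \<omega> w =
     Complex (real_cond_exp M (sigma_gen M L) (\<lambda>w. Re (iexp (\<omega> * X w))) w)
             (real_cond_exp M (sigma_gen M L) (\<lambda>w. Im (iexp (\<omega> * X w))) w)"


section \<open>The network model\<close>

definition wall_prob :: "real \<Rightarrow> nat \<Rightarrow> real \<Rightarrow> real \<Rightarrow> real" where
  "wall_prob lamw N r \<theta> =
     (lamw * r * \<bar>cos \<theta>\<bar> + lamw * r * \<bar>sin \<theta>\<bar>) ^ N / fact N *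
     exp (- (lamw * r * \<bar>cos \<theta>\<bar> + lamw * r * \<bar>sin \<theta>\<bar>))"

text \<open>
  The measure on the plane whose density with respect to \<open>r dr d\<theta>\<close> is
  \<open>lamPH * wall_prob lamw N r \<theta>\<close> on the disc of radius \<open>RD\<close> (image of the corresponding measure
  on the \<open>(r, \<theta>)\<close> strip under the polar coordinate map).
\<close>

definition intensity :: "real \<Rightarrow> real \<Rightarrow> real \<Rightarrow> nat \<Rightarrow> (real \<times> real) measure" where
  "intensity lamPH lamw RD N =
     distr (density lborel (\<lambda>(r, \<theta>). ennreal (lamPH * wall_prob lamw N r \<theta> * r) *
                                     indicator ({0..RD} \<times> {0..<2 * pi}) (r, \<theta>)))
           borel (\<lambda>(r, \<theta>). (r * cos \<theta>, r * sin \<theta>))"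

text \<open>
  Path losses are extended reals: for \<open>K = 0\<close> and \<open>N > 0\<close> the path loss is \<open>\<infinity>\<close>
  (no signal passes a wall). The minimum path loss is \<open>\<infinity>\<close> if there are no transmitters.
\<close>

definition path_loss :: "real \<Rightarrow> real \<Rightarrow> real \<Rightarrow> nat \<Rightarrow> real \<Rightarrow> ereal" where
  "path_loss \<kappa> \<beta> K N r = ereal (\<kappa> * r powr \<beta>) / ereal (K ^ N)"

definition min_path_loss ::
  "real \<Rightarrow> real \<Rightarrow> real \<Rightarrow> nat \<Rightarrow> (nat \<Rightarrow> 'w \<Rightarrow> nat set) \<Rightarrow> (nat \<Rightarrow> 'w \<Rightarrow> real \<times> real) \<Rightarrow> 'w \<Rightarrow> ereal" where
  "min_path_loss \<kappa> \<beta> K Nmax \<Psi> pos w =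
     (INF N\<in>{..Nmax}. INF n\<in>\<Psi> N w. path_loss \<kappa> \<beta> K N (norm (pos n w)))"

definition interference_from ::
  "real \<Rightarrow> real \<Rightarrow> real \<Rightarrow> nat \<Rightarrow> (nat \<Rightarrow> 'w \<Rightarrow> nat set) \<Rightarrow> (nat \<Rightarrow> 'w \<Rightarrow> real \<times> real) \<Rightarrow>
   (nat \<Rightarrow> 'w \<Rightarrow> real) \<Rightarrow> nat \<Rightarrow> 'w \<Rightarrow> real" where
  "interference_from \<kappa> \<beta> K Nmax \<Psi> pos h N w =
     (\<Sum>n\<in>\<Psi> N w. real_of_ereal (ereal (h n w) / path_loss \<kappa> \<beta> K N (norm (pos n w))) *
        of_bool (path_loss \<kappa> \<beta> K N (norm (pos n w)) > min_path_loss \<kappa> \<beta> K Nmax \<Psi> pos w))"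

definition interference ::
  "real \<Rightarrow> real \<Rightarrow> real \<Rightarrow> nat \<Rightarrow> (nat \<Rightarrow> 'w \<Rightarrow> nat set) \<Rightarrow> (nat \<Rightarrow> 'w \<Rightarrow> real \<times> real) \<Rightarrow>
   (nat \<Rightarrow> 'w \<Rightarrow> real) \<Rightarrow> 'w \<Rightarrow> real" where
  "interference \<kappa> \<beta> K Nmax \<Psi> pos h w =
     (\<Sum>N\<le>Nmax. interference_from \<kappa> \<beta> K Nmax \<Psi> pos h N w)"


section \<open>The closed-form expressions\<close>

definition chi :: "real \<Rightarrow> real \<Rightarrow> real" where
  "chi \<eta> lamw = lamw powr \<eta> *
     (2 powr (\<eta> / 2) * sqrt pi * Gamma ((\<eta> + 1) / 2) / Gamma ((\<eta> + 2) / 2) -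
      sqrt 2 * Re (hypergeo_2F1 (1/2) (of_real ((\<eta> + 1) / 2)) (of_real ((\<eta> + 3) / 2)) (1/2)) /
        (\<eta> + 1))"

definition Delta_generic ::
  "real \<Rightarrow> real \<Rightarrow> real \<Rightarrow> real \<Rightarrow> real \<Rightarrow> nat \<Rightarrow> real \<Rightarrow> real \<Rightarrow> complex" where
  "Delta_generic \<kappa> \<beta> K RD \<eta> N \<omega> L0 =
     of_real ((L0 * K ^ N / \<kappa>) powr ((\<eta> + 2) / \<beta>)) *
       (1 - hypergeo_2F1 1 (of_real (- (\<eta> + 2) / \<beta>)) (of_real (1 - (\<eta> + 2) / \<beta>))
              (\<i> * of_real \<omega> / of_real L0)) -
     of_real (RD powr (\<eta> + 2)) *
       (1 - hypergeo_2F1 1 (of_real (- (\<eta> + 2) / \<beta>)) (of_real (1 - (\<eta> + 2) / \<beta>))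
              (\<i> * of_real \<omega> * of_real (K ^ N) / of_real (RD powr \<beta> * \<kappa>)))"

text \<open>
  The two hypergeometric terms are undefined when their third parameter \<open>1 - (\<eta> + 2) / \<beta>\<close>
  is a nonpositive integer; for rational \<open>\<beta>\<close> this happens for infinitely many integers \<open>\<eta>\<close>.
  The poles of the two terms cancel, and there the expression is understood as its continuous
  extension in \<open>\<beta>\<close>.
\<close>

definition Delta ::
  "real \<Rightarrow> real \<Rightarrow> real \<Rightarrow> real \<Rightarrow> real \<Rightarrow> nat \<Rightarrow> real \<Rightarrow> real \<Rightarrow> complex" where
  "Delta \<kappa> \<beta> K RD \<eta> N \<omega> L0 =
     (if 1 - (\<eta> + 2) / \<beta> \<in> \<int>\<^sub>\<le>\<^sub>0
      then Lim (at \<beta>) (\<lambda>b. Delta_generic \<kappa> b K RD \<eta> N \<omega> L0)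
      else Delta_generic \<kappa> \<beta> K RD \<eta> N \<omega> L0)"

text \<open>The threshold in the case distinction is the path loss at distance \<open>RD\<close>, possibly \<open>\<infinity>\<close>.\<close>

definition Phi ::
  "real \<Rightarrow> real \<Rightarrow> real \<Rightarrow> real \<Rightarrow> real \<Rightarrow> real \<Rightarrow> nat \<Rightarrow> real \<Rightarrow> real \<Rightarrow> complex" where
  "Phi lamPH lamw \<kappa> \<beta> K RD N \<omega> L0 =
     (if ereal L0 < ereal (RD powr \<beta> * \<kappa>) / ereal (K ^ N)
      then exp (of_real (4 * lamPH / fact N) *
             (\<Sum>\<^sub>\<infinity>\<eta>\<in>{N..}. of_real ((-1) ^ (\<eta> - N) * chi (real \<eta>) lamw /
                                   (fact (\<eta> - N) * (real \<eta> + 2))) *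
                          Delta \<kappa> \<beta> K RD (real \<eta>) N \<omega> L0))
      else 1)"

end

theory Submission
  imports Defs
begin

text \<open>
  For a fixed threshold \<open>t\<close>, the interference from the transmitters with path loss above \<open>t\<close> has an
  explicit characteristic function: averaging over the exponential gains gives a product of factors
  \<open>1 / (1 - \<i> \<omega> / l)\<close> over the points, whose expectation is read off the generating functional
  \<open>exp (- \<integral> (1 - f) d\<Lambda>)\<close> of the Poisson processes. Setting \<open>f = 0\<close> where the path loss is at most \<open>a < t\<close>
  shows by the same computation that this interference is independent of \<open>min L t\<close>. If the minimum path
  loss \<open>L\<close> is replaced by a slightly larger value from a finite grid, the threshold is constant on each of
  finitely many events; as every realization has only finitely many points, refining the grid eventually
  does not change the interference. Hence conditioning on \<open>L\<close> amounts to substituting \<open>t = L\<close>.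

  In the exponent, expanding \<open>exp (- \<lambda> r)\<close> leaves products of an angular and a radial integral. The angular
  ones are the \<open>\<chi>\<close>, by Wallis' formula and an incomplete beta integral. The radial ones are the
  \<open>\<Delta>\<close>: the function \<open>F = \<^sub>2F\<^sub>1(1, -q; 1 - q; \<cdot>)\<close> satisfies \<open>x F' - q F = - q / (1 - x)\<close>, which makes
  \<open>r\<^sup>\<eta>\<^sup>+\<^sup>2 (F (c / r\<^sup>\<beta>) - 1)\<close> an antiderivative. The distribution function follows from the
  Gil-Pelaez inversion formula, since the interference has no atom except at \<open>0\<close>.
\<close>

section \<open>Generating functional of Poisson processes\<close>

text \<open>Two kinds of independence are given: the processes \<open>\<Psi> N\<close> are
  independent of each other through their counts, and the gains are independent of the whole
  labelled configuration. The gains are therefore integrated out for a frozen configuration, label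
  by label; as the label sets are disjoint, each gain enters one factor only. What remains is a
  product over points of a function of position. Such a product is determined by the counts, so the
  independence of the processes applies to it. The event \<open>L = L0\<close> may be null, hence
  conditional expectations are identified by their integrals over the events
  \<open>L \<in> A\<close>. The value \<open>z = 0\<close> is excluded because above a fixed
  threshold there is no transmitter with positive probability, and then the interference is 0; at
  such a jump the inversion formula yields the midpoint. Inversion also needs a characteristic
  function that is Lipschitz at 0. Above a threshold \<open>t > 0\<close> all attenuations are below
  \<open>1 / t\<close>, which gives this bound; hence the need for \<open>L > 0\<close> almost
  surely.\<close>

definition process_sigma ::
  "'w measure \<Rightarrow> ('w \<Rightarrow> nat set) \<Rightarrow> (nat \<Rightarrow> 'w \<Rightarrow> 'p::topological_space) \<Rightarrow> 'w measure" where
  "process_sigma M \<Psi> pos =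
     sigma (space M) {{w \<in> space M. point_count \<Psi> pos B w = k} | B k. B \<in> sets borel}"

lemma space_process_sigma [simp]: "space (process_sigma M \<Psi> pos) = space M"
  by (simp add: process_sigma_def space_measure_of_conv)

text \<open>\<open>process_sigma\<close> packages \<open>process_events\<close> as a measure, so
  that \<open>measurable\<close> can express that a function depends on the counts alone.\<close>

lemma sets_process_sigma: "sets (process_sigma M \<Psi> pos) = process_events M \<Psi> pos"
  unfolding process_sigma_def process_events_def by (rule sets_measure_of) auto

lemma point_count_measurable_process:
  assumes "B \<in> sets borel"
  shows "point_count \<Psi> pos B \<in> measurable (process_sigma M \<Psi> pos) (count_space UNIV)"
proof (subst measurable_count_space_eq_countable, simp, intro conjI ballI)
  show "point_count \<Psi> pos B \<in> space (process_sigma M \<Psi> pos) \<rightarrow> UNIV" by simp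
next
  fix k :: nat
  have "point_count \<Psi> pos B -` {k} \<inter> space M = {w \<in> space M. point_count \<Psi> pos B w = k}"
    by auto
  then show "point_count \<Psi> pos B -` {k} \<inter> space (process_sigma M \<Psi> pos)
      \<in> sets (process_sigma M \<Psi> pos)"
    unfolding sets_process_sigma process_events_def using assms by (auto intro!: sigma_sets.Basic)
qed

context prob_space
begin

lemma poisson_process_count_measurable:
  assumes "poisson_process M \<Lambda> \<Psi> pos" "B \<in> sets borel"
  shows "point_count \<Psi> pos B \<in> measurable M (count_space UNIV)"
proof -
  \<comment> \<open>Measurability of a single count is contained in the independence clause of
    \<open>poisson_process\<close>, which speaks of sequences of disjoint sets; the set
    \<open>B\<close> is padded with empty sets.\<close>
  define C where "C i = (if i = (0::nat) then B else {})" for i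
  have "range C \<subseteq> sets borel" "disjoint_family C"
    using assms(2) by (auto simp: C_def disjoint_family_on_def)
  then have "indep_vars (\<lambda>_. count_space UNIV) (\<lambda>i. point_count \<Psi> pos (C i)) UNIV"
    using assms(1) unfolding poisson_process_def by blast
  then show ?thesis
    using C_def[of 0] unfolding indep_vars_def by (metis UNIV_I)
qed

lemma process_events_subset:
  assumes "poisson_process M \<Lambda> \<Psi> pos"
  shows "process_events M \<Psi> pos \<subseteq> events"
  unfolding process_events_def
proof (rule sets.sigma_sets_subset, safe)
  fix B :: "'b set" and k assume "B \<in> sets borel"
  from measurable_sets[OF poisson_process_count_measurable[OF assms this], of "{k}"]
  show "{w \<in> space M. point_count \<Psi> pos B w = k} \<in> events"
    by (simp add: vimage_def Int_def conj_commute)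
qed

lemma poisson_process_measurable_sub:
  assumes "poisson_process M \<Lambda> \<Psi> pos" "f \<in> measurable (process_sigma M \<Psi> pos) N"
  shows "f \<in> measurable M N"
  using process_events_subset[OF assms(1)] assms(2)
  by (auto simp: measurable_def sets_process_sigma)

text \<open>The law of \<open>X\<close> has density \<open>p\<close> with respect to counting
  measure, and summing \<open>p k * c ^ k\<close> is the exponential series at
  \<open>r * c\<close>.\<close>

lemma poisson_pgf_count:
  fixes X :: "'a \<Rightarrow> nat" and c :: complex
  assumes X: "X \<in> measurable M (count_space UNIV)"
    and law: "\<And>k. measure M {w \<in> space M. X w = k} = r ^ k / fact k * exp (- r)"
  shows "expectation (\<lambda>w. c ^ X w) = exp (- (of_real r * (1 - c)))"
proof -
  have nn: "r ^ k / fact k * exp (- r) \<ge> 0" for k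
    using law[of k] by (metis measure_nonneg)
  define p where "p k = r ^ k / fact k * exp (- r)" for k
  have eq: "distr M (count_space UNIV) X = density (count_space UNIV) (\<lambda>k. ennreal (p k))"
  proof (rule measure_eqI_countable[of _ UNIV])
    fix k :: nat
    have "emeasure (distr M (count_space UNIV) X) {k} = emeasure M (X -` {k} \<inter> space M)"
      using X by (simp add: emeasure_distr)
    also have "X -` {k} \<inter> space M = {w \<in> space M. X w = k}" by auto
    also have "emeasure M \<dots> = ennreal (p k)"
      by (simp add: emeasure_eq_measure law p_def)
    finally show "emeasure (distr M (count_space UNIV) X) {k} =
        emeasure (density (count_space UNIV) (\<lambda>k. ennreal (p k))) {k}"
      by (simp add: emeasure_density nn_integral_count_space_indicator[symmetric] one_ennreal_def[symmetric])
  qed auto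
  have ex: "(\<lambda>k. (of_real r * c) ^ k /\<^sub>R fact k * exp (- of_real r)) sums (exp (of_real r * c) * exp (- of_real r))"
    by (intro sums_mult2 exp_converges)
  have term_eq: "p k *\<^sub>R c ^ k = (of_real r * c) ^ k /\<^sub>R fact k * exp (- of_real r)" for k
    by (simp add: p_def scaleR_conv_of_real power_mult_distrib field_simps exp_of_real[symmetric] del: exp_of_real)
  have "summable (\<lambda>k. norm ((of_real r * c) ^ k /\<^sub>R fact k) * norm (exp (- of_real r :: complex)))"
    by (intro summable_mult2 summable_norm_exp)
  then have "summable (\<lambda>k. norm (p k *\<^sub>R c ^ k))"
    unfolding term_eq norm_mult .
  then have int: "integrable (count_space UNIV) (\<lambda>k. p k *\<^sub>R c ^ k)"
    by (simp add: integrable_count_space_nat_iff)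
  have "expectation (\<lambda>w. c ^ X w) = (\<integral>k. c ^ k \<partial>distr M (count_space UNIV) X)"
    using X by (subst integral_distr) auto
  also have "\<dots> = (\<integral>k. p k *\<^sub>R c ^ k \<partial>count_space UNIV)"
    unfolding eq using nn by (subst integral_density) (auto simp: p_def)
  also have "\<dots> = (\<Sum>k. p k *\<^sub>R c ^ k)"
    using int by (rule integral_count_space_nat)
  also have "\<dots> = exp (of_real r * c) * exp (- of_real r)"
    unfolding term_eq using ex by (rule sums_unique[symmetric])
  also have "\<dots> = exp (- (of_real r * (1 - c)))"
    by (simp add: exp_add[symmetric] algebra_simps)
  finally show ?thesis .
qed

text \<open>Grouping the points by the value of \<open>f\<close> turns the product into powers of
  the counts of the level sets. These are disjoint, so the counts are independent Poisson variables.
  Measurability with respect to the counts is recorded as well, since independence of several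
  processes is known only for events of that kind.\<close>

lemma poisson_process_pgf_simple:
  fixes f :: "'p::topological_space \<Rightarrow> complex"
  assumes pp: "poisson_process M \<Lambda> \<Psi> pos" and sets_\<Lambda>: "sets \<Lambda> = sets borel"
    and f: "f \<in> borel_measurable borel" "finite (range f)" "\<And>x. norm (f x) \<le> 1"
  shows "(\<lambda>w. \<Prod>n\<in>\<Psi> w. f (pos n w)) \<in> borel_measurable (process_sigma M \<Psi> pos)"
    and "expectation (\<lambda>w. \<Prod>n\<in>\<Psi> w. f (pos n w)) = exp (- (\<integral>x. 1 - f x \<partial>\<Lambda>))"
proof -
  interpret \<Lambda>: finite_measure \<Lambda> using pp by (simp add: poisson_process_def)
  have space_\<Lambda>: "space \<Lambda> = UNIV" using sets_eq_imp_space_eq[OF sets_\<Lambda>] by simp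
  obtain c where c: "bij_betw c {..<card (range f)} (range f)"
    using ex_bij_betw_nat_finite[OF f(2)] by (auto simp: atLeast0LessThan)
  define k where "k = card (range f)"
  \<comment> \<open>The level sets of \<open>f\<close>, continued by empty sets to an infinite
    sequence as \<open>poisson_process\<close> requires.\<close>
  define C where "C i = (if i < k then f -` {c i} else {})" for i
  have C_sets [measurable]: "C i \<in> sets borel" for i
    using measurable_sets[OF f(1), of "{c i}"] by (auto simp: C_def)
  have disj: "disjoint_family C"
    using c unfolding disjoint_family_on_def C_def bij_betw_def inj_on_def k_def by auto
  have inC: "x \<in> C i \<Longrightarrow> f x = c i" for x i by (auto simp: C_def split: if_splits)
  have cover: "\<exists>i<k. x \<in> C i" for x
  proof -
    have "f x \<in> c ` {..<k}" using bij_betw_imp_surj_on[OF c] by (simp add: k_def)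
    then obtain i where "i < k" "f x = c i" by blast
    then have "x \<in> C i" by (simp add: C_def)
    with \<open>i < k\<close> show ?thesis by blast
  qed
  have cnorm: "norm (c i) \<le> 1" if "i < k" for i
  proof -
    have "c i \<in> range f" using bij_betw_apply[OF c, of i] that by (simp add: k_def)
    then show ?thesis using f(3) by auto
  qed
  have prod_eq: "(\<Prod>n\<in>\<Psi> w. f (pos n w)) = (\<Prod>i<k. c i ^ point_count \<Psi> pos (C i) w)"
    if "w \<in> space M" for w
  proof -
    have fin: "finite (\<Psi> w)" using pp that by (auto simp: poisson_process_def)
    define g where "g n = (SOME i. i < k \<and> pos n w \<in> C i)" for n
    have g: "g n < k \<and> pos n w \<in> C (g n)" for n
      unfolding g_def by (rule someI_ex) (rule cover)
    have g_eq: "g n = i \<longleftrightarrow> pos n w \<in> C i" for n i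
      using g[of n] disj unfolding disjoint_family_on_def by blast
    have "(\<Prod>n\<in>\<Psi> w. f (pos n w)) = (\<Prod>i<k. \<Prod>n\<in>{n\<in>\<Psi> w. g n = i}. f (pos n w))"
      by (rule prod.group[symmetric]) (use g fin in auto)
    also have "\<dots> = (\<Prod>i<k. c i ^ point_count \<Psi> pos (C i) w)"
    proof (rule prod.cong[OF refl])
      fix i
      have "(\<Prod>n\<in>{n\<in>\<Psi> w. g n = i}. f (pos n w)) = (\<Prod>n\<in>{n\<in>\<Psi> w. g n = i}. c i)"
        by (rule prod.cong) (auto simp: g_eq inC)
      then show "(\<Prod>n\<in>{n\<in>\<Psi> w. g n = i}. f (pos n w)) = c i ^ point_count \<Psi> pos (C i) w"
        by (simp add: point_count_def g_eq)
    qed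
    finally show ?thesis .
  qed
  have meas: "(\<lambda>w. c i ^ point_count \<Psi> pos (C i) w) \<in> borel_measurable (process_sigma M \<Psi> pos)" for i
    by (rule measurable_compose[OF point_count_measurable_process[OF C_sets]]) simp
  have "(\<lambda>w. \<Prod>i<k. c i ^ point_count \<Psi> pos (C i) w) \<in> borel_measurable (process_sigma M \<Psi> pos)"
    using meas by (rule borel_measurable_prod)
  then show "(\<lambda>w. \<Prod>n\<in>\<Psi> w. f (pos n w)) \<in> borel_measurable (process_sigma M \<Psi> pos)"
    using measurable_cong[of "process_sigma M \<Psi> pos", OF prod_eq[folded space_process_sigma[of M \<Psi> pos]]]
    by (rule iffD2[rotated])
  have "indep_vars (\<lambda>_. count_space UNIV) (\<lambda>i. point_count \<Psi> pos (C i)) UNIV"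
    using pp C_sets disj unfolding poisson_process_def by blast
  then have "indep_vars (\<lambda>_. count_space UNIV) (\<lambda>i. point_count \<Psi> pos (C i)) {..<k}"
    by (rule indep_vars_subset) simp
  then have indep: "indep_vars (\<lambda>_. borel) (\<lambda>i w. c i ^ point_count \<Psi> pos (C i) w) {..<k}"
    by (rule indep_vars_compose2) simp
  have "expectation (\<lambda>w. \<Prod>n\<in>\<Psi> w. f (pos n w)) =
      expectation (\<lambda>w. \<Prod>i<k. c i ^ point_count \<Psi> pos (C i) w)"
    by (rule Bochner_Integration.integral_cong) (auto simp: prod_eq)
  also have "\<dots> = (\<Prod>i<k. expectation (\<lambda>w. c i ^ point_count \<Psi> pos (C i) w))"
  proof (rule indep_vars_lebesgue_integral[OF _ indep])
    fix i assume i: "i \<in> {..<k}"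
    show "integrable M (\<lambda>w. c i ^ point_count \<Psi> pos (C i) w)"
      by (rule integrable_const_bound[where B=1])
         (use poisson_process_measurable_sub[OF pp meas] cnorm i in \<open>auto simp: norm_power power_le_one\<close>)
  qed simp
  also have "\<dots> = (\<Prod>i<k. exp (- (of_real (measure \<Lambda> (C i)) * (1 - c i))))"
  proof (rule prod.cong[OF refl])
    fix i
    show "expectation (\<lambda>w. c i ^ point_count \<Psi> pos (C i) w) = exp (- (of_real (measure \<Lambda> (C i)) * (1 - c i)))"
      by (rule poisson_pgf_count[OF poisson_process_count_measurable[OF pp C_sets]])
         (use pp C_sets in \<open>auto simp: poisson_process_def\<close>)
  qed
  also have "\<dots> = exp (- (\<Sum>i<k. of_real (measure \<Lambda> (C i)) * (1 - c i)))"
    by (simp add: exp_sum[symmetric] sum_negf)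
  also have "(\<Sum>i<k. of_real (measure \<Lambda> (C i)) * (1 - c i)) =
      (\<Sum>i<k. \<integral>x. indicator (C i) x *\<^sub>R (1 - c i) \<partial>\<Lambda>)"
    by (simp add: sets_\<Lambda> space_\<Lambda> scaleR_conv_of_real \<Lambda>.emeasure_eq_measure)
  also have "\<dots> = (\<integral>x. (\<Sum>i<k. indicator (C i) x *\<^sub>R (1 - c i)) \<partial>\<Lambda>)"
    by (rule Bochner_Integration.integral_sum[symmetric])
       (simp add: sets_\<Lambda> \<Lambda>.emeasure_eq_measure)
  also have "\<dots> = (\<integral>x. 1 - f x \<partial>\<Lambda>)"
  proof (rule Bochner_Integration.integral_cong[OF refl])
    fix x
    obtain i where i: "i < k" "x \<in> C i" using cover by auto
    have "x \<notin> C l" if "l \<noteq> i" for l using disj i(2) that unfolding disjoint_family_on_def by blast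
    then have "(\<Sum>i<k. indicator (C i) x *\<^sub>R (1 - c i)) = (\<Sum>l<k. if l = i then 1 - c i else 0)"
      using i by (intro sum.cong) (auto simp: indicator_def)
    also have "\<dots> = 1 - f x" using i inC by simp
    finally show "(\<Sum>i<k. indicator (C i) x *\<^sub>R (1 - c i)) = 1 - f x" .
  qed
  finally show "expectation (\<lambda>w. \<Prod>n\<in>\<Psi> w. f (pos n w)) = exp (- (\<integral>x. 1 - f x \<partial>\<Lambda>))" .
qed

text \<open>Simple functions converging pointwise to \<open>f\<close> pass to the limit on both
  sides: each product is finite, and dominated convergence applies under \<open>M\<close> and under
  the finite measure \<open>\<Lambda>\<close>.\<close>

lemma poisson_process_pgf:
  fixes f :: "'p::topological_space \<Rightarrow> complex"
  assumes pp: "poisson_process M \<Lambda> \<Psi> pos" and sets_\<Lambda>: "sets \<Lambda> = sets borel"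
    and f: "f \<in> borel_measurable borel" "\<And>x. norm (f x) \<le> 1"
  shows "(\<lambda>w. \<Prod>n\<in>\<Psi> w. f (pos n w)) \<in> borel_measurable (process_sigma M \<Psi> pos)"
    and "expectation (\<lambda>w. \<Prod>n\<in>\<Psi> w. f (pos n w)) = exp (- (\<integral>x. 1 - f x \<partial>\<Lambda>))"
proof -
  interpret \<Lambda>: finite_measure \<Lambda> using pp by (simp add: poisson_process_def)
  obtain s where s: "\<And>i. simple_function borel (s i)" "\<And>x. (\<lambda>i. s i x) \<longlonglongrightarrow> f x"
    using borel_measurable_implies_sequence_metric[OF f(1), of 0] by auto
  \<comment> \<open>The approximations are pulled back into the closed unit disc, which provides the
    dominating constants; the limit stays \<open>f\<close> because \<open>f\<close> takes its values
    there.\<close>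
  define g where "g i x = s i x / of_real (max 1 (norm (s i x)))" for i x
  have s_meas: "s i \<in> borel_measurable borel" for i
    using s(1) by (rule borel_measurable_simple_function)
  have g_meas: "g i \<in> borel_measurable borel" for i
    unfolding g_def using s_meas by measurable
  have g_fin: "finite (range (g i))" for i
  proof -
    have "range (g i) = (\<lambda>y. y / of_real (max 1 (norm y))) ` range (s i)"
      by (auto simp: g_def)
    then show ?thesis using simple_functionD(1)[OF s(1), of i] by simp
  qed
  have g_norm: "norm (g i x) \<le> 1" for i x
    by (simp add: g_def norm_divide)
  have g_lim: "(\<lambda>i. g i x) \<longlonglongrightarrow> f x" for x
  proof -
    have "(\<lambda>i. g i x) \<longlonglongrightarrow> f x / of_real (max 1 (norm (f x)))"
      unfolding g_def by (intro tendsto_intros s) auto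
    then show ?thesis
      using f(2)[of x] by (simp add: max_absorb1)
  qed
  note simple = poisson_process_pgf_simple[OF pp sets_\<Lambda> g_meas g_fin g_norm]
  have lim: "(\<lambda>i. \<Prod>n\<in>\<Psi> w. g i (pos n w)) \<longlonglongrightarrow> (\<Prod>n\<in>\<Psi> w. f (pos n w))" for w
    by (intro tendsto_prod g_lim)
  show meas: "(\<lambda>w. \<Prod>n\<in>\<Psi> w. f (pos n w)) \<in> borel_measurable (process_sigma M \<Psi> pos)"
    by (rule borel_measurable_LIMSEQ_metric[OF simple(1) lim])
  have lim1: "(\<lambda>i. expectation (\<lambda>w. \<Prod>n\<in>\<Psi> w. g i (pos n w))) \<longlonglongrightarrow>
      expectation (\<lambda>w. \<Prod>n\<in>\<Psi> w. f (pos n w))"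
  proof (rule integral_dominated_convergence[where w="\<lambda>_. 1"])
    show "AE w in M. norm (\<Prod>n\<in>\<Psi> w. g i (pos n w)) \<le> 1" for i
      by (auto intro!: prod_le_1 simp: prod_norm[symmetric] g_norm)
  qed (use poisson_process_measurable_sub[OF pp simple(1)] poisson_process_measurable_sub[OF pp meas] lim in auto)
  have "(\<lambda>i. \<integral>x. 1 - g i x \<partial>\<Lambda>) \<longlonglongrightarrow> (\<integral>x. 1 - f x \<partial>\<Lambda>)"
  proof (rule integral_dominated_convergence[where w="\<lambda>_. 2"])
    have "norm (1 - g i x) \<le> 2" for i x
      using norm_triangle_ineq4[of 1 "g i x"] g_norm[of i x] by simp
    then show "AE x in \<Lambda>. norm (1 - g i x) \<le> 2" for i
      by simp
    have "f \<in> borel_measurable \<Lambda>" "g i \<in> borel_measurable \<Lambda>" for i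
      using f(1) g_meas measurable_cong_sets[OF sets_\<Lambda> refl] by auto
    then show "(\<lambda>x. 1 - f x) \<in> borel_measurable \<Lambda>" "\<And>i. (\<lambda>x. 1 - g i x) \<in> borel_measurable \<Lambda>"
      by measurable
    show "AE x in \<Lambda>. (\<lambda>i. 1 - g i x) \<longlonglongrightarrow> 1 - f x"
      by (intro AE_I2 tendsto_intros g_lim)
  qed simp
  then have "(\<lambda>i. exp (- (\<integral>x. 1 - g i x \<partial>\<Lambda>))) \<longlonglongrightarrow> exp (- (\<integral>x. 1 - f x \<partial>\<Lambda>))"
    by (intro tendsto_intros)
  then show "expectation (\<lambda>w. \<Prod>n\<in>\<Psi> w. f (pos n w)) = exp (- (\<integral>x. 1 - f x \<partial>\<Lambda>))"
    using lim1 unfolding simple(2) by (rule LIMSEQ_unique[OF _ , symmetric])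
qed

text \<open>Each factor is measurable with respect to the events of its own process, so the factors
  inherit the independence of these event families and the expectation splits.\<close>

lemma poisson_processes_pgf:
  fixes f :: "'i \<Rightarrow> 'p::topological_space \<Rightarrow> complex"
  assumes "finite J"
    and pp: "\<And>i. i \<in> J \<Longrightarrow> poisson_process M (\<Lambda> i) (\<Psi> i) pos"
    and sets_\<Lambda>: "\<And>i. i \<in> J \<Longrightarrow> sets (\<Lambda> i) = sets borel"
    and indep: "indep_sets (\<lambda>i. process_events M (\<Psi> i) pos) J"
    and f: "\<And>i. i \<in> J \<Longrightarrow> f i \<in> borel_measurable borel" "\<And>i x. i \<in> J \<Longrightarrow> norm (f i x) \<le> 1"
  shows "(\<lambda>w. \<Prod>i\<in>J. \<Prod>n\<in>\<Psi> i w. f i (pos n w)) \<in> borel_measurable M"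
    and "expectation (\<lambda>w. \<Prod>i\<in>J. \<Prod>n\<in>\<Psi> i w. f i (pos n w)) =
      exp (- (\<Sum>i\<in>J. \<integral>x. 1 - f i x \<partial>\<Lambda> i))"
proof -
  note pgf = poisson_process_pgf[OF pp sets_\<Lambda> f]
  have meas: "(\<lambda>w. \<Prod>n\<in>\<Psi> i w. f i (pos n w)) \<in> borel_measurable M" if "i \<in> J" for i
    by (rule poisson_process_measurable_sub[OF pp[OF that] pgf(1)[OF that that that that]])
  then show "(\<lambda>w. \<Prod>i\<in>J. \<Prod>n\<in>\<Psi> i w. f i (pos n w)) \<in> borel_measurable M"
    by (rule borel_measurable_prod)
  have iv: "indep_vars (\<lambda>_. borel) (\<lambda>i w. \<Prod>n\<in>\<Psi> i w. f i (pos n w)) J"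
    unfolding indep_vars_def
  proof (intro conjI ballI)
    fix i assume "i \<in> J"
    then show "random_variable borel (\<lambda>w. \<Prod>n\<in>\<Psi> i w. f i (pos n w))" by (rule meas)
  next
    show "indep_sets (\<lambda>i. sigma_sets (space M)
        {(\<lambda>w. \<Prod>n\<in>\<Psi> i w. f i (pos n w)) -` A \<inter> space M |A. A \<in> sets borel}) J"
      using indep
    proof (rule indep_sets_mono_sets)
      fix i assume i: "i \<in> J"
      show "sigma_sets (space M) {(\<lambda>w. \<Prod>n\<in>\<Psi> i w. f i (pos n w)) -` A \<inter> space M |A. A \<in> sets borel}
          \<subseteq> process_events M (\<Psi> i) pos"
      proof -
        have "{(\<lambda>w. \<Prod>n\<in>\<Psi> i w. f i (pos n w)) -` A \<inter> space M |A. A \<in> sets borel}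
            \<subseteq> sets (process_sigma M (\<Psi> i) pos)"
          using measurable_sets[OF pgf(1)[OF i i i i]] by auto
        from sets.sigma_sets_subset[OF this] show ?thesis
          by (simp add: sets_process_sigma)
      qed
    qed
  qed
  have "expectation (\<lambda>w. \<Prod>i\<in>J. \<Prod>n\<in>\<Psi> i w. f i (pos n w)) =
      (\<Prod>i\<in>J. expectation (\<lambda>w. \<Prod>n\<in>\<Psi> i w. f i (pos n w)))"
  proof (rule indep_vars_lebesgue_integral[OF \<open>finite J\<close> iv])
    fix i assume i: "i \<in> J"
    have "norm (\<Prod>n\<in>\<Psi> i w. f i (pos n w)) \<le> 1" for w
      unfolding prod_norm[symmetric] by (rule prod_le_1) (simp add: f(2)[OF i])
    then show "integrable M (\<lambda>w. \<Prod>n\<in>\<Psi> i w. f i (pos n w))"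
      by (intro integrable_const_bound[where B=1] AE_I2 meas[OF i])
  qed
  also have "\<dots> = (\<Prod>i\<in>J. exp (- (\<integral>x. 1 - f i x \<partial>\<Lambda> i)))"
    by (intro prod.cong refl pgf(2))
  also have "\<dots> = exp (- (\<Sum>i\<in>J. \<integral>x. 1 - f i x \<partial>\<Lambda> i))"
    using \<open>finite J\<close> by (simp only: exp_sum[symmetric] sum_negf)
  finally show "expectation (\<lambda>w. \<Prod>i\<in>J. \<Prod>n\<in>\<Psi> i w. f i (pos n w)) =
      exp (- (\<Sum>i\<in>J. \<integral>x. 1 - f i x \<partial>\<Lambda> i))" .
qed

end

section \<open>The hypergeometric function on the cut plane\<close>

abbreviation cut_plane :: "complex set" where
  "cut_plane \<equiv> - (complex_of_real ` {1..})"

lemma in_cut_plane_iff: "z \<in> cut_plane \<longleftrightarrow> \<not> (Im z = 0 \<and> 1 \<le> Re z)"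
proof -
  have "z \<in> complex_of_real ` {1..} \<longleftrightarrow> Im z = 0 \<and> 1 \<le> Re z"
    by (auto simp: image_iff complex_eq_iff)
  then show ?thesis by simp
qed

lemma open_cut_plane: "open cut_plane"
proof -
  have "complex_of_real ` {1..} = {z. Im z = 0} \<inter> {z. 1 \<le> Re z}"
    using in_cut_plane_iff by auto
  also have "closed \<dots>"
    by (intro closed_Int closed_Collect_eq closed_Collect_le continuous_intros)
  finally show ?thesis by (simp add: open_closed)
qed

lemma connected_cut_plane: "connected cut_plane"
proof (rule starlike_imp_connected)
  show "starlike cut_plane"
    unfolding starlike_def
  proof (intro bexI[of _ 0] ballI subsetI)
    fix x y assume x: "x \<in> cut_plane" and y: "y \<in> closed_segment 0 x"
    from y obtain u where u: "0 \<le> u" "u \<le> 1" "y = u *\<^sub>R x"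
      by (auto simp: in_segment)
    show "y \<in> cut_plane"
    proof (rule ccontr)
      assume "y \<notin> cut_plane"
      then have *: "u * Im x = 0" "1 \<le> u * Re x" unfolding in_cut_plane_iff u(3) by auto
      then have "u \<noteq> 0" by auto
      with * have "Im x = 0" by simp
      moreover have "1 \<le> Re x"
      proof (rule ccontr)
        assume "\<not> 1 \<le> Re x"
        then have "u * Re x < u * 1" using u \<open>u \<noteq> 0\<close> by (intro mult_strict_left_mono) auto
        then show False using * u by linarith
      qed
      ultimately show False using x unfolding in_cut_plane_iff by simp
    qed
  next
    show "0 \<in> cut_plane" unfolding in_cut_plane_iff by simp
  qed
qed

lemma ball_subset_cut_plane: "ball 0 1 \<subseteq> cut_plane"
proof
  fix z :: complex assume "z \<in> ball 0 1"
  then have "norm z < 1" by simp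
  then show "z \<in> cut_plane" using complex_Re_le_cmod[of z] by (auto simp: in_cut_plane_iff)
qed

lemma cut_plane_eqI:
  assumes "f holomorphic_on cut_plane" "g holomorphic_on cut_plane"
    and "\<And>z. z \<in> ball 0 1 \<Longrightarrow> f z = g z" and "z \<in> cut_plane"
  shows "f z = g z"
  by (rule analytic_continuation_open[OF open_ball open_cut_plane _ connected_cut_plane
        ball_subset_cut_plane assms(1,2)])
     (use assms(3,4) in auto)

text \<open>Evaluates the definite description: by the identity theorem on the connected cut plane,
  one holomorphic extension of the series determines the value.\<close>

lemma hypergeo_2F1_eq_continuation:
  assumes f: "f holomorphic_on cut_plane"
    and eq: "\<And>z. z \<in> ball 0 1 \<Longrightarrow> f z = eval_fps (fps_hypergeo [a, b] [c] 1) z"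
    and z: "z \<in> cut_plane"
  shows "hypergeo_2F1 a b c z = f z"
proof (cases "norm z < 1")
  case True
  then show ?thesis using eq by (simp add: hypergeo_2F1_def)
next
  case False
  have "(THE v. \<exists>f. f holomorphic_on cut_plane \<and>
                 (\<forall>y\<in>ball 0 1. f y = eval_fps (fps_hypergeo [a, b] [c] 1) y) \<and> f z = v) = f z"
  proof (rule the_equality)
    show "\<exists>fa. fa holomorphic_on cut_plane \<and>
        (\<forall>y\<in>ball 0 1. fa y = eval_fps (fps_hypergeo [a, b] [c] 1) y) \<and> fa z = f z"
      using f eq by blast
  next
    fix v
    assume "\<exists>fa. fa holomorphic_on cut_plane \<and>
        (\<forall>y\<in>ball 0 1. fa y = eval_fps (fps_hypergeo [a, b] [c] 1) y) \<and> fa z = v"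
    then obtain g where g: "g holomorphic_on cut_plane" "g z = v"
      "\<And>y. y \<in> ball 0 1 \<Longrightarrow> g y = eval_fps (fps_hypergeo [a, b] [c] 1) y" by blast
    have "g z = f z"
      using cut_plane_eqI[OF g(1) f _ z] g(3) eq by auto
    then show "v = f z" using g(2) by simp
  qed
  then show ?thesis using False by (simp add: hypergeo_2F1_def)
qed

section \<open>Hypergeometric series whose lower parameter exceeds an upper one by 1\<close>

lemma fps_hypergeo_shift_nth:
  fixes a b :: complex
  assumes "b \<notin> \<int>\<^sub>\<le>\<^sub>0"
  shows "fps_nth (fps_hypergeo [a, b] [1 + b] 1) n = pochhammer a n / fact n * (b / (of_nat n + b))"
proof -
  have nz: "of_nat n + b \<noteq> 0" for n
  proof
    assume "of_nat n + b = 0"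
    then have "b = - of_nat n" by (simp add: eq_neg_iff_add_eq_0 add.commute)
    then show False using assms by simp
  qed
  have b0: "b \<noteq> 0" using nz[of 0] by simp
  have "pochhammer (1 + b) n \<noteq> 0"
  proof
    assume "pochhammer (1 + b) n = 0"
    then obtain k where "1 + b = - of_nat k" by (auto simp: pochhammer_eq_0_iff)
    then have "1 + b + of_nat k = 0" by simp
    then have "of_nat (Suc k) + b = 0" by (simp add: add_ac)
    with nz[of "Suc k"] show False by simp
  qed
  moreover have "b * pochhammer (1 + b) n = (of_nat n + b) * pochhammer b n"
    using pochhammer_rec[of b n] pochhammer_rec'[of b n] by (simp add: add.commute)
  ultimately have *: "pochhammer b n / pochhammer (1 + b) n = b / (of_nat n + b)"
    using nz[of n] b0 by (simp add: field_simps)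
  have "fps_nth (fps_hypergeo [a, b] [1 + b] 1) n =
      pochhammer a n / fact n * (pochhammer b n / pochhammer (1 + b) n)"
    by simp
  then show ?thesis unfolding * .
qed

text \<open>The coefficients are bounded, because \<open>b / (n + b)\<close> tends to 0 and the
  Pochhammer quotient has norm at most 1; comparison with a geometric series suffices.\<close>

lemma fps_conv_radius_hypergeo_shift:
  fixes a b :: complex
  assumes b: "b \<notin> \<int>\<^sub>\<le>\<^sub>0" and a: "\<And>n. norm (pochhammer a n) \<le> fact n"
  shows "fps_conv_radius (fps_hypergeo [a, b] [1 + b] 1) \<ge> 1"
  unfolding fps_conv_radius_def
proof (rule conv_radius_geI_ex)
  fix r :: real assume r: "0 < r" "ereal r < 1"
  have "filterlim (\<lambda>n. b + of_nat n) at_infinity sequentially"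
    by (intro tendsto_add_filterlim_at_infinity[OF tendsto_const] tendsto_of_nat)
  then have "(\<lambda>n. b / (of_nat n + b)) \<longlonglongrightarrow> 0"
    by (intro tendsto_divide_0[OF tendsto_const]) (simp add: add.commute)
  then obtain B where B: "\<And>n. norm (b / (of_nat n + b)) \<le> B" "0 < B"
    by (meson BseqE convergentI convergent_imp_Bseq)
  have "summable (\<lambda>n. fps_nth (fps_hypergeo [a, b] [1 + b] 1) n * of_real r ^ n)"
  proof (rule summable_comparison_test')
    show "summable (\<lambda>n. B * r ^ n)" using r by (intro summable_mult summable_geometric) auto
    fix n :: nat
    have "norm (pochhammer a n / fact n * (b / (of_nat n + b))) \<le> 1 * B"
      unfolding norm_mult using a[of n] B(1)[of n] by (intro mult_mono) (auto simp: norm_divide)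
    then show "norm (fps_nth (fps_hypergeo [a, b] [1 + b] 1) n * of_real r ^ n) \<le> B * r ^ n"
      unfolding fps_hypergeo_shift_nth[OF b] norm_mult[of _ "of_real r ^ n"]
      using r B(2) by (intro mult_mono) (auto simp: norm_power)
  qed
  then show "\<exists>z. norm z = r \<and> summable (\<lambda>n. fps_nth (fps_hypergeo [a, b] [1 + b] 1) n * z ^ n)"
    using r by (intro exI[of _ "of_real r"]) auto
qed

text \<open>The operator \<open>z d/dz + b\<close> multiplies the n-th coefficient by
  \<open>n + b\<close> and so cancels the denominator \<open>n + b\<close>. What is left is
  \<open>b\<close> times the binomial series of \<open>(1 - z) powr (- a)\<close>. The case
  \<open>a = 1\<close> serves the radial integrals, the case \<open>a = 1/2\<close> the angular
  ones.\<close>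

lemma fps_hypergeo_shift_ode:
  fixes a b :: complex
  assumes b: "b \<notin> \<int>\<^sub>\<le>\<^sub>0" and a: "\<And>n. norm (pochhammer a n) \<le> fact n" and z: "norm z < 1"
  defines "F \<equiv> fps_hypergeo [a, b] [1 + b] 1"
  shows "z * deriv (eval_fps F) z + b * eval_fps F z = b * (\<Sum>n. pochhammer a n / fact n * z ^ n)"
proof -
  have rad: "fps_conv_radius F \<ge> 1"
    unfolding F_def by (rule fps_conv_radius_hypergeo_shift[OF b a])
  have z': "ereal (norm z) < fps_conv_radius F"
    using z rad by (metis ereal_less(3) less_le_trans one_ereal_def)
  have z'': "ereal (norm z) < fps_conv_radius (fps_deriv F)"
    using z' fps_conv_radius_deriv[of F] by (rule less_le_trans)
  have nz: "of_nat n + b \<noteq> 0" for n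
  proof
    assume "of_nat n + b = 0"
    then have "b = - of_nat n" by (simp add: eq_neg_iff_add_eq_0 add.commute)
    then show False using b by simp
  qed
  have "fps_X * fps_deriv F + fps_const b * F = fps_const b * Abs_fps (\<lambda>n. pochhammer a n / fact n)"
  proof (rule fps_ext)
    fix n
    have "fps_nth (fps_X * fps_deriv F + fps_const b * F) n = (of_nat n + b) * fps_nth F n"
      by (cases n) (simp_all add: algebra_simps)
    also have "\<dots> = b * (pochhammer a n / fact n)"
      unfolding F_def fps_hypergeo_shift_nth[OF b] using nz[of n] by simp
    finally show "fps_nth (fps_X * fps_deriv F + fps_const b * F) n =
        fps_nth (fps_const b * Abs_fps (\<lambda>n. pochhammer a n / fact n)) n" by simp
  qed
  then have "eval_fps (fps_X * fps_deriv F + fps_const b * F) z =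
      eval_fps (fps_const b * Abs_fps (\<lambda>n. pochhammer a n / fact n)) z" by simp
  moreover have "eval_fps (fps_X * fps_deriv F + fps_const b * F) z =
      z * deriv (eval_fps F) z + b * eval_fps F z"
  proof -
    have 1: "ereal (norm z) < fps_conv_radius (fps_X * fps_deriv F)"
      using fps_conv_radius_mult[of fps_X "fps_deriv F"] z'' by (simp add: less_le_trans)
    have 2: "ereal (norm z) < fps_conv_radius (fps_const b * F)"
      using fps_conv_radius_mult[of "fps_const b" F] z' by (simp add: less_le_trans)
    show ?thesis
      using z' z'' 1 2 by (simp add: eval_fps_add eval_fps_mult eval_fps_deriv)
  qed
  moreover have "eval_fps (fps_const b * Abs_fps (\<lambda>n. pochhammer a n / fact n)) z =
      b * (\<Sum>n. pochhammer a n / fact n * z ^ n)"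
  proof -
    have "summable (\<lambda>n. pochhammer a n / fact n * z ^ n)"
    proof (rule summable_comparison_test')
      show "summable (\<lambda>n. norm z ^ n)" using z by (intro summable_geometric) auto
      show "norm (pochhammer a n / fact n * z ^ n) \<le> norm z ^ n" for n
        using a[of n] mult_right_mono[of "norm (pochhammer a n) / fact n" 1 "norm z ^ n"]
        by (simp add: norm_mult norm_divide norm_power)
    qed
    then show ?thesis
      unfolding eval_fps_def by (subst suminf_mult[symmetric]) (simp_all add: mult.assoc)
  qed
  ultimately show ?thesis by simp
qed

lemma fps_hypergeo_1_ode:
  assumes "b \<notin> \<int>\<^sub>\<le>\<^sub>0" "norm z < 1"
  shows "z * deriv (eval_fps (fps_hypergeo [1, b] [1 + b] 1)) z +
    b * eval_fps (fps_hypergeo [1, b] [1 + b] 1) z = b / (1 - z :: complex)"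
  using fps_hypergeo_shift_ode[OF assms(1) _ assms(2), of 1] assms(2)
  by (simp add: pochhammer_fact[symmetric] suminf_geometric)

section \<open>Analytic continuation by a kernel integral\<close>

lemma cut_plane_factor_neq_0:
  assumes "z \<in> cut_plane" "0 \<le> t" "t \<le> (1::real)"
  shows "1 - z * of_real t \<noteq> 0"
proof
  assume "1 - z * of_real t = 0"
  then have *: "z * of_real t = 1" by simp
  then have t: "t \<noteq> 0" by auto
  with * have "z = of_real (1 / t)" by (simp add: field_simps)
  moreover have "1 / t \<ge> 1" using assms t by simp
  ultimately have "z \<in> complex_of_real ` {1..}" by (intro image_eqI[of _ _ "1 / t"]) auto
  then show False using assms(1) by blast
qed

text \<open>Differentiation under the integral sign. It is carried out on a ball around each point
  because the Leibniz rule asks for a convex domain; a positive \<open>\<mu>\<close> keeps the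
  weight continuous at 0.\<close>

lemma holomorphic_cauchy_kernel_integral:
  assumes \<mu>: "0 < \<mu>"
  shows "(\<lambda>z. integral {0..1} (\<lambda>t. of_real (t powr \<mu>) / (1 - z * of_real t))) holomorphic_on cut_plane"
proof (rule holomorphic_onI)
  let ?f = "\<lambda>z t. of_real (t powr \<mu>) / (1 - z * of_real t) :: complex"
  let ?fx = "\<lambda>z t. of_real (t powr \<mu>) * of_real t / (1 - z * of_real t)\<^sup>2 :: complex"
  fix z assume z: "z \<in> cut_plane"
  then obtain e where e: "e > 0" "ball z e \<subseteq> cut_plane"
    using open_cut_plane openE by blast
  have powr: "continuous_on {0..1} (\<lambda>t::real. t powr \<mu>)"
    using \<mu> by (intro continuous_on_powr' continuous_intros) auto
  have nz: "1 - x * of_real t \<noteq> 0" if "x \<in> ball z e" "t \<in> {0..1}" for x t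
    using that e cut_plane_factor_neq_0 by auto
  have "(\<lambda>x. integral (cbox 0 1) (?f x)) holomorphic_on ball z e"
  proof (rule leibniz_rule_holomorphic[where fx="?fx"])
    fix x :: complex and t :: real assume "x \<in> ball z e" "t \<in> cbox 0 1"
    then show "((\<lambda>x. ?f x t) has_field_derivative ?fx x t) (at x within ball z e)"
      using nz[of x t] by (auto intro!: derivative_eq_intros simp: power2_eq_square)
  next
    fix x assume x: "x \<in> ball z e"
    show "?f x integrable_on cbox 0 1"
      using nz[OF x] by (intro integrable_continuous) (auto intro!: continuous_intros powr)
  next
    have "continuous_on (ball z e \<times> {0..1}) (\<lambda>(x, t::real). t powr \<mu>)"
      unfolding case_prod_unfold
      by (rule continuous_on_compose2[OF powr]) (auto intro: continuous_intros)
    then have c: "continuous_on (ball z e \<times> {0..1}) (\<lambda>p. complex_of_real (snd p powr \<mu>))"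
      unfolding case_prod_unfold by (rule continuous_on_of_real)
    show "continuous_on (ball z e \<times> cbox 0 1) (\<lambda>(x, t). ?fx x t)"
      unfolding case_prod_unfold cbox_interval
    proof (intro continuous_on_divide continuous_on_mult c)
      show "\<forall>p\<in>ball z e \<times> {0..1::real}. (1 - fst p * of_real (snd p))\<^sup>2 \<noteq> 0"
        using nz by (metis mem_Times_iff power_not_zero)
    qed (intro continuous_intros)+
  qed simp
  then have "(\<lambda>x. integral (cbox 0 1) (?f x)) field_differentiable at z"
    by (rule holomorphic_on_imp_differentiable_at) (use e in auto)
  then show "(\<lambda>z. integral {0..1} (?f z)) field_differentiable at z within cut_plane"
    unfolding cbox_interval by (rule field_differentiable_at_within)
qed

text \<open>The geometric series of the kernel is integrated term by term; its remainder
  \<open>(z * t) ^ n / (1 - z * t)\<close> is at most \<open>norm z ^ n / (1 - norm z)\<close>,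
  uniformly in \<open>t\<close>.\<close>

lemma cauchy_kernel_integral_sums:
  fixes z :: complex
  assumes \<mu>: "0 < \<mu>" and z: "norm z < 1"
  shows "(\<lambda>k. z ^ k / (of_real \<mu> + of_nat k + 1)) sums
    integral {0..1} (\<lambda>t. of_real (t powr \<mu>) / (1 - z * of_real t))"
proof -
  have powr: "continuous_on {0..1} (\<lambda>t::real. t powr \<mu>)"
    using \<mu> by (intro continuous_on_powr' continuous_intros) auto
  have nz: "1 - z * of_real t \<noteq> 0" if "t \<in> {0..1}" for t
    using that z ball_subset_cut_plane by (intro cut_plane_factor_neq_0) auto
  let ?f = "\<lambda>t. of_real (t powr \<mu>) / (1 - z * of_real t) :: complex"
  let ?g = "\<lambda>k t. z ^ k * of_real (t powr \<mu> * t ^ k) :: complex"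
  have g_int: "integral {0..1} (?g k) = z ^ k / (of_real \<mu> + of_nat k + 1)" for k
  proof -
    have "((\<lambda>t. t powr (\<mu> + real k)) has_integral 1 / (\<mu> + real k + 1)) {0..1}"
      using has_integral_powr_from_0[of "\<mu> + real k" 1] \<mu> by simp
    then have "((\<lambda>t. t powr \<mu> * t ^ k) has_integral 1 / (\<mu> + real k + 1)) {0..1}"
      by (rule has_integral_spike[of "{0}", rotated 2]) (auto simp: powr_add powr_realpow)
    then have "((\<lambda>t. of_real (t powr \<mu> * t ^ k) :: complex) has_integral of_real (1 / (\<mu> + real k + 1))) {0..1}"
      by (rule has_integral_of_real)
    then have "(?g k has_integral z ^ k * of_real (1 / (\<mu> + real k + 1))) {0..1}"
      by (rule has_integral_mult_right)
    then have "integral {0..1} (?g k) = z ^ k * of_real (1 / (\<mu> + real k + 1))"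
      by (rule integral_unique)
    also have "\<dots> = z ^ k / (of_real \<mu> + of_nat k + 1)" by simp
    finally show ?thesis .
  qed
  have cont_g: "continuous_on {0..1} (?g k)" for k
    by (intro continuous_intros powr)
  have cont_f: "continuous_on {0..1} ?f"
    using nz by (intro continuous_intros powr) auto
  have bound: "norm (integral {0..1} ?f - (\<Sum>k<n. z ^ k / (of_real \<mu> + of_nat k + 1)))
      \<le> norm z ^ n / (1 - norm z)" for n
  proof -
    have "(\<Sum>k<n. z ^ k / (of_real \<mu> + of_nat k + 1)) = integral {0..1} (\<lambda>t. \<Sum>k<n. ?g k t)"
      unfolding g_int[symmetric]
      by (rule integral_sum[symmetric]) (use cont_g in \<open>auto intro: integrable_continuous_real\<close>)
    then have "integral {0..1} ?f - (\<Sum>k<n. z ^ k / (of_real \<mu> + of_nat k + 1)) =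
        integral {0..1} (\<lambda>t. ?f t - (\<Sum>k<n. ?g k t))"
      using cont_f cont_g
      by (simp add: integral_diff integrable_continuous_real continuous_on_sum)
    also have "norm \<dots> \<le> norm z ^ n / (1 - norm z) * (1 - 0)"
    proof (rule integral_bound)
      show "continuous_on {0..1} (\<lambda>t. ?f t - (\<Sum>k<n. ?g k t))"
        by (intro continuous_intros cont_f cont_g)
      fix t :: real assume t: "t \<in> {0..1}"
      have "?f t - (\<Sum>k<n. ?g k t) =
          of_real (t powr \<mu>) * (1 / (1 - z * of_real t) - (\<Sum>k<n. (z * of_real t) ^ k))"
        by (simp add: sum_distrib_left power_mult_distrib algebra_simps)
      also have "1 / (1 - z * of_real t) - (\<Sum>k<n. (z * of_real t) ^ k) =
          (1 - (1 - z * of_real t) * (\<Sum>k<n. (z * of_real t) ^ k)) / (1 - z * of_real t)"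
        using nz[OF t] by (simp add: diff_divide_distrib)
      also have "\<dots> = (z * of_real t) ^ n / (1 - z * of_real t)"
        by (simp add: one_diff_power_eq[symmetric])
      finally have "?f t - (\<Sum>k<n. ?g k t) = of_real (t powr \<mu>) * (z * of_real t) ^ n / (1 - z * of_real t)"
        by simp
      also have "norm \<dots> = t powr \<mu> * (norm z * t) ^ n / norm (1 - z * of_real t)"
        using t by (simp add: norm_mult norm_divide norm_power)
      also have "\<dots> \<le> norm z ^ n / (1 - norm z)"
      proof (rule frac_le)
        have "t powr \<mu> \<le> 1" using t \<mu> by (intro powr_le1) auto
        moreover have "(norm z * t) ^ n \<le> norm z ^ n"
          using t by (intro power_mono) (auto intro: mult_left_le)
        ultimately have "t powr \<mu> * (norm z * t) ^ n \<le> 1 * norm z ^ n"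
          using t by (intro mult_mono) auto
        then show "t powr \<mu> * (norm z * t) ^ n \<le> norm z ^ n" by simp
        have "norm (z * of_real t) \<le> norm z" using t by (simp add: norm_mult mult_left_le)
        then show "1 - norm z \<le> norm (1 - z * of_real t)"
          using norm_triangle_ineq2[of 1 "z * of_real t"] by simp
      qed (use z in auto)
      finally show "norm (?f t - (\<Sum>k<n. ?g k t)) \<le> norm z ^ n / (1 - norm z)" .
    qed simp
    finally show ?thesis by simp
  qed
  have "(\<lambda>n. norm z ^ n / (1 - norm z)) \<longlonglongrightarrow> 0 / (1 - norm z)"
    using z by (intro tendsto_divide tendsto_const LIMSEQ_power_zero) auto
  then have "(\<lambda>n. norm z ^ n / (1 - norm z)) \<longlonglongrightarrow> 0" by simp
  with always_eventually[OF allI[OF bound]]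
  have "(\<lambda>n. integral {0..1} ?f - (\<Sum>k<n. z ^ k / (of_real \<mu> + of_nat k + 1))) \<longlonglongrightarrow> 0"
    by (rule Lim_null_comparison)
  from tendsto_diff[OF tendsto_const[of "integral {0..1} ?f"] this]
  show ?thesis
    unfolding sums_def by simp
qed

text \<open>
  Euler's integral for \<open>\<^sub>2F\<^sub>1(1, s; 1 + s; \<cdot>)\<close> converges only for \<open>s > 0\<close>; splitting off the first \<open>m\<close> terms
  of the series raises \<open>s\<close> to \<open>s + m\<close>.
\<close>

lemma hypergeo_2F1_one_continuation:
  fixes s :: real
  assumes s: "of_real s \<notin> (\<int>\<^sub>\<le>\<^sub>0 :: complex set)"
  obtains f where "f holomorphic_on cut_plane"
    and "\<And>z. z \<in> cut_plane \<Longrightarrow> hypergeo_2F1 1 (of_real s) (of_real (1 + s)) z = f z"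
    and "\<And>z. z \<in> cut_plane \<Longrightarrow> z * deriv f z + of_real s * f z = of_real s / (1 - z)"
proof -
  let ?F = "fps_hypergeo [1, of_real s] [1 + of_real s] 1 :: complex fps"
  \<comment> \<open>Large enough for the exponent \<open>\<mu> = m + s - 1\<close> to be at least
    1.\<close>
  define m where "m = nat \<lceil>2 - s\<rceil>"
  have m: "0 < real m + s - 1" unfolding m_def by linarith
  define \<mu> where "\<mu> = real m + s - 1"
  \<comment> \<open>The part of the series from index \<open>m\<close> on is
    \<open>s * z ^ m\<close> times the sum of \<open>z ^ k / (k + m + s)\<close>, and
    \<open>k + m + s = \<mu> + k + 1\<close> is the denominator produced by the kernel
    integral.\<close>
  define f where "f z = (\<Sum>n<m. fps_nth ?F n * z ^ n) +
    of_real s * z ^ m * integral {0..1} (\<lambda>t. of_real (t powr \<mu>) / (1 - z * of_real t))" for z :: complex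
  have holo: "f holomorphic_on cut_plane"
    unfolding f_def using m by (intro holomorphic_intros holomorphic_cauchy_kernel_integral) (simp add: \<mu>_def)
  have nth: "fps_nth ?F n = of_real s / (of_nat n + of_real s)" for n
    unfolding fps_hypergeo_shift_nth[OF s] by (simp add: pochhammer_fact[symmetric])
  have rad: "fps_conv_radius ?F \<ge> 1"
    by (rule fps_conv_radius_hypergeo_shift[OF s]) (simp add: pochhammer_fact[symmetric])
  have eq: "f z = eval_fps ?F z" if "z \<in> ball 0 1" for z
  proof -
    have z: "norm z < 1" using that by simp
    have "ereal (norm z) < fps_conv_radius ?F"
      using z rad by (metis ereal_less(3) less_le_trans one_ereal_def)
    then have summable: "summable (\<lambda>n. fps_nth ?F n * z ^ n)"
      by (rule summable_fps)
    have "(\<lambda>k. of_real s * z ^ m * (z ^ k / (of_real \<mu> + of_nat k + 1))) sums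
        (of_real s * z ^ m * integral {0..1} (\<lambda>t. of_real (t powr \<mu>) / (1 - z * of_real t)))"
      using m z by (intro sums_mult cauchy_kernel_integral_sums) (auto simp: \<mu>_def)
    moreover have "of_real s * z ^ m * (z ^ k / (of_real \<mu> + of_nat k + 1)) =
        fps_nth ?F (k + m) * z ^ (k + m)" for k
      unfolding nth by (simp add: \<mu>_def power_add add_ac mult_ac)
    ultimately have "(\<lambda>k. fps_nth ?F (k + m) * z ^ (k + m)) sums
        (of_real s * z ^ m * integral {0..1} (\<lambda>t. of_real (t powr \<mu>) / (1 - z * of_real t)))"
      by simp
    then have "of_real s * z ^ m * integral {0..1} (\<lambda>t. of_real (t powr \<mu>) / (1 - z * of_real t)) =
        (\<Sum>k. fps_nth ?F (k + m) * z ^ (k + m))"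
      by (rule sums_unique)
    then show ?thesis
      unfolding f_def eval_fps_def using suminf_split_initial_segment[OF summable, of m] by simp
  qed
  \<comment> \<open>Known on the unit disc from the coefficients; both sides are holomorphic on the
    cut plane, so the equation continues to it.\<close>
  have ode: "z * deriv f z + of_real s * f z = of_real s / (1 - z)" if "z \<in> cut_plane" for z
  proof (rule cut_plane_eqI[where f="\<lambda>z. z * deriv f z + of_real s * f z" and g="\<lambda>z. of_real s / (1 - z)"])
    show "(\<lambda>z. z * deriv f z + of_real s * f z) holomorphic_on cut_plane"
      by (intro holomorphic_intros holo holomorphic_deriv[OF holo open_cut_plane])
    show "(\<lambda>z. of_real s / (1 - z)) holomorphic_on cut_plane"
    proof (intro holomorphic_intros)
      fix z assume "z \<in> cut_plane"
      then show "1 - z \<noteq> 0" using cut_plane_factor_neq_0[of z 1] by simp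
    qed
    fix z :: complex assume z: "z \<in> ball 0 1"
    have "deriv f z = deriv (eval_fps ?F) z"
    proof (rule deriv_cong_ev)
      show "\<forall>\<^sub>F w in nhds z. f w = eval_fps ?F w"
        using eventually_nhds_in_open[OF open_ball z] by eventually_elim (rule eq)
    qed simp
    then show "z * deriv f z + of_real s * f z = of_real s / (1 - z)"
      using fps_hypergeo_1_ode[OF s, of z] z eq[OF z] by simp
  qed (rule that)
  show thesis
  proof (rule that[OF holo _ ode])
    fix z assume "z \<in> cut_plane"
    then show "hypergeo_2F1 1 (of_real s) (of_real (1 + s)) z = f z"
      using hypergeo_2F1_eq_continuation[OF holo, of 1 "of_real s" "1 + of_real s" z] eq by simp
  qed
qed

section \<open>The radial integrals\<close>

text \<open>\<open>1 / (1 - \<i> * y)\<close> is the characteristic function of a unit exponential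
  variable. The first bound dominates the radial integrands, the second bounds the factor of a
  point, the third yields the Lipschitz estimate at frequency 0.\<close>

lemma norm_inverse_one_minus_imaginary:
  "norm (1 / (1 - \<i> * of_real y) - 1) \<le> 1" "norm (1 / (1 - \<i> * of_real y)) \<le> 1"
    "norm (1 / (1 - \<i> * of_real y) - 1) \<le> \<bar>y\<bar>"
proof -
  have ge1: "1 \<le> norm (1 - \<i> * of_real y)"
    using complex_Re_le_cmod[of "1 - \<i> * of_real y"] by simp
  have ge2: "\<bar>y\<bar> \<le> norm (1 - \<i> * of_real y)"
    using abs_Im_le_cmod[of "1 - \<i> * of_real y"] by simp
  have nz: "1 - \<i> * of_real y \<noteq> 0" using ge1 by auto
  then have "1 / (1 - \<i> * of_real y) - 1 = \<i> * of_real y / (1 - \<i> * of_real y)"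
    by (simp add: field_simps)
  then have eq: "norm (1 / (1 - \<i> * of_real y) - 1) = \<bar>y\<bar> / norm (1 - \<i> * of_real y)"
    by (simp add: norm_divide norm_mult)
  show "norm (1 / (1 - \<i> * of_real y) - 1) \<le> 1"
    unfolding eq using ge1 ge2 by (simp add: divide_le_eq)
  show "norm (1 / (1 - \<i> * of_real y)) \<le> 1"
    using ge1 by (simp add: norm_divide divide_le_eq)
  show "norm (1 / (1 - \<i> * of_real y) - 1) \<le> \<bar>y\<bar>"
    unfolding eq using ge1 mult_left_mono[OF ge1, of "\<bar>y\<bar>"] by (simp add: divide_le_eq)
qed

lemma imaginary_in_cut_plane: "\<i> * of_real y \<in> cut_plane"
  unfolding in_cut_plane_iff by simp

text \<open>Along \<open>x r = \<i> * c * r powr - b\<close> one has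
  \<open>r * x' = - b * x\<close>, so the differential equation of the hypergeometric function in
  \<open>x\<close> becomes a derivative in \<open>r\<close>. The lower limit is the distance at
  which the path loss equals \<open>L0\<close>, where \<open>x\<close> is
  \<open>\<i> * \<omega> / L0\<close>; at \<open>RD\<close> it is the argument of the second
  hypergeometric term.\<close>

lemma Delta_generic_eq_integral:
  fixes b RD \<eta> :: real
  assumes pos: "0 < \<kappa>" "0 < b" "0 < K" "0 < RD" "0 < L0" "0 \<le> \<eta>"
    and pole: "1 - (\<eta> + 2) / b \<notin> \<int>\<^sub>\<le>\<^sub>0"
    and le: "L0 * K ^ N / \<kappa> \<le> RD powr b"
  shows "Delta_generic \<kappa> b K RD \<eta> N \<omega> L0 = of_real (\<eta> + 2) *
    (LINT r|lborel. indicator {(L0 * K ^ N / \<kappa>) powr (1 / b)..RD} r *\<^sub>R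
      (of_real (r powr (\<eta> + 1)) * (1 / (1 - \<i> * of_real (\<omega> * K ^ N / \<kappa> * r powr - b)) - 1)))"
proof -
  define s where "s = - (\<eta> + 2) / b"
  define c where "c = \<omega> * K ^ N / \<kappa>"
  define u where "u = L0 * K ^ N / \<kappa>"
  have u: "0 < u" using pos by (simp add: u_def)
  have bs: "b * s = - (\<eta> + 2)" using pos by (simp add: s_def)
  \<comment> \<open>The pole condition concerns \<open>1 + s\<close>, the differential equation
    needs it for \<open>s\<close>. As \<open>s\<close> is negative, a nonpositive integer
    \<open>s\<close> would make \<open>1 + s\<close> one too.\<close>
  have "s \<notin> \<int>\<^sub>\<le>\<^sub>0"
  proof
    assume "s \<in> \<int>\<^sub>\<le>\<^sub>0"
    then obtain n where n: "s = - of_nat n" by (auto elim: nonpos_Ints_cases')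
    have "s < 0" using pos by (simp add: s_def divide_neg_pos)
    with n have "n \<noteq> 0" by auto
    then have "1 + s = - of_nat (n - 1)" using n by (simp add: of_nat_diff)
    then have "1 + s \<in> \<int>\<^sub>\<le>\<^sub>0" by simp
    moreover have "1 + s = 1 - (\<eta> + 2) / b"
      unfolding s_def by (simp only: diff_conv_add_uminus minus_divide_left)
    ultimately show False using pole by simp
  qed
  then have "of_real s \<notin> (\<int>\<^sub>\<le>\<^sub>0 :: complex set)"
    by (simp add: of_real_in_nonpos_Ints_iff)
  then obtain f where f: "f holomorphic_on cut_plane"
    "\<And>z. z \<in> cut_plane \<Longrightarrow> hypergeo_2F1 1 (of_real s) (of_real (1 + s)) z = f z"
    "\<And>z. z \<in> cut_plane \<Longrightarrow> z * deriv f z + of_real s * f z = of_real s / (1 - z)"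
    using hypergeo_2F1_one_continuation by blast
  define x where "x r = \<i> * of_real (c * r powr - b)" for r :: real
  define H where "H r = of_real (r powr (\<eta> + 2)) * (f (x r) - 1)" for r :: real
  define G where "G r = of_real (r powr (\<eta> + 1)) * (1 / (1 - x r) - 1)" for r :: real
  have x_cut: "x r \<in> cut_plane" for r unfolding x_def by (rule imaginary_in_cut_plane)
  have r0: "0 < u powr (1 / b)" using u by simp
  have r0_le: "u powr (1 / b) \<le> RD"
  proof -
    have "u powr (1 / b) \<le> (RD powr b) powr (1 / b)"
      using le u pos by (intro powr_mono2) (auto simp: u_def)
    then show ?thesis using pos by (simp add: powr_powr)
  qed
  have H_deriv: "(H has_vector_derivative of_real (\<eta> + 2) * G r) (at r)" if r: "0 < r" for r
  proof -
    have "((\<lambda>r. c * r powr - b) has_real_derivative c * (- b * r powr (- b - 1))) (at r)"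
      using r by (auto intro!: derivative_eq_intros)
    moreover have "r powr (- b - 1) = r powr - b / r"
      using r by (simp add: powr_diff)
    ultimately have "((\<lambda>r. c * r powr - b) has_real_derivative (- b / r * (c * r powr - b))) (at r)"
      by (simp add: mult_ac)
    then have "((\<lambda>r. of_real (c * r powr - b) :: complex) has_vector_derivative of_real (- b / r * (c * r powr - b))) (at r)"
      by (rule has_vector_derivative_of_real)
    then have "(x has_vector_derivative \<i> * of_real (- b / r * (c * r powr - b))) (at r)"
      unfolding x_def by (rule has_vector_derivative_mult_right)
    then have dx: "(x has_vector_derivative of_real (- b / r) * x r) (at r)"
      by (simp add: x_def mult_ac)
    have "(f has_field_derivative deriv f (x r)) (at (x r))"
      by (rule holomorphic_derivI[OF f(1) open_cut_plane x_cut])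
    from field_vector_diff_chain_at[OF dx this]
    have dfx: "((\<lambda>r. f (x r) - 1) has_vector_derivative (of_real (- b / r) * x r * deriv f (x r))) (at r)"
      using has_vector_derivative_diff[OF _ has_vector_derivative_const] by (fastforce simp: o_def)
    have "((\<lambda>r. r powr (\<eta> + 2)) has_real_derivative ((\<eta> + 2) * r powr (\<eta> + 1))) (at r)"
      using r by (auto intro!: derivative_eq_intros simp: add.commute)
    then have "((\<lambda>r. of_real (r powr (\<eta> + 2)) :: complex) has_vector_derivative of_real ((\<eta> + 2) * r powr (\<eta> + 1))) (at r)"
      by (rule has_vector_derivative_of_real)
    from has_vector_derivative_mult[OF this dfx]
    have dH: "(H has_vector_derivative (of_real (r powr (\<eta> + 2)) * (of_real (- b / r) * x r * deriv f (x r)) +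
        of_real ((\<eta> + 2) * r powr (\<eta> + 1)) * (f (x r) - 1))) (at r)"
      unfolding H_def .
    have "r powr (\<eta> + 2) = r * r powr (\<eta> + 1)"
      using r by (simp add: powr_add power2_eq_square powr_numeral)
    then have "of_real (r powr (\<eta> + 2)) * (of_real (- b / r) * x r * deriv f (x r)) =
        - of_real (r powr (\<eta> + 1)) * of_real b * (x r * deriv f (x r))"
      using r by simp
    also have "x r * deriv f (x r) = of_real s / (1 - x r) - of_real s * f (x r)"
      using f(3)[OF x_cut, of r] by (simp add: algebra_simps)
    also have "- of_real (r powr (\<eta> + 1)) * of_real b * (of_real s / (1 - x r) - of_real s * f (x r)) =
        - of_real (r powr (\<eta> + 1)) * (of_real (b * s) * (1 / (1 - x r) - f (x r)))"
      by (simp add: algebra_simps)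
    finally have "of_real (r powr (\<eta> + 2)) * (of_real (- b / r) * x r * deriv f (x r)) =
        of_real (r powr (\<eta> + 1)) * of_real (\<eta> + 2) * (1 / (1 - x r) - f (x r))"
      unfolding bs of_real_minus by (simp only: mult_minus_left mult_minus_right minus_minus mult.assoc)
    \<comment> \<open>Because \<open>b * s = - (\<eta> + 2)\<close>, the two terms containing
      \<open>f (x r)\<close> cancel and only the elementary kernel survives.\<close>
    moreover have "P * Q * (R - F) + Q * P * (F - 1) = Q * (P * (R - 1))" for P Q R F :: complex
      by (simp add: algebra_simps)
    ultimately have "of_real (r powr (\<eta> + 2)) * (of_real (- b / r) * x r * deriv f (x r)) +
        of_real ((\<eta> + 2) * r powr (\<eta> + 1)) * (f (x r) - 1) = of_real (\<eta> + 2) * G r"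
      unfolding G_def of_real_mult by (simp only:)
    with dH show ?thesis by simp
  qed
  have G_cont: "continuous_on {u powr (1 / b)..RD} (\<lambda>r. of_real (\<eta> + 2) * G r)"
    unfolding G_def x_def using r0 cut_plane_factor_neq_0[OF imaginary_in_cut_plane, of 1]
    by (intro continuous_intros) auto
  have "(LINT r|lborel. indicator {u powr (1 / b)..RD} r *\<^sub>R (of_real (\<eta> + 2) * G r)) =
      H RD - H (u powr (1 / b))"
  proof (rule integral_FTC_Icc[OF r0_le _ G_cont])
    fix r assume "u powr (1 / b) \<le> r"
    with r0 have "0 < r" by (rule less_le_trans)
    then show "(H has_vector_derivative of_real (\<eta> + 2) * G r) (at r within {u powr (1 / b)..RD})"
      by (rule has_vector_derivative_at_within[OF H_deriv])
  qed
  moreover have "H RD - H (u powr (1 / b)) = Delta_generic \<kappa> b K RD \<eta> N \<omega> L0"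
  proof -
    have "x (u powr (1 / b)) = \<i> * of_real \<omega> / of_real L0"
      using pos by (simp add: x_def powr_powr c_def u_def powr_minus field_simps)
    moreover have "x RD = \<i> * of_real \<omega> * of_real (K ^ N) / of_real (RD powr b * \<kappa>)"
      using pos by (simp add: x_def c_def powr_minus field_simps)
    moreover have "(u powr (1 / b)) powr (\<eta> + 2) = u powr ((\<eta> + 2) / b)"
      by (simp add: powr_powr)
    moreover have "1 - (\<eta> + 2) / b = 1 + s"
      unfolding s_def by (simp only: diff_conv_add_uminus minus_divide_left)
    ultimately have "Delta_generic \<kappa> b K RD \<eta> N \<omega> L0 =
        of_real ((u powr (1 / b)) powr (\<eta> + 2)) * (1 - f (x (u powr (1 / b)))) -
        of_real (RD powr (\<eta> + 2)) * (1 - f (x RD))"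
      unfolding Delta_generic_def f(2)[OF x_cut, symmetric] by (simp only: s_def[symmetric] u_def[symmetric])
    then show ?thesis by (simp add: H_def algebra_simps)
  qed
  ultimately have "Delta_generic \<kappa> b K RD \<eta> N \<omega> L0 =
      (LINT r|lborel. of_real (\<eta> + 2) * (indicator {u powr (1 / b)..RD} r *\<^sub>R G r))"
    by (simp only: mult_scaleR_right)
  also have "\<dots> = of_real (\<eta> + 2) * (LINT r|lborel. indicator {u powr (1 / b)..RD} r *\<^sub>R G r)"
    by (rule integral_mult_right_zero)
  finally show ?thesis
    unfolding G_def x_def c_def u_def .
qed

text \<open>Unlike the closed form, the integral has no poles in the exponent. Its continuity
  identifies the limit by which \<open>Delta\<close> is defined at the exceptional
  exponents.\<close>

lemma Delta_integral_continuous: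
  fixes u c RD \<eta> :: real
  assumes pos: "0 < \<beta>" "0 < u" "0 \<le> \<eta>"
  shows "((\<lambda>b. LINT r|lborel. indicator {u powr (1 / b)..RD} r *\<^sub>R
      (of_real (r powr (\<eta> + 1)) * (1 / (1 - \<i> * of_real (c * r powr - b)) - 1))) \<longlongrightarrow>
    (LINT r|lborel. indicator {u powr (1 / \<beta>)..RD} r *\<^sub>R
      (of_real (r powr (\<eta> + 1)) * (1 / (1 - \<i> * of_real (c * r powr - \<beta>)) - 1)))) (at \<beta>)"
  unfolding tendsto_at_iff_sequentially comp_def
proof (intro allI impI)
  fix X :: "nat \<Rightarrow> real" assume "X \<longlonglongrightarrow> \<beta>"
  let ?g = "\<lambda>b r. indicator {u powr (1 / b)..RD} r *\<^sub>R
      (of_real (r powr (\<eta> + 1)) * (1 / (1 - \<i> * of_real (c * r powr - b)) - 1)) :: complex"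
  have r0_lim: "(\<lambda>i. u powr (1 / X i)) \<longlonglongrightarrow> u powr (1 / \<beta>)"
    using pos by (intro tendsto_intros \<open>X \<longlonglongrightarrow> \<beta>\<close>) auto
  show "(\<lambda>i. LINT r|lborel. ?g (X i) r) \<longlonglongrightarrow> (LINT r|lborel. ?g \<beta> r)"
  proof (rule integral_dominated_convergence[where w="\<lambda>r. indicator {0..RD} r *\<^sub>R (RD powr (\<eta> + 1))"])
    show "integrable lborel (\<lambda>r. indicator {0..RD} r *\<^sub>R (RD powr (\<eta> + 1)))"
      by (intro integrable_scaleR_left) (simp add: emeasure_lborel_Icc_eq)
    show "AE r in lborel. norm (?g (X i) r) \<le> indicator {0..RD} r *\<^sub>R (RD powr (\<eta> + 1))" for i
    proof (intro AE_I2)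
      fix r
      show "norm (?g (X i) r) \<le> indicator {0..RD} r *\<^sub>R (RD powr (\<eta> + 1))"
      proof (cases "r \<in> {u powr (1 / X i)..RD}")
        case True
        then have r: "0 \<le> r" "r \<le> RD" using powr_ge_zero[of u "1 / X i"] by (auto simp del: powr_ge_zero)
        have "norm (of_real (r powr (\<eta> + 1)) * (1 / (1 - \<i> * of_real (c * r powr - X i)) - 1)) \<le>
            RD powr (\<eta> + 1) * 1"
          unfolding norm_mult using r pos
          by (intro mult_mono norm_inverse_one_minus_imaginary(1)) (auto intro: powr_mono2)
        then show ?thesis using True r by simp
      qed (auto simp: indicator_def)
    qed
    \<comment> \<open>The lower endpoint moves with the exponent, so the indicators need not
      converge at its limit position; this single point is null.\<close>
    show "AE r in lborel. (\<lambda>i. ?g (X i) r) \<longlonglongrightarrow> ?g \<beta> r"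
      using AE_lborel_singleton[of "u powr (1 / \<beta>)"]
    proof eventually_elim
      fix r assume ne: "r \<noteq> u powr (1 / \<beta>)"
      show "(\<lambda>i. ?g (X i) r) \<longlonglongrightarrow> ?g \<beta> r"
      proof (cases "r < u powr (1 / \<beta>)")
        case True
        from order_tendstoD(1)[OF r0_lim True]
        have "\<forall>\<^sub>F i in sequentially. ?g (X i) r = ?g \<beta> r"
          by eventually_elim (use True in simp)
        then show ?thesis by (rule tendsto_eventually)
      next
        case False
        then have gt: "u powr (1 / \<beta>) < r" using ne by simp
        then have "0 < r" using powr_ge_zero[of u "1 / \<beta>"] by linarith
        from order_tendstoD(2)[OF r0_lim gt]
        have "\<forall>\<^sub>F i in sequentially. indicator {u powr (1 / X i)..RD} r = (indicator {u powr (1 / \<beta>)..RD} r :: real)"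
          by eventually_elim (use gt in \<open>simp add: indicator_def\<close>)
        then have "(\<lambda>i. indicator {u powr (1 / X i)..RD} r) \<longlonglongrightarrow> (indicator {u powr (1 / \<beta>)..RD} r :: real)"
          by (rule tendsto_eventually)
        moreover have "1 - \<i> * of_real y \<noteq> 0" for y
          using cut_plane_factor_neq_0[OF imaginary_in_cut_plane, of 1] by simp
        ultimately show ?thesis
          using \<open>0 < r\<close> by (intro tendsto_intros \<open>X \<longlonglongrightarrow> \<beta>\<close>) auto
      qed
    qed
  qed measurable
qed

text \<open>Exceptional exponents are isolated: if \<open>1 - a / \<beta>\<close> is an integer,
  nearby values within distance 1 could be integers only by equality, which forces
  \<open>b = \<beta>\<close>; otherwise the complement of the integers is an open neighbourhood of
  it.\<close>

lemma eventually_not_nonpos_Ints_at: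
  fixes \<beta> a :: real
  assumes "0 < \<beta>" "0 < a"
  shows "\<forall>\<^sub>F b in at \<beta>. 1 - a / b \<notin> \<int>\<^sub>\<le>\<^sub>0"
proof (cases "1 - a / \<beta> \<in> \<int>")
  case False
  have "((\<lambda>b. 1 - a / b) \<longlongrightarrow> 1 - a / \<beta>) (at \<beta>)"
    using assms by (intro tendsto_intros) auto
  moreover have "open (- (\<int> :: real set))" by (simp add: closed_Ints open_Compl)
  moreover have "1 - a / \<beta> \<in> - \<int>" using False by blast
  ultimately have "\<forall>\<^sub>F b in at \<beta>. 1 - a / b \<in> - \<int>"
    by (rule topological_tendstoD)
  then show ?thesis
    by eventually_elim (use nonpos_Ints_Int in auto)
next
  case True
  have "((\<lambda>b. 1 - a / b) \<longlongrightarrow> 1 - a / \<beta>) (at \<beta>)"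
    using assms by (intro tendsto_intros) auto
  then have "\<forall>\<^sub>F b in at \<beta>. dist (1 - a / b) (1 - a / \<beta>) < 1"
    by (rule tendstoD) simp
  moreover have "\<forall>\<^sub>F b in at \<beta>. b \<noteq> \<beta>" by (simp add: eventually_at_filter)
  moreover have "\<forall>\<^sub>F b in at \<beta>. b > 0"
    using assms(1) by (intro order_tendstoD[OF tendsto_ident_at])
  ultimately show ?thesis
  proof eventually_elim
    fix b assume b: "dist (1 - a / b) (1 - a / \<beta>) < 1" "b \<noteq> \<beta>" "b > 0"
    show "1 - a / b \<notin> \<int>\<^sub>\<le>\<^sub>0"
    proof
      assume "1 - a / b \<in> \<int>\<^sub>\<le>\<^sub>0"
      then have "1 - a / b \<in> \<int>" by (rule nonpos_Ints_Int)
      with True b(1) have "1 - a / b = 1 - a / \<beta>"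
        by (elim Ints_cases) (simp add: dist_real_def flip: of_int_diff of_int_abs)
      then show False using b assms by (simp add: field_simps)
    qed
  qed
qed

text \<open>Strictness of \<open>less\<close> persists for exponents near \<open>\<beta>\<close>, so
  the generic formula holds in a punctured neighbourhood and the limit can be taken there.\<close>

lemma Delta_eq_integral:
  fixes \<beta> \<kappa> K RD \<eta> \<omega> L0 :: real
  assumes pos: "0 < \<kappa>" "0 < \<beta>" "0 < K" "0 < RD" "0 < L0" "0 \<le> \<eta>"
    and less: "L0 * K ^ N / \<kappa> < RD powr \<beta>"
  shows "Delta \<kappa> \<beta> K RD \<eta> N \<omega> L0 = of_real (\<eta> + 2) *
    (LINT r|lborel. indicator {(L0 * K ^ N / \<kappa>) powr (1 / \<beta>)..RD} r *\<^sub>R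
      (of_real (r powr (\<eta> + 1)) * (1 / (1 - \<i> * of_real (\<omega> * K ^ N / \<kappa> * r powr - \<beta>)) - 1)))"
    (is "_ = ?I \<beta>")
proof (cases "1 - (\<eta> + 2) / \<beta> \<in> \<int>\<^sub>\<le>\<^sub>0")
  case False
  then show ?thesis
    using Delta_generic_eq_integral[OF pos False] less by (simp add: Delta_def)
next
  case True
  have "\<forall>\<^sub>F b in at \<beta>. 0 < b"
    using pos by (intro order_tendstoD[OF tendsto_ident_at])
  moreover have "\<forall>\<^sub>F b in at \<beta>. 1 - (\<eta> + 2) / b \<notin> \<int>\<^sub>\<le>\<^sub>0"
    using pos by (intro eventually_not_nonpos_Ints_at) auto
  moreover have "((\<lambda>b. RD powr b) \<longlongrightarrow> RD powr \<beta>) (at \<beta>)"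
    using pos by (intro tendsto_intros) auto
  then have "\<forall>\<^sub>F b in at \<beta>. L0 * K ^ N / \<kappa> < RD powr b"
    using less by (rule order_tendstoD)
  ultimately have ev: "\<forall>\<^sub>F b in at \<beta>. ?I b = Delta_generic \<kappa> b K RD \<eta> N \<omega> L0"
    by eventually_elim (rule Delta_generic_eq_integral[symmetric], use pos in auto)
  have "(?I \<longlongrightarrow> ?I \<beta>) (at \<beta>)"
    using pos by (intro tendsto_mult tendsto_const Delta_integral_continuous) auto
  then have "((\<lambda>b. Delta_generic \<kappa> b K RD \<eta> N \<omega> L0) \<longlongrightarrow> ?I \<beta>) (at \<beta>)"
    by (rule Lim_transform_eventually[OF _ ev])
  then show ?thesis
    using True tendsto_Lim[OF trivial_limit_at] by (simp add: Delta_def)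
qed

text \<open>In the first term \<open>0 powr\<close> vanishes; in the second the hypergeometric
  argument is 0, where the series has the value 1.\<close>

lemma Delta_K_0:
  assumes "K ^ N = (0::real)" "0 < \<beta>" "0 \<le> \<eta>"
  shows "Delta \<kappa> \<beta> K RD \<eta> N \<omega> L0 = 0"
proof -
  have "Delta_generic \<kappa> b K RD \<eta> N \<omega> L0 = 0" for b
    unfolding Delta_generic_def assms(1) by (simp add: hypergeo_2F1_def eval_fps_at_0)
  then show ?thesis
    unfolding Delta_def using tendsto_Lim[OF trivial_limit_at[of \<beta>] tendsto_const[of "0 :: complex"]] by simp
qed

section \<open>The angular integrals\<close>

text \<open>The difference of the two integrands is the derivative of
  \<open>sin x * cos x ^ Suc n\<close>, which vanishes at both ends.\<close>

lemma integral_cos_power_Suc_Suc: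
  "real (Suc (Suc n)) * integral {0..pi/2} (\<lambda>x. cos x ^ Suc (Suc n)) =
   real (Suc n) * integral {0..pi/2} (\<lambda>x. cos x ^ n)"
proof -
  have "((\<lambda>x. real (Suc (Suc n)) * cos x ^ Suc (Suc n) - real (Suc n) * cos x ^ n) has_integral
      sin (pi/2) * cos (pi/2) ^ Suc n - sin 0 * cos 0 ^ Suc n) {0..pi/2}"
  proof (rule fundamental_theorem_of_calculus)
    fix x :: real
    have "((\<lambda>x. sin x * cos x ^ Suc n) has_real_derivative
        cos x * cos x ^ Suc n + real (Suc n) * cos x ^ n * (- sin x) * sin x) (at x within {0..pi/2})"
      by (rule derivative_eq_intros refl | simp)+
    moreover have "cos x * cos x ^ Suc n + real (Suc n) * cos x ^ n * (- sin x) * sin x =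
        cos x ^ Suc (Suc n) - real (Suc n) * cos x ^ n * (sin x)\<^sup>2"
      by (simp add: power2_eq_square algebra_simps)
    moreover have "\<dots> = real (Suc (Suc n)) * cos x ^ Suc (Suc n) - real (Suc n) * cos x ^ n"
      unfolding sin_squared_eq by (simp add: power2_eq_square algebra_simps)
    ultimately show "((\<lambda>x. sin x * cos x ^ Suc n) has_vector_derivative
        real (Suc (Suc n)) * cos x ^ Suc (Suc n) - real (Suc n) * cos x ^ n) (at x within {0..pi/2})"
      by (simp only: has_real_derivative_iff_has_vector_derivative)
  qed simp
  moreover have "((\<lambda>x. real (Suc (Suc n)) * cos x ^ Suc (Suc n) - real (Suc n) * cos x ^ n) has_integral
      real (Suc (Suc n)) * integral {0..pi/2} (\<lambda>x. cos x ^ Suc (Suc n)) -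
      real (Suc n) * integral {0..pi/2} (\<lambda>x. cos x ^ n)) {0..pi/2}"
    by (intro has_integral_diff has_integral_mult_right integrable_integral
        integrable_continuous_real continuous_intros)
  ultimately have "sin (pi/2) * cos (pi/2) ^ Suc n - sin 0 * cos 0 ^ Suc n =
      real (Suc (Suc n)) * integral {0..pi/2} (\<lambda>x. cos x ^ Suc (Suc n)) -
      real (Suc n) * integral {0..pi/2} (\<lambda>x. cos x ^ n)"
    by (rule has_integral_unique)
  then show ?thesis by simp
qed

text \<open>By the functional equation of Gamma both sides obey the same recursion in steps of two,
  so the values at 0 and 1 decide.\<close>

lemma integral_cos_power:
  "integral {0..pi/2} (\<lambda>x. cos x ^ n) =
   sqrt pi * Gamma ((real n + 1) / 2) / (2 * Gamma ((real n + 2) / 2))"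
proof (induction n rule: induct_nat_012)
  case 0
  show ?case by (simp add: Gamma_one_half_real)
next
  case 1
  have "((\<lambda>x. cos x) has_integral sin (pi/2) - sin 0) {0..pi/2}"
    by (rule fundamental_theorem_of_calculus)
       (auto intro!: derivative_eq_intros simp flip: has_real_derivative_iff_has_vector_derivative)
  then have "integral {0..pi/2} (\<lambda>x. cos x) = 1"
    by (simp add: integral_unique)
  moreover have G: "Gamma (3 / 2 :: real) = sqrt pi / 2"
  proof -
    have "(1/2 :: real) \<notin> \<int>\<^sub>\<le>\<^sub>0" using nonpos_Ints_nonpos by fastforce
    from Gamma_plus1[OF this] show ?thesis by (simp add: Gamma_one_half_real)
  qed
  ultimately show ?case by (simp add: G)
next
  case (ge2 n)
  have 1: "Gamma ((real n + 1) / 2 + 1) = (real n + 1) / 2 * Gamma ((real n + 1) / 2)"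
    and 2: "Gamma ((real n + 2) / 2 + 1) = (real n + 2) / 2 * Gamma ((real n + 2) / 2)"
    by (intro Gamma_plus1; auto elim!: nonpos_Ints_cases' simp: field_simps)+
  have "Gamma ((real n + 2) / 2) > 0" by (rule Gamma_real_pos) simp
  have "integral {0..pi/2} (\<lambda>x. cos x ^ Suc (Suc n)) =
      (real n + 1) / (real n + 2) * integral {0..pi/2} (\<lambda>x. cos x ^ n)"
    using integral_cos_power_Suc_Suc[of n] by (simp add: field_simps)
  also have "\<dots> = sqrt pi * ((real n + 1) / 2 * Gamma ((real n + 1) / 2)) /
      (2 * ((real n + 2) / 2 * Gamma ((real n + 2) / 2)))"
  proof -
    have "a / c * (s * g / (2 * h)) = s * (a / 2 * g) / (2 * (c / 2 * h))" for a c s g h :: real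
      by (cases "c = 0"; cases "h = 0") (auto simp: field_simps)
    then show ?thesis unfolding ge2 .
  qed
  also have "\<dots> = sqrt pi * Gamma ((real (Suc (Suc n)) + 1) / 2) / (2 * Gamma ((real (Suc (Suc n)) + 2) / 2))"
    unfolding 1[symmetric] 2[symmetric] by (simp add: field_simps)
  finally show ?case .
qed

section \<open>The incomplete sine integral as a hypergeometric value\<close>

lemma norm_pochhammer_half_le: "norm (pochhammer (1 / 2 :: complex) n) \<le> fact n"
proof (induction n)
  case (Suc n)
  have "norm (1 / 2 + of_nat n :: complex) \<le> real (Suc n)"
    using norm_triangle_ineq[of "1 / 2" "of_nat n :: complex"] by simp
  with Suc show ?case
    by (simp add: pochhammer_Suc norm_mult mult.commute mult_mono del: of_nat_Suc)
qed simp

text \<open>The binomial series with exponent -1/2, which is the right-hand side of the differential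
  equation for \<open>a = 1/2\<close>; at \<open>u = sin\<^sup>2\<close> it becomes the reciprocal
  cosine.\<close>

lemma pochhammer_half_sums:
  assumes "0 \<le> u" "u < (1::real)"
  shows "(\<lambda>n. pochhammer (1 / 2) n / fact n * (of_real u :: complex) ^ n) sums of_real (1 / sqrt (1 - u))"
proof -
  have "(\<lambda>n. ((- 1 / 2) gchoose n) * (- u) ^ n) sums (1 + - u) powr (- 1 / 2)"
    using assms by (intro gen_binomial_real) auto
  moreover have "((- 1 / 2) gchoose n) * (- u) ^ n = pochhammer (1 / 2) n / fact n * u ^ n" for n
  proof -
    have *: "(- 1) ^ n * (- u) ^ n = u ^ n" by (simp flip: power_mult_distrib)
    have "((- 1 / 2) gchoose n) * (- u) ^ n = pochhammer (1 / 2) n / fact n * ((- 1) ^ n * (- u) ^ n)"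
      by (simp add: gbinomial_pochhammer)
    then show ?thesis unfolding * .
  qed
  moreover have "(1 + - u) powr (- 1 / 2) = 1 / sqrt (1 - u)"
    using assms by (simp add: powr_minus_divide powr_half_sqrt)
  ultimately have "(\<lambda>n. pochhammer (1 / 2) n / fact n * u ^ n) sums (1 / sqrt (1 - u))"
    by simp
  then have "(\<lambda>n. of_real (pochhammer (1 / 2) n / fact n * u ^ n) :: complex) sums of_real (1 / sqrt (1 - u))"
    by (rule sums_of_real)
  then show ?thesis
    by (simp add: pochhammer_of_real[symmetric])
qed

text \<open>
  \<open>sin\<^sup>n\<^sup>+\<^sup>1 / (n + 1) \<cdot> \<^sub>2F\<^sub>1(1/2, (n + 1)/2; (n + 3)/2; sin\<^sup>2)\<close> is an antiderivative of \<open>sin\<^sup>n\<close>.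
\<close>

lemma integral_sin_power_quarter:
  "integral {0..pi/4} (\<lambda>x. sin x ^ n) = (sqrt 2 / 2) ^ Suc n / real (Suc n) *
     Re (hypergeo_2F1 (1/2) (of_real ((real n + 1) / 2)) (of_real ((real n + 3) / 2)) (1/2))"
proof -
  define b where "b = (real n + 1) / 2"
  have b: "0 < b" by (simp add: b_def)
  have b_int: "of_real b \<notin> (\<int>\<^sub>\<le>\<^sub>0 :: complex set)"
    using b by (auto simp: of_real_in_nonpos_Ints_iff elim!: nonpos_Ints_cases')
  let ?F = "fps_hypergeo [1/2, of_real b] [1 + of_real b] 1 :: complex fps"
  define T where "T x = of_real (sin x ^ Suc n / real (Suc n)) * eval_fps ?F (of_real ((sin x)\<^sup>2))" for x
  have rad: "1 \<le> fps_conv_radius ?F"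
    by (rule fps_conv_radius_hypergeo_shift[OF b_int norm_pochhammer_half_le])
  have holo: "eval_fps ?F holomorphic_on ball 0 1"
  proof (rule holomorphic_on_eval_fps, rule subsetI)
    fix z :: complex assume "z \<in> ball 0 1"
    then have "ereal (norm z) < 1" by simp
    from less_le_trans[OF this rad] show "z \<in> eball 0 (fps_conv_radius ?F)" by simp
  qed
  have deriv: "(T has_vector_derivative of_real (sin x ^ n)) (at x)" if x: "0 \<le> x" "x \<le> pi/4" for x
  proof -
    define u where "u = (sin x)\<^sup>2"
    have cos_pos: "0 < cos x" using x pi_gt_zero by (intro cos_gt_zero_pi) linarith+
    then have "0 < (cos x)\<^sup>2" by simp
    then have u: "0 \<le> u" "u < 1"
      using cos_squared_eq[of x] unfolding u_def by (simp, linarith)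
    have "1 - u = (cos x)\<^sup>2" by (simp add: u_def cos_squared_eq)
    then have sqrt: "sqrt (1 - u) = cos x" using cos_pos by simp
    have ode: "of_real u * deriv (eval_fps ?F) (of_real u) + of_real b * eval_fps ?F (of_real u) =
        of_real b * of_real (1 / cos x)"
      using fps_hypergeo_shift_ode[OF b_int norm_pochhammer_half_le, of "of_real u"] u
        sums_unique[OF pochhammer_half_sums[OF u]]
      by (simp add: sqrt)
    have "((\<lambda>x. (sin x)\<^sup>2) has_real_derivative 2 * sin x * cos x) (at x)"
      by (auto intro!: derivative_eq_intros)
    then have 1: "((\<lambda>x. of_real ((sin x)\<^sup>2) :: complex) has_vector_derivative of_real (2 * sin x * cos x)) (at x)"
      by (rule has_vector_derivative_of_real)
    have 2: "(eval_fps ?F has_field_derivative deriv (eval_fps ?F) (of_real u)) (at (of_real u))"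
      using u by (intro holomorphic_derivI[OF holo open_ball]) auto
    have dF: "((\<lambda>x. eval_fps ?F (of_real ((sin x)\<^sup>2))) has_vector_derivative
        of_real (2 * sin x * cos x) * deriv (eval_fps ?F) (of_real u)) (at x)"
      using field_vector_diff_chain_at[OF 1 2[unfolded u_def]] by (simp add: o_def u_def)
    have "((\<lambda>x. sin x ^ Suc n / real (Suc n)) has_real_derivative sin x ^ n * cos x) (at x)"
      by (auto intro!: derivative_eq_intros simp del: power_Suc of_nat_Suc)
    then have "((\<lambda>x. of_real (sin x ^ Suc n / real (Suc n)) :: complex) has_vector_derivative
        of_real (sin x ^ n * cos x)) (at x)"
      by (rule has_vector_derivative_of_real)
    from has_vector_derivative_mult[OF this dF]
    have "(T has_vector_derivative
        (of_real (sin x ^ Suc n / real (Suc n)) * (of_real (2 * sin x * cos x) * deriv (eval_fps ?F) (of_real u)) +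
         of_real (sin x ^ n * cos x) * eval_fps ?F (of_real u))) (at x)"
      unfolding T_def u_def .
    moreover have "of_real (sin x ^ Suc n / real (Suc n)) * (of_real (2 * sin x * cos x) * deriv (eval_fps ?F) (of_real u)) +
         of_real (sin x ^ n * cos x) * eval_fps ?F (of_real u) = of_real (sin x ^ n)"
    proof -
      \<comment> \<open>As \<open>b = (n + 1) / 2\<close>, the inner derivative of the squared sine
        combines with the prefactor to \<open>sin x ^ n * cos x / b\<close> times \<open>u\<close>,
        so the whole derivative is a multiple of the left-hand side of \<open>ode\<close>.\<close>
      have "sin x ^ Suc n / real (Suc n) * (2 * sin x * cos x) = sin x ^ n * cos x / b * u"
        by (simp add: b_def u_def field_simps power2_eq_square)
      then have "of_real (sin x ^ Suc n / real (Suc n)) * (of_real (2 * sin x * cos x) * deriv (eval_fps ?F) (of_real u)) +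
         of_real (sin x ^ n * cos x) * eval_fps ?F (of_real u) =
         of_real (sin x ^ n * cos x / b) *
          (of_real u * deriv (eval_fps ?F) (of_real u) + of_real b * eval_fps ?F (of_real u))"
        using b unfolding mult.assoc[symmetric] of_real_mult[symmetric]
        by (simp add: distrib_left mult_ac)
      also have "\<dots> = of_real (sin x ^ n)"
        unfolding ode using b cos_pos by simp
      finally show ?thesis .
    qed
    ultimately show ?thesis by simp
  qed
  have "((\<lambda>x. of_real (sin x ^ n)) has_integral T (pi/4) - T 0) {0..pi/4}"
    by (rule fundamental_theorem_of_calculus)
       (auto intro: has_vector_derivative_at_within[OF deriv] simp del: of_real_power)
  then have "((\<lambda>x. Re (of_real (sin x ^ n))) has_integral Re (T (pi/4) - T 0)) {0..pi/4}"
    by (rule has_integral_Re)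
  then have "integral {0..pi/4} (\<lambda>x. sin x ^ n) = Re (T (pi/4) - T 0)"
    by (simp add: integral_unique del: of_real_power)
  also have "T 0 = 0" by (simp add: T_def)
  also have "Re (T (pi/4) - 0) = (sqrt 2 / 2) ^ Suc n / real (Suc n) * Re (eval_fps ?F (of_real ((sqrt 2 / 2)\<^sup>2)))"
    by (simp only: T_def sin_45 times_complex.sel Re_complex_of_real Im_complex_of_real
        mult_zero_left diff_0_right)
  also have "of_real ((sqrt 2 / 2)\<^sup>2) = (1 / 2 :: complex)"
    by (simp add: power_divide)
  \<comment> \<open>The argument 1/2 lies in the unit disc, where \<open>hypergeo_2F1\<close> is the
    series itself.\<close>
  also have "eval_fps ?F (1 / 2) = hypergeo_2F1 (1/2) (of_real ((real n + 1) / 2)) (of_real ((real n + 3) / 2)) (1/2)"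
  proof -
    have "(real n + 3) / 2 = 1 + b" by (simp add: b_def field_simps)
    then have *: "complex_of_real ((real n + 3) / 2) = 1 + of_real b" by (simp only: of_real_add of_real_1)
    show ?thesis unfolding * b_def[symmetric] by (simp add: hypergeo_2F1_def)
  qed
  finally show ?thesis .
qed

section \<open>Angular moments over a full turn\<close>

lemma abs_cos_sin_shift:
  "\<bar>cos (x + pi/2)\<bar> + \<bar>sin (x + pi/2)\<bar> = \<bar>cos x\<bar> + \<bar>sin (x::real)\<bar>"
  by (simp add: cos_add sin_add)

text \<open>The integrand has period \<open>pi / 2\<close> and equals a power of
  \<open>sqrt 2 * cos (x - pi/4)\<close> on the first quadrant. Four quadrants and the evenness of
  the cosine give the factor 8; the integral up to \<open>pi/4\<close> is the Wallis integral minus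
  its part beyond \<open>pi/4\<close>, which reflects into a sine integral.\<close>

lemma integral_abs_cos_sin_power:
  "integral {0..2 * pi} (\<lambda>x. (\<bar>cos x\<bar> + \<bar>sin x\<bar>) ^ n) =
   8 * sqrt 2 ^ n * (integral {0..pi/2} (\<lambda>x. cos x ^ n) - integral {0..pi/4} (\<lambda>x. sin x ^ n))"
proof -
  let ?g = "\<lambda>x. (\<bar>cos x\<bar> + \<bar>sin x\<bar>) ^ n :: real"
  have g_cont: "continuous_on S ?g" for S by (intro continuous_intros)
  have g_int: "?g integrable_on {a..b}" for a b
    by (rule integrable_continuous_real[OF g_cont])
  have shift: "integral {a + pi/2..b + pi/2} ?g = integral {a..b} ?g" for a b
    using integral_shift_Icc_real[of a b ?g "pi/2"]
    by (simp add: abs_cos_sin_shift o_def add.commute[of "pi / 2"])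
  have "integral {0..2 * pi} ?g = integral {0..pi/2} ?g + integral {pi/2..pi} ?g +
      integral {pi..3*pi/2} ?g + integral {3*pi/2..2*pi} ?g"
    using Henstock_Kurzweil_Integration.integral_combine[OF _ _ g_int, of 0 "pi/2" pi] Henstock_Kurzweil_Integration.integral_combine[OF _ _ g_int, of 0 pi "3*pi/2"]
      Henstock_Kurzweil_Integration.integral_combine[OF _ _ g_int, of 0 "3*pi/2" "2*pi"] by simp
  moreover have "integral {pi/2..pi} ?g = integral {0..pi/2} ?g"
    using shift[of 0 "pi/2"] by simp
  moreover have "integral {pi..3*pi/2} ?g = integral {pi/2..pi} ?g"
    using shift[of "pi/2" pi] by simp
  moreover have "integral {3*pi/2..2*pi} ?g = integral {pi..3*pi/2} ?g"
    using shift[of pi "3*pi/2"] by simp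
  ultimately have "integral {0..2 * pi} ?g = 4 * integral {0..pi/2} ?g" by simp
  also have "integral {0..pi/2} ?g = integral {0..pi/2} (\<lambda>x. (sqrt 2 * cos (x - pi/4)) ^ n)"
  proof (rule integral_cong)
    fix x assume "x \<in> {0..pi/2}"
    then have "0 \<le> cos x" "0 \<le> sin x" by (auto intro!: cos_ge_zero sin_ge_zero)
    then show "?g x = (sqrt 2 * cos (x - pi/4)) ^ n"
      by (simp add: cos_diff cos_45 sin_45 algebra_simps)
  qed
  also have "\<dots> = integral {- (pi/4)..pi/4} (\<lambda>x. (sqrt 2 * cos x) ^ n)"
    using integral_shift_Icc_real[of 0 "pi/2" "\<lambda>x. (sqrt 2 * cos x) ^ n" "- (pi/4)"]
    by (simp add: o_def)
  also have "\<dots> = sqrt 2 ^ n * integral {- (pi/4)..pi/4} (\<lambda>x. cos x ^ n)"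
    by (simp add: power_mult_distrib)
  also have "integral {- (pi/4)..pi/4} (\<lambda>x. cos x ^ n) =
      integral {- (pi/4)..0} (\<lambda>x. cos x ^ n) + integral {0..pi/4} (\<lambda>x. cos x ^ n)"
    by (rule Henstock_Kurzweil_Integration.integral_combine[symmetric]) (auto intro!: integrable_continuous_real continuous_intros)
  also have "integral {- (pi/4)..0} (\<lambda>x. cos x ^ n) = integral {0..pi/4} (\<lambda>x. cos x ^ n)"
    using Henstock_Kurzweil_Integration.integral_reflect_real[of "pi/4" 0 "\<lambda>x. cos x ^ n"] by simp
  also have "integral {0..pi/4} (\<lambda>x. cos x ^ n) =
      integral {0..pi/2} (\<lambda>x. cos x ^ n) - integral {pi/4..pi/2} (\<lambda>x. cos x ^ n)"
  proof -
    have "integral {0..pi/4} (\<lambda>x. cos x ^ n) + integral {pi/4..pi/2} (\<lambda>x. cos x ^ n) =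
        integral {0..pi/2} (\<lambda>x. cos x ^ n)"
      by (rule Henstock_Kurzweil_Integration.integral_combine) (auto intro!: integrable_continuous_real continuous_intros)
    then show ?thesis by simp
  qed
  also have "integral {pi/4..pi/2} (\<lambda>x. cos x ^ n) = integral {0..pi/4} (\<lambda>x. sin x ^ n)"
  proof -
    have "integral {pi/4..pi/2} (\<lambda>x. cos x ^ n) = integral {- (pi/2).. - (pi/4)} (\<lambda>x. cos x ^ n)"
      using Henstock_Kurzweil_Integration.integral_reflect_real[of "pi/2" "pi/4" "\<lambda>x. cos x ^ n"] by simp
    also have "\<dots> = integral {0..pi/4} (\<lambda>x. cos (x - pi/2) ^ n)"
      using integral_shift_Icc_real[of 0 "pi/4" "\<lambda>x. cos x ^ n" "- (pi/2)"]
      by (simp add: o_def)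
    also have "\<dots> = integral {0..pi/4} (\<lambda>x. sin x ^ n)"
      by (simp add: cos_diff)
    finally show ?thesis .
  qed
  finally show ?thesis by simp
qed

text \<open>This is where \<open>chi\<close> comes from: its Gamma quotient is the complete Wallis
  integral, and its hypergeometric term is the part beyond \<open>pi/4\<close> that has to be
  removed.\<close>

lemma chi_eq_integral:
  assumes "0 < lamw"
  shows "integral {0..2 * pi} (\<lambda>x. (lamw * \<bar>cos x\<bar> + lamw * \<bar>sin x\<bar>) ^ n) = 4 * chi (real n) lamw"
proof -
  have "integral {0..2 * pi} (\<lambda>x. (lamw * \<bar>cos x\<bar> + lamw * \<bar>sin x\<bar>) ^ n) =
      lamw ^ n * integral {0..2 * pi} (\<lambda>x. (\<bar>cos x\<bar> + \<bar>sin x\<bar>) ^ n)"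
    by (simp add: power_mult_distrib flip: distrib_left)
  also have "\<dots> = 4 * (lamw ^ n * (2 * sqrt 2 ^ n * integral {0..pi/2} (\<lambda>x. cos x ^ n) -
      2 * sqrt 2 ^ n * integral {0..pi/4} (\<lambda>x. sin x ^ n)))"
    unfolding integral_abs_cos_sin_power by (simp add: algebra_simps)
  also have "2 * sqrt 2 ^ n * integral {0..pi/2} (\<lambda>x. cos x ^ n) =
      2 powr (real n / 2) * sqrt pi * Gamma ((real n + 1) / 2) / Gamma ((real n + 2) / 2)"
  proof -
    have "2 powr (real n / 2) = (2 powr (1/2)) powr real n" by (simp add: powr_powr)
    then have "2 powr (real n / 2) = sqrt 2 ^ n" by (simp add: powr_half_sqrt powr_realpow)
    then show ?thesis unfolding integral_cos_power by simp
  qed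
  also have "2 * sqrt 2 ^ n * integral {0..pi/4} (\<lambda>x. sin x ^ n) =
      sqrt 2 * Re (hypergeo_2F1 (1/2) (of_real ((real n + 1) / 2)) (of_real ((real n + 3) / 2)) (1/2)) /
        (real n + 1)"
  proof -
    have "2 * sqrt 2 ^ n * (sqrt 2 / 2) ^ Suc n = sqrt 2 * (sqrt 2 * (sqrt 2 / 2)) ^ n"
      unfolding power_mult_distrib by simp
    also have "\<dots> = sqrt 2" by simp
    finally have *: "2 * sqrt 2 ^ n * (sqrt 2 / 2) ^ Suc n = sqrt 2" .
    show ?thesis
      unfolding integral_sin_power_quarter times_divide_eq_right mult.assoc[symmetric] * times_divide_eq_left[symmetric]
      by (simp add: add.commute)
  qed
  also have "lamw ^ n = lamw powr real n"
    using assms by (simp add: powr_realpow)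
  finally show ?thesis
    unfolding chi_def by simp
qed

section \<open>The exponent of the characteristic function\<close>

lemma sets_intensity [simp]: "sets (intensity lamPH lamw RD N) = sets borel"
  by (simp add: intensity_def)

lemma integral_intensity:
  fixes f :: "real \<times> real \<Rightarrow> complex"
  assumes [measurable]: "f \<in> borel_measurable borel" and "0 \<le> lamPH" "0 \<le> lamw"
  shows "(\<integral>x. f x \<partial>intensity lamPH lamw RD N) =
    (LINT p|lborel. (indicator {0..RD} (fst p) * indicator {0..<2*pi} (snd p) *
      (lamPH * wall_prob lamw N (fst p) (snd p) * fst p)) *\<^sub>R f (fst p * cos (snd p), fst p * sin (snd p)))"
proof -
  have [measurable]: "fst \<in> borel_measurable (borel :: (real \<times> real) measure)"
      "snd \<in> borel_measurable (borel :: (real \<times> real) measure)"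
    by (intro borel_measurable_continuous_onI continuous_intros)+
  have [measurable]: "(\<lambda>p::real \<times> real. (fst p * cos (snd p), fst p * sin (snd p))) \<in> borel_measurable borel"
    by (intro borel_measurable_continuous_onI continuous_intros)
  have [measurable]: "(\<lambda>p::real \<times> real. wall_prob lamw N (fst p) (snd p)) \<in> borel_measurable borel"
    unfolding wall_prob_def by (intro borel_measurable_continuous_onI continuous_intros) auto
  let ?d = "\<lambda>p::real \<times> real. indicator {0..RD} (fst p) * indicator {0..<2*pi} (snd p) *
      (lamPH * wall_prob lamw N (fst p) (snd p) * fst p)"
  have d_nonneg: "0 \<le> ?d p" for p
    using assms(2,3) by (cases p) (auto simp: wall_prob_def indicator_def)
  have d_eq: "(\<lambda>(r, \<theta>). ennreal (lamPH * wall_prob lamw N r \<theta> * r) *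
      indicator ({0..RD} \<times> {0..<2 * pi}) (r, \<theta>)) = (\<lambda>p. ennreal (?d p))"
    by (auto simp: fun_eq_iff indicator_def)
  have d_meas: "?d \<in> borel_measurable borel" by measurable
  show ?thesis
    unfolding intensity_def unfolding d_eq unfolding case_prod_unfold
    by (subst integral_distr, simp, simp, subst integral_density) (use d_nonneg d_meas in auto)
qed

text \<open>The bound on the integral of the norm, linear in \<open>B\<close>, is what makes the
  series of integrals summable when sum and integral are exchanged.\<close>

lemma integrable_bounded_box:
  fixes f :: "real \<times> real \<Rightarrow> 'b::{banach, second_countable_topology}"
  assumes "f \<in> borel_measurable borel"
    and "\<And>p. norm (f p) \<le> B * indicator ({a..b} \<times> {c..d}) p"
  shows "integrable lborel f"
    and "(LINT p|lborel. norm (f p)) \<le> B * measure lborel ({a..b} \<times> {c..d})"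
proof -
  have box: "{a..b} \<times> {c..d} = cbox (a, c) (b, d)" by (simp add: cbox_Pair_eq)
  have int: "integrable lborel (\<lambda>p. B * indicator ({a..b} \<times> {c..d}) p :: real)"
    unfolding box by (intro integrable_mult_right) (simp add: emeasure_lborel_cbox_eq)
  show f: "integrable lborel f"
  proof (rule Bochner_Integration.integrable_bound[OF int])
    show "AE p in lborel. norm (f p) \<le> norm (B * indicator ({a..b} \<times> {c..d}) p :: real)"
      by (intro AE_I2 order_trans[OF assms(2)]) simp
  qed (use assms(1) in simp)
  have "(LINT p|lborel. norm (f p)) \<le> (LINT p|lborel. B * indicator ({a..b} \<times> {c..d}) p)"
    by (rule integral_mono[OF _ int]) (use f assms(2) in auto)
  then show "(LINT p|lborel. norm (f p)) \<le> B * measure lborel ({a..b} \<times> {c..d})"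
    unfolding box by simp
qed

lemma LINT_product:
  fixes u v :: "real \<Rightarrow> complex"
  assumes "integrable lborel (\<lambda>p. u (fst p) * v (snd p) :: complex)"
  shows "(LINT p|lborel. u (fst p) * v (snd p)) = (LINT x|lborel. u x) * (LINT y|lborel. v y)"
proof -
  have "integrable (lborel \<Otimes>\<^sub>M lborel) (\<lambda>(x, y). u x * v y)"
    using assms by (simp add: lborel_prod case_prod_unfold)
  from lborel_pair.integral_fst'[OF this]
  show ?thesis by (simp add: lborel_prod case_prod_unfold)
qed

text \<open>The exponential in \<open>wall_prob\<close> is expanded in powers of
  \<open>a \<theta> * r\<close>, which is at most \<open>2 * lamw * RD\<close> on the disc, so the
  expansion is dominated by an exponential series. Each term is a function of \<open>r\<close> times
  a function of \<open>\<theta>\<close>, and its angular integral is \<open>4 * chi\<close>.\<close>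

lemma intensity_radial_integral_sums:
  fixes k :: "real \<Rightarrow> complex" and lamPH lamw RD :: real and N :: nat
  assumes [measurable]: "k \<in> borel_measurable borel" and k: "\<And>r. norm (k r) \<le> 1"
    and pos: "0 < lamPH" "0 < lamw" "0 < RD"
  defines "c i \<equiv> of_real (lamPH / fact N * (-1) ^ i / fact i * (4 * chi (real (N + i)) lamw)) *
      (LINT r|lborel. indicator {0..RD} r *\<^sub>R (of_real (r ^ (N + i + 1)) * k r))"
  shows "summable (\<lambda>i. norm (c i))"
    and "c sums (\<integral>x. k (norm x) \<partial>intensity lamPH lamw RD N)"
proof -
  define a where "a \<theta> = lamw * \<bar>cos \<theta>\<bar> + lamw * \<bar>sin \<theta>\<bar>" for \<theta>
  have a: "0 \<le> a \<theta>" "a \<theta> \<le> 2 * lamw" for \<theta>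
  proof -
    show "0 \<le> a \<theta>" using pos by (simp add: a_def)
    have "lamw * \<bar>cos \<theta>\<bar> \<le> lamw * 1" "lamw * \<bar>sin \<theta>\<bar> \<le> lamw * 1"
      using pos by (intro mult_left_mono; simp)+
    then show "a \<theta> \<le> 2 * lamw" by (simp add: a_def)
  qed
  have [measurable]: "a \<in> borel_measurable borel"
    unfolding a_def by measurable
  define C where "C i = lamPH / fact N * (-1) ^ i / fact i" for i :: nat
  define u where "u i r = indicator {0..RD} r *\<^sub>R (of_real (r ^ (N + i + 1)) * k r)" for i r
  define v where "v i \<theta> = (of_real (indicator {0..<2*pi} \<theta> * a \<theta> ^ (N + i)) :: complex)" for i \<theta>
  define h where "h i p = of_real (C i) * (u i (fst p) * v i (snd p))" for i p
  \<comment> \<open>From \<open>r \<le> RD\<close>, \<open>a \<theta> \<le> 2 * lamw\<close> and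
    \<open>norm (k r) \<le> 1\<close>.\<close>
  define B where "B i = lamPH / fact N / fact i * (RD ^ (N + i + 1) * (2 * lamw) ^ (N + i))" for i :: nat
  have u_meas [measurable]: "u i \<in> borel_measurable borel" for i unfolding u_def by measurable
  have v_meas [measurable]: "v i \<in> borel_measurable borel" for i unfolding v_def by measurable
  have uv_meas: "(\<lambda>p. u i (fst p) * v i (snd p)) \<in> borel_measurable (borel :: (real \<times> real) measure)" for i
    by (intro borel_measurable_times measurable_compose[OF _ u_meas] measurable_compose[OF _ v_meas])
       (auto simp: borel_prod[symmetric])
  have h_meas: "h i \<in> borel_measurable borel" for i
    unfolding h_def using uv_meas by measurable
  have uv_bound: "norm (u i (fst p) * v i (snd p)) \<le>
      RD ^ (N + i + 1) * (2 * lamw) ^ (N + i) * indicator ({0..RD} \<times> {0..2*pi}) p" for i p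
  proof (cases "fst p \<in> {0..RD} \<and> snd p \<in> {0..<2*pi}")
    case True
    have "norm (u i (fst p)) = fst p ^ (N + i + 1) * norm (k (fst p))"
      using True by (simp add: u_def norm_mult norm_power)
    also have "\<dots> \<le> RD ^ (N + i + 1) * 1"
      using True pos by (intro mult_mono power_mono k) auto
    finally have "norm (u i (fst p)) \<le> RD ^ (N + i + 1) * 1" .
    moreover have "norm (v i (snd p)) = a (snd p) ^ (N + i)"
      using True a[of "snd p"] by (simp add: v_def norm_power)
    then have "norm (v i (snd p)) \<le> (2 * lamw) ^ (N + i)"
      using power_mono[OF a(2) a(1)] by simp
    ultimately have "norm (u i (fst p) * v i (snd p)) \<le> RD ^ (N + i + 1) * 1 * (2 * lamw) ^ (N + i)"
      unfolding norm_mult using pos by (intro mult_mono) auto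
    then show ?thesis using True by (cases p) auto
  next
    case False
    then have eq: "u i (fst p) * v i (snd p) = 0" by (auto simp: u_def v_def)
    show ?thesis unfolding eq norm_zero using pos by (intro mult_nonneg_nonneg) auto
  qed
  have h_bound: "norm (h i p) \<le> B i * indicator ({0..RD} \<times> {0..2*pi}) p" for i p
  proof -
    have "norm (h i p) = lamPH / fact N / fact i * norm (u i (fst p) * v i (snd p))"
      using pos by (simp add: h_def C_def norm_mult norm_divide norm_power)
    also have "\<dots> \<le> lamPH / fact N / fact i *
        (RD ^ (N + i + 1) * (2 * lamw) ^ (N + i) * indicator ({0..RD} \<times> {0..2*pi}) p)"
      using pos by (intro mult_left_mono uv_bound) auto
    finally show ?thesis by (simp add: B_def mult_ac)
  qed
  note h_int = integrable_bounded_box[OF h_meas h_bound]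
  have uv_int: "integrable lborel (\<lambda>p. u i (fst p) * v i (snd p))" for i
    by (rule integrable_bounded_box(1)[OF uv_meas uv_bound])
  have B_summable: "summable B"
  proof -
    have "summable (\<lambda>i. lamPH / fact N * RD * (RD * (2 * lamw)) ^ N * ((RD * (2 * lamw)) ^ i /\<^sub>R fact i))"
      by (intro summable_mult summable_exp_generic)
    moreover have "lamPH / fact N * RD * (RD * (2 * lamw)) ^ N * ((RD * (2 * lamw)) ^ i /\<^sub>R fact i) = B i" for i
      by (simp add: B_def power_add power_mult_distrib field_simps)
    ultimately show ?thesis by (simp only:)
  qed
  have c_eq: "c i = (LINT p|lborel. h i p)" for i
  proof -
    have "(LINT \<theta>|lborel. v i \<theta>) = of_real (LINT \<theta>|lborel. indicator {0..<2*pi} \<theta> * a \<theta> ^ (N + i))"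
      unfolding v_def by (rule integral_complex_of_real)
    \<comment> \<open>The half-open range of angles differs from the closed one by a null
      set.\<close>
    also have "(LINT \<theta>|lborel. indicator {0..<2*pi} \<theta> * a \<theta> ^ (N + i)) =
        (LINT \<theta>|lborel. indicator {0..2*pi} \<theta> *\<^sub>R a \<theta> ^ (N + i))"
    proof (rule integral_cong_AE)
      show "AE x in lborel. indicator {0..<2*pi} x * a x ^ (N + i) = indicator {0..2*pi} x *\<^sub>R a x ^ (N + i)"
        using AE_lborel_singleton[of "2*pi"] by eventually_elim (auto simp: indicator_def)
    qed measurable
    also have "\<dots> = integral {0..2*pi} (\<lambda>\<theta>. a \<theta> ^ (N + i))"
    proof (rule set_borel_integral_eq_integral(2)[unfolded set_lebesgue_integral_def])
      show "set_integrable lborel {0..2*pi} (\<lambda>\<theta>. a \<theta> ^ (N + i))"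
        unfolding a_def by (intro borel_integrable_atLeastAtMost' continuous_intros)
    qed
    also have "\<dots> = 4 * chi (real (N + i)) lamw"
      unfolding a_def using chi_eq_integral[OF pos(2)] .
    finally have "(LINT \<theta>|lborel. v i \<theta>) = of_real (4 * chi (real (N + i)) lamw)" .
    moreover have "(LINT p|lborel. h i p) = of_real (C i) * ((LINT r|lborel. u i r) * (LINT \<theta>|lborel. v i \<theta>))"
      unfolding h_def LINT_product[OF uv_int, symmetric] by (rule integral_mult_right_zero)
    ultimately show ?thesis
      unfolding c_def C_def u_def by simp
  qed
  have c_bound: "norm (c i) \<le> B i * measure lborel ({0..RD} \<times> {0..2*pi})" for i
    unfolding c_eq using integral_norm_bound[of lborel "h i"] h_int(2)[of i] by (rule order_trans)
  show "summable (\<lambda>i. norm (c i))"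
    by (rule summable_comparison_test'[OF summable_mult2[OF B_summable]]) (use c_bound in auto)
  have h_summable: "summable (\<lambda>i. norm (h i p))" for p
    by (rule summable_comparison_test'[OF summable_mult2[OF B_summable,
          of "indicator ({0..RD} \<times> {0..2*pi}) p"]]) (use h_bound[of _ p] in simp)
  have h_sum: "(\<Sum>i. h i p) = (indicator {0..RD} (fst p) * indicator {0..<2*pi} (snd p) *
      (lamPH * wall_prob lamw N (fst p) (snd p) * fst p)) *\<^sub>R k (norm (fst p * cos (snd p), fst p * sin (snd p)))" for p
  proof (cases "fst p \<in> {0..RD} \<and> snd p \<in> {0..<2*pi}")
    case True
    define r where "r = fst p"
    \<comment> \<open>The mean number of walls crossed at this point, that is, the Poisson parameter
      in \<open>wall_prob\<close>; the terms \<open>h i p\<close> are those of the series of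
      \<open>exp (- s)\<close>.\<close>
    define s where "s = a (snd p) * r"
    have "(r * cos (snd p))\<^sup>2 + (r * sin (snd p))\<^sup>2 = r\<^sup>2"
      by (simp add: power_mult_distrib flip: distrib_left)
    then have norm_eq: "norm (fst p * cos (snd p), fst p * sin (snd p)) = r"
      using True by (simp add: norm_Pair r_def)
    have h_eq: "h i p = ((- s) ^ i /\<^sub>R fact i) *\<^sub>R (of_real (lamPH / fact N * s ^ N * r) * k r)" for i
    proof -
      have "C i * (r ^ (N + i + 1) * a (snd p) ^ (N + i)) = (- s) ^ i / fact i * (lamPH / fact N * s ^ N * r)"
        unfolding C_def unfolding power_minus[of s i] unfolding s_def power_mult_distrib by (simp add: power_add field_simps)
      moreover have "h i p = of_real (C i * (r ^ (N + i + 1) * a (snd p) ^ (N + i))) * k r"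
        using True by (simp add: h_def u_def v_def r_def[symmetric] mult_ac)
      moreover have "(- s) ^ i /\<^sub>R fact i = (- s) ^ i / fact i"
        by (simp add: divide_inverse)
      ultimately show ?thesis
        by (simp only: scaleR_conv_of_real of_real_mult mult.assoc)
    qed
    have "(\<lambda>i. h i p) sums (exp (- s) *\<^sub>R (of_real (lamPH / fact N * s ^ N * r) * k r))"
      unfolding h_eq by (intro sums_scaleR_left exp_converges)
    then have "(\<Sum>i. h i p) = exp (- s) *\<^sub>R (of_real (lamPH / fact N * s ^ N * r) * k r)"
      by (rule sums_unique[symmetric])
    moreover have "lamw * r * \<bar>cos (snd p)\<bar> + lamw * r * \<bar>sin (snd p)\<bar> = s"
      by (simp add: s_def a_def algebra_simps)
    ultimately show ?thesis
      using True unfolding norm_eq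
      by (simp add: wall_prob_def r_def[symmetric] scaleR_conv_of_real field_simps)
  next
    case False
    then have "h i p = 0" for i by (auto simp: h_def u_def v_def)
    then show ?thesis using False by auto
  qed
  have "(\<lambda>i. LINT p|lborel. h i p) sums (LINT p|lborel. (\<Sum>i. h i p))"
  proof (rule sums_integral[OF h_int(1)])
    show "AE p in lborel. summable (\<lambda>i. norm (h i p))" using h_summable by simp
    show "summable (\<lambda>i. LINT p|lborel. norm (h i p))"
      by (rule summable_comparison_test'[OF summable_mult2[OF B_summable, of "measure lborel ({0..RD} \<times> {0..2*pi})"]])
         (use h_int(2) in auto)
  qed
  moreover have "(\<integral>x. k (norm x) \<partial>intensity lamPH lamw RD N) = (LINT p|lborel. (\<Sum>i. h i p))"
    unfolding h_sum using pos by (intro integral_intensity) auto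
  ultimately show "c sums (\<integral>x. k (norm x) \<partial>intensity lamPH lamw RD N)"
    unfolding c_eq by simp
qed

section \<open>The path loss threshold and the factor of a single point\<close>

definition attenuation :: "real \<Rightarrow> real \<Rightarrow> real \<Rightarrow> nat \<Rightarrow> real \<Rightarrow> real" where
  "attenuation \<kappa> \<beta> K N r = real_of_ereal (inverse (path_loss \<kappa> \<beta> K N r))"

text \<open>An infinite path loss has reciprocal 0, in agreement with the right-hand side for
  \<open>K ^ N = 0\<close>. The restriction to positive distances matters: at distance 0 the
  reciprocal is infinite and \<open>real_of_ereal\<close> sends it to 0.\<close>

lemma attenuation_eq:
  assumes "0 < \<kappa>" "0 \<le> K" "0 < r"
  shows "attenuation \<kappa> \<beta> K N r = K ^ N / \<kappa> * r powr - \<beta>"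
proof (cases "K ^ N = 0")
  case True
  have "0 < \<kappa> * r powr \<beta>" using assms by simp
  then show ?thesis using True by (simp add: attenuation_def path_loss_def divide_ereal_def)
next
  case False
  have "0 < \<kappa> * r powr \<beta>" using assms by simp
  then show ?thesis using False
    by (simp add: attenuation_def path_loss_def powr_minus field_simps)
qed

text \<open>Turns the threshold on path losses into the lower limit of the radial integral. For
  \<open>K ^ N = 0\<close> both sides hold, since the loss is infinite and the critical distance is
  0.\<close>

lemma path_loss_greater_iff:
  assumes "0 < \<kappa>" "0 < \<beta>" "0 \<le> K" "0 < r" "0 < L0"
  shows "ereal L0 < path_loss \<kappa> \<beta> K N r \<longleftrightarrow> (L0 * K ^ N / \<kappa>) powr (1 / \<beta>) < r"
proof (cases "K ^ N = 0")
  case True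
  have "0 < \<kappa> * r powr \<beta>" using assms by simp
  then show ?thesis unfolding path_loss_def True using assms by (simp add: divide_ereal_def)
next
  case False
  define k where "k = K ^ N"
  have k: "0 < k" using False zero_le_power[OF assms(3), of N] unfolding k_def less_le by metis
  have "ereal L0 < path_loss \<kappa> \<beta> K N r \<longleftrightarrow> L0 * k / \<kappa> < r powr \<beta>"
    unfolding path_loss_def k_def[symmetric] using k assms by (simp add: field_simps)
  also have "\<dots> \<longleftrightarrow> (L0 * k / \<kappa>) powr (1 / \<beta>) < (r powr \<beta>) powr (1 / \<beta>)"
    using k assms powr_less_mono2[of "1 / \<beta>" "L0 * k / \<kappa>" "r powr \<beta>"]
      powr_mono2[of "1 / \<beta>" "r powr \<beta>" "L0 * k / \<kappa>"]
    by (meson divide_nonneg_pos divide_pos_pos less_imp_le mult_pos_pos not_le powr_ge_zero zero_less_one)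
  also have "(r powr \<beta>) powr (1 / \<beta>) = r" using assms by (simp add: powr_powr)
  finally show ?thesis unfolding k_def .
qed

text \<open>The mean over the gain of the factor that a transmitter at \<open>x\<close> contributes
  to the characteristic function; below the threshold it is silent and the factor is 1.\<close>

definition gain_factor :: "real \<Rightarrow> real \<Rightarrow> real \<Rightarrow> nat \<Rightarrow> real \<Rightarrow> ereal \<Rightarrow> real \<times> real \<Rightarrow> complex" where
  "gain_factor \<kappa> \<beta> K N \<omega> t x =
     (if t < path_loss \<kappa> \<beta> K N (norm x)
      then 1 / (1 - \<i> * of_real (\<omega> * attenuation \<kappa> \<beta> K N (norm x))) else 1)"

lemma path_loss_measurable [measurable]: "path_loss \<kappa> \<beta> K N \<in> borel_measurable borel"
  unfolding path_loss_def by measurable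

lemma attenuation_measurable [measurable]: "attenuation \<kappa> \<beta> K N \<in> borel_measurable borel"
  unfolding attenuation_def by measurable

lemma gain_factor_measurable: "gain_factor \<kappa> \<beta> K N \<omega> t \<in> borel_measurable borel"
  unfolding gain_factor_def by measurable

lemma norm_gain_factor_le: "norm (gain_factor \<kappa> \<beta> K N \<omega> t x) \<le> 1"
  unfolding gain_factor_def using norm_inverse_one_minus_imaginary(2) by (simp del: of_real_mult)

lemma Delta_eq_gain_factor_integral:
  fixes \<kappa> \<beta> K RD L0 \<omega> :: real
  assumes pos: "0 < \<kappa>" "0 < \<beta>" "0 \<le> K" "0 < RD" "0 < L0"
    and less: "ereal L0 < ereal (RD powr \<beta> * \<kappa>) / ereal (K ^ N)"
  defines "k r \<equiv> (if ereal L0 < path_loss \<kappa> \<beta> K N r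
      then 1 / (1 - \<i> * of_real (\<omega> * attenuation \<kappa> \<beta> K N r)) else 1) - 1"
  shows "Delta \<kappa> \<beta> K RD (real n) N \<omega> L0 =
    of_real (real n + 2) * (LINT r|lborel. indicator {0..RD} r *\<^sub>R (of_real (r ^ (n + 1)) * k r))"
proof -
  define r0 where "r0 = (L0 * K ^ N / \<kappa>) powr (1 / \<beta>)"
  define c where "c = \<omega> * K ^ N / \<kappa>"
  have k_eq: "k r = (if r0 < r then 1 / (1 - \<i> * of_real (c * r powr - \<beta>)) - 1 else 0)" if "0 < r" for r
    unfolding k_def path_loss_greater_iff[OF pos(1,2,3) that pos(5)] attenuation_eq[OF pos(1,3) that]
    by (simp add: r0_def c_def)
  have "(LINT r|lborel. indicator {0..RD} r *\<^sub>R (of_real (r ^ (n + 1)) * k r)) =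
      (LINT r|lborel. indicator {r0..RD} r *\<^sub>R
        (of_real (r powr (real n + 1)) * (1 / (1 - \<i> * of_real (c * r powr - \<beta>)) - 1)))"
  proof (rule integral_cong_AE)
    show "AE r in lborel. indicator {0..RD} r *\<^sub>R (of_real (r ^ (n + 1)) * k r) =
        indicator {r0..RD} r *\<^sub>R (of_real (r powr (real n + 1)) * (1 / (1 - \<i> * of_real (c * r powr - \<beta>)) - 1))"
      using AE_lborel_singleton[of r0] AE_lborel_singleton[of 0]
    proof eventually_elim
      fix r :: real assume r: "r \<noteq> r0" "r \<noteq> 0"
      have "0 \<le> r0" by (simp add: r0_def)
      show "indicator {0..RD} r *\<^sub>R (of_real (r ^ (n + 1)) * k r) =
        indicator {r0..RD} r *\<^sub>R (of_real (r powr (real n + 1)) * (1 / (1 - \<i> * of_real (c * r powr - \<beta>)) - 1))"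
      proof (cases "0 < r")
        case True
        have "r powr (real n + 1) = r ^ (n + 1)"
          using True powr_realpow[of r "n + 1"] by (simp add: add.commute)
        then show ?thesis using True r k_eq[OF True] by (auto simp: indicator_def)
      next
        case False
        then show ?thesis using r \<open>0 \<le> r0\<close> by (auto simp: indicator_def)
      qed
    qed
    show "(\<lambda>r. indicator {0..RD} r *\<^sub>R (of_real (r ^ (n + 1)) * k r)) \<in> borel_measurable lborel"
      unfolding k_def by measurable
  qed measurable
  moreover have "Delta \<kappa> \<beta> K RD (real n) N \<omega> L0 = of_real (real n + 2) *
      (LINT r|lborel. indicator {r0..RD} r *\<^sub>R
        (of_real (r powr (real n + 1)) * (1 / (1 - \<i> * of_real (c * r powr - \<beta>)) - 1)))"
  proof (cases "K = 0 \<and> 0 < N")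
    case True
    then have "c = 0" "K ^ N = 0" by (simp_all add: c_def)
    then show ?thesis using Delta_K_0[of K N \<beta> "real n"] pos by simp
  next
    case False
    show ?thesis
    proof (cases "K = 0")
      case True
      with False have "N = 0" by simp
      \<comment> \<open>Since \<open>0 ^ 0 = 1\<close>, the penetration loss does not enter for
        \<open>N = 0\<close>, and \<open>K\<close> may be replaced by 1 to reach the positive
        case.\<close>
      then have "Delta \<kappa> \<beta> K RD (real n) N \<omega> L0 = Delta \<kappa> \<beta> 1 RD (real n) N \<omega> L0"
        by (simp add: Delta_def Delta_generic_def)
      moreover have "L0 * 1 ^ N / \<kappa> < RD powr \<beta>"
        using less pos \<open>N = 0\<close> by (simp add: field_simps one_ereal_def)
      ultimately show ?thesis
        using Delta_eq_integral[of \<kappa> \<beta> 1 RD L0 "real n" N \<omega>] pos \<open>N = 0\<close>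
        by (simp add: r0_def c_def)
    next
      case False
      then have "0 < K ^ N" using pos by simp
      then have "L0 * K ^ N / \<kappa> < RD powr \<beta>"
        using less pos False by (simp add: field_simps)
      then show ?thesis
        using Delta_eq_integral[of \<kappa> \<beta> K RD L0 "real n" N \<omega>] pos False
        unfolding r0_def c_def by simp
    qed
  qed
  ultimately show ?thesis by simp
qed

text \<open>Both branches of \<open>Phi\<close> are one formula: if \<open>L0\<close> is at least
  the path loss at \<open>RD\<close>, no point of the disc passes the threshold, so every radial
  integral vanishes and the exponent is 0.\<close>

lemma Phi_eq_exp_integral:
  fixes lamPH lamw \<kappa> \<beta> K RD L0 \<omega> :: real
  assumes pos: "0 < lamPH" "0 < lamw" "0 < \<kappa>" "0 < \<beta>" "0 \<le> K" "0 < RD" "0 < L0"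
  shows "Phi lamPH lamw \<kappa> \<beta> K RD N \<omega> L0 =
    exp (- (\<integral>x. 1 - gain_factor \<kappa> \<beta> K N \<omega> (ereal L0) x \<partial>intensity lamPH lamw RD N))"
proof -
  define k where "k r = (if ereal L0 < path_loss \<kappa> \<beta> K N r
      then 1 / (1 - \<i> * of_real (\<omega> * attenuation \<kappa> \<beta> K N r)) else 1) - 1" for r
  define c where "c i = of_real (lamPH / fact N * (-1) ^ i / fact i * (4 * chi (real (N + i)) lamw)) *
      (LINT r|lborel. indicator {0..RD} r *\<^sub>R (of_real (r ^ (N + i + 1)) * k r))" for i
  have k_meas: "k \<in> borel_measurable borel" unfolding k_def by measurable
  have k_norm: "norm (k r) \<le> 1" for r
    unfolding k_def using norm_inverse_one_minus_imaginary(1) by (simp del: of_real_mult)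
  note sums = intensity_radial_integral_sums[OF k_meas k_norm pos(1,2,6), of N, folded c_def]
  have neg: "- (\<integral>x. 1 - gain_factor \<kappa> \<beta> K N \<omega> (ereal L0) x \<partial>intensity lamPH lamw RD N) =
      (\<integral>x. k (norm x) \<partial>intensity lamPH lamw RD N)"
    by (subst Bochner_Integration.integral_minus[symmetric])
       (simp add: k_def gain_factor_def)
  show ?thesis
  proof (cases "ereal L0 < ereal (RD powr \<beta> * \<kappa>) / ereal (K ^ N)")
    case True
    define d where "d \<eta> = of_real ((-1) ^ (\<eta> - N) * chi (real \<eta>) lamw / (fact (\<eta> - N) * (real \<eta> + 2))) *
        Delta \<kappa> \<beta> K RD (real \<eta>) N \<omega> L0" for \<eta>
    \<comment> \<open>With \<open>\<eta> = N + i\<close>, the factor \<open>\<eta> + 2\<close> in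
      front of the radial integral cancels the denominator \<open>\<eta> + 2\<close> of the
      series.\<close>
    have d_c: "of_real (4 * lamPH / fact N) * d (N + i) = c i" for i
    proof -
      have *: "Delta \<kappa> \<beta> K RD (real (N + i)) N \<omega> L0 = of_real (real (N + i) + 2) *
          (LINT r|lborel. indicator {0..RD} r *\<^sub>R (of_real (r ^ (N + i + 1)) * k r))"
        unfolding k_def by (rule Delta_eq_gain_factor_integral[OF pos(3-7) True])
      have nz: "real (N + i) + 2 \<noteq> 0" by linarith
      have **: "4 * lamPH / fact N * ((-1) ^ i * chi (real (N + i)) lamw / (fact i * (real (N + i) + 2))) * (real (N + i) + 2)
          = lamPH / fact N * (-1) ^ i / fact i * (4 * chi (real (N + i)) lamw)"
      proof -
        have "4 * A / F * (S * X / (I * M)) * M = A / F * S / I * (4 * X)" if "M \<noteq> 0" for A F S X I M :: real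
          using that by (cases "F = 0"; cases "I = 0") (auto simp: field_simps)
        then show ?thesis using nz by blast
      qed
      show ?thesis
        unfolding d_def * c_def **[symmetric] of_real_mult by (simp add: mult_ac)
    qed
    \<comment> \<open>The sum in \<open>Phi\<close> is unordered; absolute summability turns the
      ordered series into it.\<close>
    have c_sum: "(c has_sum (\<integral>x. k (norm x) \<partial>intensity lamPH lamw RD N)) UNIV"
      by (rule norm_summable_imp_has_sum[OF sums])
    have "((\<lambda>i. inverse (of_real (4 * lamPH / fact N)) * c i) has_sum
        inverse (of_real (4 * lamPH / fact N)) * (\<integral>x. k (norm x) \<partial>intensity lamPH lamw RD N)) UNIV"
      by (rule has_sum_cmult_right[OF c_sum])
    moreover have "inverse (of_real (4 * lamPH / fact N)) * c i = (d \<circ> (\<lambda>i. N + i)) i" for i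
      unfolding d_c[symmetric] o_def using pos by simp
    ultimately have "((d \<circ> (\<lambda>i. N + i)) has_sum
        inverse (of_real (4 * lamPH / fact N)) * (\<integral>x. k (norm x) \<partial>intensity lamPH lamw RD N)) UNIV"
      by (simp only:)
    then have "(d has_sum
        inverse (of_real (4 * lamPH / fact N)) * (\<integral>x. k (norm x) \<partial>intensity lamPH lamw RD N)) (range (\<lambda>i. N + i))"
      by (subst has_sum_reindex) auto
    also have "range (\<lambda>i. N + i) = {N..}"
      by (auto simp: image_iff le_iff_add)
    finally have "infsum d {N..} = inverse (of_real (4 * lamPH / fact N)) *
        (\<integral>x. k (norm x) \<partial>intensity lamPH lamw RD N)"
      by (rule infsumI)
    then have "of_real (4 * lamPH / fact N) * infsum d {N..} = (\<integral>x. k (norm x) \<partial>intensity lamPH lamw RD N)"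
      using pos by simp
    then show ?thesis
      using True unfolding Phi_def neg d_def by simp
  next
    case False
    have K: "K ^ N \<noteq> 0"
    proof
      assume "K ^ N = 0"
      then have "ereal (RD powr \<beta> * \<kappa>) / ereal (K ^ N) = \<infinity>"
        using pos by (simp only: divide_ereal_def) (simp add: ereal_mult_infty)
      with False show False by simp
    qed
    have "c i = 0" for i
    proof -
      have zero: "(indicator {0..RD} r *\<^sub>R (of_real (r ^ (N + i + 1)) * k r)) = 0" for r
      proof (cases "0 \<le> r \<and> r \<le> RD")
        case True
        have "r powr \<beta> \<le> RD powr \<beta>" using True pos by (intro powr_mono2) auto
        then have "path_loss \<kappa> \<beta> K N r \<le> ereal (RD powr \<beta> * \<kappa>) / ereal (K ^ N)"
          unfolding path_loss_def using pos K
          by (intro ereal_divide_right_mono) (auto simp: mult.commute zero_less_power_eq le_less)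
        with False have "\<not> ereal L0 < path_loss \<kappa> \<beta> K N r" by auto
        then show ?thesis by (simp add: k_def)
      qed (auto simp: indicator_def)
      show ?thesis unfolding c_def zero by simp
    qed
    then have "c = (\<lambda>_. 0)" by auto
    then have "(\<integral>x. k (norm x) \<partial>intensity lamPH lamw RD N) = 0"
      using sums(2) sums_zero sums_unique2 by metis
    then show ?thesis using False unfolding Phi_def neg by simp
  qed
qed

section \<open>The Gil-Pelaez inversion formula\<close>

context prob_space
begin

lemma expectation_of_bool:
  "expectation (\<lambda>w. of_bool (P w)) = prob {w \<in> space M. P w}"
proof -
  have "expectation (\<lambda>w. of_bool (P w)) = expectation (indicator {w \<in> space M. P w})"
    by (rule Bochner_Integration.integral_cong) (auto simp: indicator_def)
  also have "\<dots> = prob {w \<in> space M. P w}"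
    by (subst Bochner_Integration.integral_indicator) (auto intro!: arg_cong[where f=prob])
  finally show ?thesis .
qed

lemma continuous_on_char_random_variable:
  assumes [measurable]: "X \<in> borel_measurable M"
  shows "continuous_on S (\<lambda>\<omega>::real. expectation (\<lambda>w. iexp (\<omega> * X w)))"
proof -
  interpret D: real_distribution "distr M borel X" by (rule real_distribution_distr) simp
  have "expectation (\<lambda>w. iexp (\<omega> * X w)) = char (distr M borel X) \<omega>" for \<omega>
    unfolding char_def by (subst integral_distr) auto
  then show ?thesis
    using D.isCont_char by (simp add: continuous_at_imp_continuous_on)
qed

lemma Im_shifted_char:
  assumes [measurable]: "X \<in> borel_measurable M"
  shows "Im (exp (- \<i> * of_real \<omega> * of_real z) * expectation (\<lambda>w. iexp (\<omega> * X w))) =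
    expectation (\<lambda>w. sin (\<omega> * (X w - z)))"
proof -
  have "exp (- \<i> * of_real \<omega> * of_real z) * expectation (\<lambda>w. iexp (\<omega> * X w)) =
      expectation (\<lambda>w. exp (- \<i> * of_real \<omega> * of_real z) * iexp (\<omega> * X w))"
    by (rule integral_mult_right_zero[symmetric])
  also have "\<dots> = expectation (\<lambda>w. iexp (\<omega> * (X w - z)))"
    by (simp add: exp_add[symmetric] algebra_simps)
  also have "Im \<dots> = expectation (\<lambda>w. Im (iexp (\<omega> * (X w - z))))"
    by (rule integral_Im[symmetric]) (rule integrable_const_bound[where B=1]; simp)
  also have "\<dots> = expectation (\<lambda>w. sin (\<omega> * (X w - z)))"
    by (simp add: Im_exp)
  finally show ?thesis .
qed

text \<open>Fubini on a strip away from 0, where \<open>sin (\<omega> * X) / \<omega>\<close> is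
  bounded by \<open>1 / \<epsilon>\<close>. Near 0 the obvious bound is the absolute value of
  \<open>X\<close>, which need not be integrable.\<close>

lemma expectation_sin_divide_integral:
  assumes [measurable]: "X \<in> borel_measurable M" and \<epsilon>: "0 < \<epsilon>" "\<epsilon> \<le> T"
  shows "(LINT \<omega>|lborel. indicator {\<epsilon><..T} \<omega> * (expectation (\<lambda>w. sin (\<omega> * X w)) / \<omega>)) =
    expectation (\<lambda>w. sgn (X w) * (Si (T * \<bar>X w\<bar>) - Si (\<epsilon> * \<bar>X w\<bar>)))"
proof -
  interpret pair_sigma_finite M "lborel :: real measure" ..
  let ?f = "\<lambda>w \<omega>. indicator {\<epsilon><..T} \<omega> * (sin (\<omega> * X w) / \<omega>) :: real"
  have sin_int: "(LINT \<omega>|lborel. ?f w \<omega>) = sgn (X w) * (Si (T * \<bar>X w\<bar>) - Si (\<epsilon> * \<bar>X w\<bar>))" for w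
  proof -
    have "(LBINT t=ereal 0..\<epsilon>. sin (t * X w) / t) + (LBINT t=\<epsilon>..T. sin (t * X w) / t) =
        (LBINT t=ereal 0..T. sin (t * X w) / t)"
      using \<epsilon> integrable_sinc'[of T "X w"] by (intro interval_integral_sum) (simp add: min_def max_def zero_ereal_def)
    then have "(LBINT t=\<epsilon>..T. sin (t * X w) / t) = sgn (X w) * Si (T * \<bar>X w\<bar>) - sgn (X w) * Si (\<epsilon> * \<bar>X w\<bar>)"
      using \<epsilon> LBINT_I0c_sin_scale_divide[of T "X w"] LBINT_I0c_sin_scale_divide[of \<epsilon> "X w"]
      by (simp add: zero_ereal_def)
    moreover have "(LBINT t=\<epsilon>..T. sin (t * X w) / t) = (LINT \<omega>|lborel. ?f w \<omega>)"
      using \<epsilon> by (simp add: interval_integral_Ioc set_lebesgue_integral_def)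
    ultimately show ?thesis by (simp add: right_diff_distrib)
  qed
  have int: "integrable (M \<Otimes>\<^sub>M lborel) (\<lambda>(w, \<omega>). ?f w \<omega>)"
  proof (rule Bochner_Integration.integrable_bound)
    have "integrable (M \<Otimes>\<^sub>M lborel) (\<lambda>p. indicator (space M \<times> {\<epsilon>..T}) p *\<^sub>R (1 / \<epsilon>))"
      using \<epsilon> by (intro integrable_scaleR_left integrable_real_indicator)
        (auto simp: lborel.emeasure_pair_measure_Times emeasure_space_1 ennreal_mult_less_top)
    then show "integrable (M \<Otimes>\<^sub>M lborel) (\<lambda>p. indicator (space M \<times> {\<epsilon>..T}) p *\<^sub>R (1 / \<epsilon>))" .
    show "(\<lambda>(w, \<omega>). ?f w \<omega>) \<in> borel_measurable (M \<Otimes>\<^sub>M lborel)" by measurable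
    show "AE p in M \<Otimes>\<^sub>M lborel. norm (case p of (w, \<omega>) \<Rightarrow> ?f w \<omega>) \<le>
        norm (indicator (space M \<times> {\<epsilon>..T}) p *\<^sub>R (1 / \<epsilon>))"
    proof (rule AE_I2)
      fix p assume p: "p \<in> space (M \<Otimes>\<^sub>M (lborel :: real measure))"
      obtain w \<omega> where [simp]: "p = (w, \<omega>)" by (cases p)
      have "w \<in> space M" using p by (simp add: space_pair_measure)
      moreover have "\<bar>sin (\<omega> * X w)\<bar> / \<bar>\<omega>\<bar> \<le> 1 / \<epsilon>" if "\<epsilon> < \<omega>"
        using that \<epsilon> by (intro frac_le) auto
      ultimately show "norm (case p of (w, \<omega>) \<Rightarrow> ?f w \<omega>) \<le> norm (indicator (space M \<times> {\<epsilon>..T}) p *\<^sub>R (1 / \<epsilon>))"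
        using \<epsilon> by (auto simp: indicator_def)
    qed
  qed
  have "expectation (\<lambda>w. sgn (X w) * (Si (T * \<bar>X w\<bar>) - Si (\<epsilon> * \<bar>X w\<bar>))) =
      (LINT w|M. LINT \<omega>|lborel. ?f w \<omega>)"
    by (simp only: sin_int)
  also have "\<dots> = (LINT \<omega>|lborel. LINT w|M. ?f w \<omega>)"
    using int by (rule Fubini_integral[symmetric])
  also have "\<dots> = (LINT \<omega>|lborel. indicator {\<epsilon><..T} \<omega> * (expectation (\<lambda>w. sin (\<omega> * X w)) / \<omega>))"
    by simp
  finally show ?thesis by simp
qed

text \<open>\<open>Si\<close> is bounded with limit \<open>pi / 2\<close>, so the limit is
  \<open>pi / 2\<close> times the expected sign. The absence of an atom at 0 makes this sign equal
  to 1 minus twice the indicator of \<open>X \<le> 0\<close> almost surely.\<close>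

lemma expectation_sgn_Si_tendsto:
  assumes [measurable]: "X \<in> borel_measurable M" and zero: "prob {w \<in> space M. X w = 0} = 0"
  shows "((\<lambda>T. expectation (\<lambda>w. sgn (X w) * Si (T * \<bar>X w\<bar>))) \<longlongrightarrow> pi * (1/2 - prob {w \<in> space M. X w \<le> 0})) at_top"
proof -
  obtain B where B: "\<And>T. \<bar>Si T\<bar> \<le> B" using bounded_Si by blast
  have "((\<lambda>T. expectation (\<lambda>w. sgn (X w) * Si (T * \<bar>X w\<bar>))) \<longlongrightarrow> expectation (\<lambda>w. sgn (X w) * (pi / 2))) at_top"
  proof (rule integral_dominated_convergence_at_top[where w="\<lambda>_. B"])
    show "\<forall>\<^sub>F T in at_top. AE w in M. norm (sgn (X w) * Si (T * \<bar>X w\<bar>)) \<le> B"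
    proof (intro always_eventually allI AE_I2)
      fix T w
      show "norm (sgn (X w) * Si (T * \<bar>X w\<bar>)) \<le> B"
        using B[of 0] B[of "T * \<bar>X w\<bar>"] by (auto simp: sgn_if abs_mult)
    qed
    show "AE w in M. ((\<lambda>T. sgn (X w) * Si (T * \<bar>X w\<bar>)) \<longlongrightarrow> sgn (X w) * (pi / 2)) at_top"
    proof (rule AE_I2)
      fix w
      show "((\<lambda>T. sgn (X w) * Si (T * \<bar>X w\<bar>)) \<longlongrightarrow> sgn (X w) * (pi / 2)) at_top"
      proof (cases "X w = 0")
        case False
        then have "filterlim (\<lambda>T. T * \<bar>X w\<bar>) at_top at_top"
          by (intro filterlim_at_top_mult_tendsto_pos[OF tendsto_const _ filterlim_ident]) auto
        then show ?thesis
          by (intro tendsto_mult tendsto_const filterlim_compose[OF Si_at_top])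
      qed simp
    qed
  qed auto
  also have "expectation (\<lambda>w. sgn (X w) * (pi / 2)) = pi * (1/2 - prob {w \<in> space M. X w \<le> 0})"
  proof -
    define A where "A = {w \<in> space M. X w \<le> 0}"
    define Z where "Z = {w \<in> space M. X w = 0}"
    have [measurable]: "A \<in> events" "Z \<in> events" unfolding A_def Z_def by measurable
    have "expectation (\<lambda>w. sgn (X w) * (pi / 2)) =
        expectation (\<lambda>w. pi / 2 - pi * indicator A w + pi / 2 * indicator Z w)"
      by (rule Bochner_Integration.integral_cong) (auto simp: sgn_if indicator_def A_def Z_def)
    also have "\<dots> = pi / 2 - pi * prob A + pi / 2 * prob Z"
      by (simp add: prob_space emeasure_eq_measure)
    finally show ?thesis using zero by (simp add: algebra_simps A_def Z_def)
  qed
  finally show ?thesis .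
qed

text \<open>
  The integral need not converge absolutely at infinity: the Henstock-Kurzweil integral over \<open>{0<..}\<close> is
  the limit of the integrals over \<open>{0<..T}\<close>. The Lipschitz bound makes the integrand bounded near \<open>0\<close>.
\<close>

lemma gil_pelaez:
  fixes X :: "'a \<Rightarrow> real" and z C :: real
  assumes X [measurable]: "X \<in> borel_measurable M"
    and lip: "\<And>\<omega>. norm (expectation (\<lambda>w. iexp (\<omega> * X w)) - 1) \<le> C * \<bar>\<omega>\<bar>"
    and atom: "prob {w \<in> space M. X w = z} = 0"
  shows "((\<lambda>\<omega>. 1 / (pi * \<omega>) * Im (exp (- \<i> * of_real \<omega> * of_real z) * expectation (\<lambda>w. iexp (\<omega> * X w))))
    has_integral (1 / 2 - prob {w \<in> space M. X w \<le> z})) {0<..}"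
proof -
  define g where "g \<omega> = (if 0 < \<omega> then 1 / (pi * \<omega>) * Im (exp (- \<i> * of_real \<omega> * of_real z) *
    expectation (\<lambda>w. iexp (\<omega> * X w))) else 0)" for \<omega> :: real
  have [measurable]: "(\<lambda>\<omega>::real. expectation (\<lambda>w. iexp (\<omega> * X w))) \<in> borel_measurable borel"
    by (intro borel_measurable_continuous_onI continuous_on_char_random_variable X)
  have g_meas [measurable]: "g \<in> borel_measurable borel"
    unfolding g_def by measurable
  \<comment> \<open>Near 0 the constant \<open>C\<close> controls the deviation of the
    characteristic function from 1, and the absolute value of \<open>z\<close> controls the sine of
    the shift.\<close>
  define G where "G = (C + \<bar>z\<bar>) / pi"
  have g_bound: "norm (g \<omega>) \<le> \<bar>G\<bar>" for \<omega>
  proof (cases "0 < \<omega>")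
    case True
    let ?e = "exp (- \<i> * of_real \<omega> * of_real z)" and ?p = "expectation (\<lambda>w. iexp (\<omega> * X w))"
    have ne: "norm ?e = 1" by (simp add: norm_exp_eq_Re)
    have "Im (?e * ?p) = Im (?e * (?p - 1)) + Im ?e"
      by (simp add: algebra_simps)
    moreover have "\<bar>Im (?e * (?p - 1))\<bar> \<le> C * \<omega>"
      using abs_Im_le_cmod[of "?e * (?p - 1)"] lip[of \<omega>] True unfolding norm_mult ne by simp
    moreover have "\<bar>Im ?e\<bar> \<le> \<bar>z\<bar> * \<omega>"
      using abs_sin_x_le_abs_x[of "\<omega> * z"] True by (simp add: Im_exp abs_mult mult.commute)
    ultimately have "\<bar>Im (?e * ?p)\<bar> \<le> (C + \<bar>z\<bar>) * \<omega>"
      unfolding distrib_right by linarith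
    then have "\<bar>Im (?e * ?p)\<bar> / (pi * \<omega>) \<le> (C + \<bar>z\<bar>) * \<omega> / (pi * \<omega>)"
      using True by (intro divide_right_mono) auto
    also have "\<bar>Im (?e * ?p)\<bar> / (pi * \<omega>) = norm (1 / (pi * \<omega>) * Im (?e * ?p))"
      using True by (simp only: real_norm_def abs_mult abs_divide) simp
    also have "\<dots> = norm (g \<omega>)" unfolding g_def using True by (simp only: if_True)
    also have "(C + \<bar>z\<bar>) * \<omega> / (pi * \<omega>) = G" using True by (simp add: G_def)
    finally show ?thesis by simp
  qed (simp add: g_def)
  have g_int: "set_integrable lborel {a..b} g" for a b
  proof -
    have "integrable lborel (\<lambda>\<omega>. indicator {a..b} \<omega> *\<^sub>R g \<omega>)"
      by (rule integrableI_bounded_set_indicator[where B="\<bar>G\<bar>"])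
         (use g_bound in \<open>auto simp: emeasure_lborel_Icc_eq\<close>)
    then show ?thesis by (simp add: set_integrable_def)
  qed
  define I where "I T = (LINT \<omega>|lborel. indicator {0<..T} \<omega> * g \<omega>)" for T
  have I_eq: "I T = expectation (\<lambda>w. sgn (X w - z) * Si (T * \<bar>X w - z\<bar>)) / pi" if T: "0 < T" for T
  proof -
    obtain B where B: "\<And>T. \<bar>Si T\<bar> \<le> B" using bounded_Si by blast
    \<comment> \<open>Cutoffs tending to 0: the left side converges because \<open>g\<close> is
      bounded, the right side because \<open>Si\<close> is bounded, continuous and 0 at 0.\<close>
    define e where "e n = T / real (Suc n)" for n
    have e: "0 < e n" "e n \<le> T" for n using T by (auto simp: e_def field_simps)
    have e_lim: "e \<longlonglongrightarrow> 0"
      unfolding e_def using tendsto_mult[OF tendsto_const[of T] LIMSEQ_inverse_real_of_nat]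
      by (simp add: divide_inverse)
    have "(LINT \<omega>|lborel. indicator {e n<..T} \<omega> * g \<omega>) =
        expectation (\<lambda>w. sgn (X w - z) * (Si (T * \<bar>X w - z\<bar>) - Si (e n * \<bar>X w - z\<bar>))) / pi" for n
    proof -
      have "(LINT \<omega>|lborel. indicator {e n<..T} \<omega> * g \<omega>) =
          (LINT \<omega>|lborel. indicator {e n<..T} \<omega> * (expectation (\<lambda>w. sin (\<omega> * (X w - z))) / \<omega>) / pi)"
        using e(1)[of n] unfolding g_def Im_shifted_char[OF X]
        by (intro Bochner_Integration.integral_cong) (auto simp: indicator_def)
      also have "\<dots> = (LINT \<omega>|lborel. indicator {e n<..T} \<omega> * (expectation (\<lambda>w. sin (\<omega> * (X w - z))) / \<omega>)) / pi"
        by (rule integral_divide_zero)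
      finally show ?thesis
        using expectation_sin_divide_integral[of "\<lambda>w. X w - z", OF _ e] by simp
    qed
    moreover have "(\<lambda>n. LINT \<omega>|lborel. indicator {e n<..T} \<omega> * g \<omega>) \<longlonglongrightarrow> I T"
      unfolding I_def
    proof (rule integral_dominated_convergence[where w="\<lambda>\<omega>. indicator {0..T} \<omega> * \<bar>G\<bar>"])
      show "integrable lborel (\<lambda>\<omega>. indicator {0..T} \<omega> * \<bar>G\<bar>)"
        by (intro integrable_mult_left) (simp add: emeasure_lborel_Icc_eq)
      show "AE \<omega> in lborel. norm (indicator {e n<..T} \<omega> * g \<omega>) \<le> indicator {0..T} \<omega> * \<bar>G\<bar>" for n
        using e(1)[of n] g_bound by (intro AE_I2) (auto simp: indicator_def)
      show "AE \<omega> in lborel. (\<lambda>n. indicator {e n<..T} \<omega> * g \<omega>) \<longlonglongrightarrow> indicator {0<..T} \<omega> * g \<omega>"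
      proof (rule AE_I2)
        fix \<omega> :: real
        show "(\<lambda>n. indicator {e n<..T} \<omega> * g \<omega>) \<longlonglongrightarrow> indicator {0<..T} \<omega> * g \<omega>"
        proof (cases "0 < \<omega>")
          case True
          from order_tendstoD(2)[OF e_lim True]
          have "\<forall>\<^sub>F n in sequentially. indicator {e n<..T} \<omega> * g \<omega> = indicator {0<..T} \<omega> * g \<omega>"
            by eventually_elim (use True in \<open>auto simp: indicator_def\<close>)
          then show ?thesis by (rule tendsto_eventually)
        qed (simp add: g_def)
      qed
    qed measurable
    moreover have "(\<lambda>n. expectation (\<lambda>w. sgn (X w - z) * (Si (T * \<bar>X w - z\<bar>) - Si (e n * \<bar>X w - z\<bar>))) / pi)
        \<longlonglongrightarrow> expectation (\<lambda>w. sgn (X w - z) * (Si (T * \<bar>X w - z\<bar>) - Si (0 * \<bar>X w - z\<bar>))) / pi"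
    proof (intro tendsto_divide tendsto_const, rule integral_dominated_convergence[where w="\<lambda>_. 2 * B"])
      show "AE w in M. norm (sgn (X w - z) * (Si (T * \<bar>X w - z\<bar>) - Si (e n * \<bar>X w - z\<bar>))) \<le> 2 * B" for n
      proof (rule AE_I2)
        fix w
        show "norm (sgn (X w - z) * (Si (T * \<bar>X w - z\<bar>) - Si (e n * \<bar>X w - z\<bar>))) \<le> 2 * B"
          using B[of 0] B[of "T * \<bar>X w - z\<bar>"] B[of "e n * \<bar>X w - z\<bar>"] by (auto simp: sgn_if abs_mult)
      qed
      show "AE w in M. (\<lambda>n. sgn (X w - z) * (Si (T * \<bar>X w - z\<bar>) - Si (e n * \<bar>X w - z\<bar>)))
          \<longlonglongrightarrow> sgn (X w - z) * (Si (T * \<bar>X w - z\<bar>) - Si (0 * \<bar>X w - z\<bar>))"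
        by (intro AE_I2 tendsto_intros isCont_tendsto_compose[OF isCont_Si] e_lim)
    qed auto
    moreover have "Si 0 = 0" by (simp add: Si_def zero_ereal_def[symmetric])
    ultimately show ?thesis
      using LIMSEQ_unique by fastforce
  qed
  have "((\<lambda>T. expectation (\<lambda>w. sgn (X w - z) * Si (T * \<bar>X w - z\<bar>)) / pi) \<longlongrightarrow>
      pi * (1/2 - prob {w \<in> space M. X w - z \<le> 0}) / pi) at_top"
    using atom by (intro tendsto_divide tendsto_const expectation_sgn_Si_tendsto) auto
  then have "((\<lambda>T. expectation (\<lambda>w. sgn (X w - z) * Si (T * \<bar>X w - z\<bar>)) / pi) \<longlongrightarrow>
      1 / 2 - prob {w \<in> space M. X w \<le> z}) at_top"
    by simp
  moreover have "\<forall>\<^sub>F T in at_top. expectation (\<lambda>w. sgn (X w - z) * Si (T * \<bar>X w - z\<bar>)) / pi = I T"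
    using eventually_gt_at_top[of 0] by eventually_elim (simp add: I_eq)
  ultimately have I_lim: "(I \<longlongrightarrow> 1 / 2 - prob {w \<in> space M. X w \<le> z}) at_top"
    by (rule Lim_transform_eventually)
  have "(g has_integral (1 / 2 - prob {w \<in> space M. X w \<le> z})) {0<..}"
    unfolding has_integral_alt'
  proof (intro conjI allI impI)
    have g_eq: "(\<lambda>\<omega>. if \<omega> \<in> {0<..} then g \<omega> else 0) = g" by (auto simp: g_def)
    show "(\<lambda>\<omega>. if \<omega> \<in> {0<..} then g \<omega> else 0) integrable_on cbox a b" for a b
      unfolding g_eq cbox_interval by (rule set_borel_integral_eq_integral(1)[OF g_int])
    fix e :: real assume "e > 0"
    \<comment> \<open>As \<open>g\<close> vanishes off the positive axis, its integral over any
      interval that contains a large ball around 0 is \<open>I\<close> at the right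
      endpoint.\<close>
    from tendstoD[OF I_lim this] obtain B where
      B: "\<And>T. B \<le> T \<Longrightarrow> dist (I T) (1 / 2 - prob {w \<in> space M. X w \<le> z}) < e"
      by (auto simp: eventually_at_top_linorder)
    show "\<exists>B>0. \<forall>a b. ball 0 B \<subseteq> cbox a b \<longrightarrow>
        norm (integral (cbox a b) (\<lambda>\<omega>. if \<omega> \<in> {0<..} then g \<omega> else 0) -
          (1 / 2 - prob {w \<in> space M. X w \<le> z})) < e"
    proof (intro exI[of _ "max B 1"] conjI allI impI)
      fix a b :: real assume "ball 0 (max B 1) \<subseteq> cbox a b"
      then have "{- max B 1<..<max B 1} \<subseteq> {a..b}"
        by (simp add: ball_eq_greaterThanLessThan)
      then have ab: "a \<le> - max B 1" "max B 1 \<le> b"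
        by (subst (asm) greaterThanLessThan_subseteq_atLeastAtMost_iff; simp)+
      have "integral {a..b} g = (LINT \<omega>:{a..b}|lborel. g \<omega>)"
        by (rule set_borel_integral_eq_integral(2)[OF g_int, symmetric])
      also have "\<dots> = I b"
        unfolding I_def set_lebesgue_integral_def using ab
        by (intro Bochner_Integration.integral_cong) (auto simp: g_def indicator_def)
      finally show "norm (integral (cbox a b) (\<lambda>\<omega>. if \<omega> \<in> {0<..} then g \<omega> else 0) -
          (1 / 2 - prob {w \<in> space M. X w \<le> z})) < e"
        unfolding g_eq cbox_interval using B[of b] ab by (simp add: dist_real_def)
    qed simp
  qed
  then show ?thesis
    by (rule has_integral_eq[rotated]) (simp add: g_def)
qed

end

section \<open>Independence\<close>

text \<open>The mean value inequality on the left half plane, which is convex and on which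
  \<open>exp\<close> has norm at most 1.\<close>

lemma norm_exp_minus_one_le:
  assumes "0 \<le> Re u"
  shows "norm (exp (- u) - 1) \<le> norm u"
proof -
  have "norm (exp (- u) - exp 0) \<le> 1 * norm (- u - 0)"
  proof (rule field_differentiable_bound[where S="{z. Re z \<le> 0}" and f'=exp])
    show "convex {z. Re z \<le> 0}" by (rule convex_halfspace_Re_le)
    show "norm (exp z) \<le> 1" if "z \<in> {z. Re z \<le> 0}" for z using that by simp
  qed (use assms in \<open>auto intro!: derivative_eq_intros\<close>)
  then show ?thesis by simp
qed

context prob_space
begin

text \<open>Independence makes the joint law a product measure, so one variable may be frozen while
  the other is integrated. Independence is assumed in the form in which it is given for gains and
  configuration.\<close>

lemma indep_expectation:
  fixes f :: "'b \<Rightarrow> 'c \<Rightarrow> 'd::{banach, second_countable_topology}"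
  assumes indep: "indep_set (sets (vimage_algebra (space M) X S)) (sets (vimage_algebra (space M) Y T))"
    and X [measurable]: "X \<in> measurable M S" and Y [measurable]: "Y \<in> measurable M T"
    and f [measurable]: "(\<lambda>(x, y). f x y) \<in> borel_measurable (S \<Otimes>\<^sub>M T)"
    and bound: "\<And>x y. norm (f x y) \<le> B"
  shows "expectation (\<lambda>w. f (X w) (Y w)) = expectation (\<lambda>v. expectation (\<lambda>w. f (X w) (Y v)))"
proof -
  interpret X: prob_space "distr M S X" by (rule prob_space_distr) simp
  interpret Y: prob_space "distr M T Y" by (rule prob_space_distr) simp
  interpret XY: pair_prob_space "distr M S X" "distr M T Y" ..
  have distr: "distr M S X \<Otimes>\<^sub>M distr M T Y = distr M (S \<Otimes>\<^sub>M T) (\<lambda>w. (X w, Y w))"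
  proof (rule pair_measure_eqI)
    show "sets (distr M S X \<Otimes>\<^sub>M distr M T Y) = sets (distr M (S \<Otimes>\<^sub>M T) (\<lambda>w. (X w, Y w)))"
      by (simp cong: sets_pair_measure_cong)
    fix A B assume "A \<in> sets (distr M S X)" "B \<in> sets (distr M T Y)"
    then have A [measurable]: "A \<in> sets S" and B [measurable]: "B \<in> sets T" by simp_all
    have "prob (X -` A \<inter> space M \<inter> (Y -` B \<inter> space M)) = prob (X -` A \<inter> space M) * prob (Y -` B \<inter> space M)"
      by (rule indep_setD[OF indep]) (auto intro!: in_vimage_algebra A B)
    moreover have "(\<lambda>w. (X w, Y w)) -` (A \<times> B) \<inter> space M = X -` A \<inter> space M \<inter> (Y -` B \<inter> space M)"
      by auto
    ultimately show "emeasure (distr M S X) A * emeasure (distr M T Y) B =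
        emeasure (distr M (S \<Otimes>\<^sub>M T) (\<lambda>w. (X w, Y w))) (A \<times> B)"
      by (simp add: emeasure_distr emeasure_eq_measure ennreal_mult)
  qed unfold_locales
  have "expectation (\<lambda>w. f (X w) (Y w)) = integral\<^sup>L (distr M (S \<Otimes>\<^sub>M T) (\<lambda>w. (X w, Y w))) (\<lambda>(x, y). f x y)"
    by (subst integral_distr) auto
  also have "\<dots> = integral\<^sup>L (distr M S X \<Otimes>\<^sub>M distr M T Y) (\<lambda>(x, y). f x y)"
    by (simp only: distr)
  also have "\<dots> = (\<integral>y. (\<integral>x. f x y \<partial>distr M S X) \<partial>distr M T Y)"
  proof (rule XY.integral_snd[symmetric])
    show "integrable (distr M S X \<Otimes>\<^sub>M distr M T Y) (\<lambda>(x, y). f x y)"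
      by (rule XY.integrable_const_bound[where B=B]) (use bound in auto)
  qed
  also have "\<dots> = expectation (\<lambda>v. \<integral>x. f x (Y v) \<partial>distr M S X)"
  proof (rule integral_distr)
    have "(\<lambda>(y, x). f x y) \<in> borel_measurable (T \<Otimes>\<^sub>M S)"
      using measurable_pair_swap[OF f] by (simp add: case_prod_unfold)
    then have "(\<lambda>(y, x). f x y) \<in> borel_measurable (T \<Otimes>\<^sub>M distr M S X)"
      by (simp cong: measurable_cong_sets sets_pair_measure_cong)
    then show "(\<lambda>y. \<integral>x. f x y \<partial>distr M S X) \<in> borel_measurable T"
      by (rule X.borel_measurable_lebesgue_integral)
  qed simp
  also have "\<dots> = expectation (\<lambda>v. expectation (\<lambda>w. f (X w) (Y v)))"
  proof (rule Bochner_Integration.integral_cong[OF refl])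
    fix v assume "v \<in> space M"
    then have "Y v \<in> space T" by (rule measurable_space[rotated]) simp
    then have "(\<lambda>x. f x (Y v)) \<in> borel_measurable S" by measurable
    then show "(\<integral>x. f x (Y v) \<partial>distr M S X) = expectation (\<lambda>w. f (X w) (Y v))"
      by (subst integral_distr) auto
  qed
  finally show ?thesis .
qed

section \<open>Absence of atoms\<close>

lemma indep_var_add_no_atom:
  assumes indep: "indep_var borel X borel Y" and atom: "\<And>x::real. prob {w \<in> space M. X w = x} = 0"
  shows "prob {w \<in> space M. X w + Y w = z} = 0"
proof -
  have [measurable]: "X \<in> borel_measurable M" "Y \<in> borel_measurable M"
    using indep by (auto dest: indep_var_rv1 indep_var_rv2)
  have indep': "indep_set (sets (vimage_algebra (space M) X borel)) (sets (vimage_algebra (space M) Y borel))"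
    using indep by (simp add: indep_var_eq sets_vimage_algebra)
  have "prob {w \<in> space M. X w + Y w = z} = expectation (\<lambda>w. of_bool (X w + Y w = z))"
    by (rule expectation_of_bool[symmetric])
  also have "\<dots> = expectation (\<lambda>v. expectation (\<lambda>w. of_bool (X w + Y v = z)))"
    by (rule indep_expectation[OF indep', where B=1]) auto
  also have "\<dots> = expectation (\<lambda>v. prob {w \<in> space M. X w = z - Y v})"
    by (simp add: expectation_of_bool eq_diff_eq)
  also have "\<dots> = 0" using atom by simp
  finally show ?thesis .
qed

text \<open>One nonzero coefficient yields an atomless summand independent of the rest, which makes
  the whole sum atomless. If all coefficients vanish the sum is 0, hence the condition on
  \<open>z\<close>.\<close>

lemma indep_linear_combination_no_atom:
  fixes h :: "nat \<Rightarrow> 'a \<Rightarrow> real"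
  assumes indep: "indep_vars (\<lambda>_. borel) h UNIV" and atom: "\<And>n x. prob {w \<in> space M. h n w = x} = 0"
    and "z \<noteq> 0"
  shows "prob {w \<in> space M. (\<Sum>n<m. h n w * c n) = z} = 0"
proof (cases "\<exists>k<m. c k \<noteq> 0")
  case False
  then have "(\<Sum>n<m. h n w * c n) = 0" for w by (intro sum.neutral) auto
  then show ?thesis using \<open>z \<noteq> 0\<close> by simp
next
  case True
  then obtain k where k: "k < m" "c k \<noteq> 0" by blast
  have "indep_vars (\<lambda>_. borel) (\<lambda>n w. h n w * c n) UNIV"
    using indep by (rule indep_vars_compose2) simp
  then have "indep_vars (\<lambda>_. borel) (\<lambda>n w. h n w * c n) (insert k ({..<m} - {k}))"
    by (rule indep_vars_subset) simp
  then have "indep_var borel (\<lambda>w. h k w * c k) borel (\<lambda>w. \<Sum>n\<in>{..<m} - {k}. h n w * c n)"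
    by (intro indep_vars_sum) auto
  moreover have "prob {w \<in> space M. h k w * c k = x} = 0" for x
  proof -
    have "{w \<in> space M. h k w * c k = x} = {w \<in> space M. h k w = x / c k}"
      using k by (auto simp: field_simps)
    then show ?thesis using atom by simp
  qed
  ultimately have "prob {w \<in> space M. h k w * c k + (\<Sum>n\<in>{..<m} - {k}. h n w * c n) = z} = 0"
    by (rule indep_var_add_no_atom)
  then show ?thesis
    using k by (simp add: sum.remove[of "{..<m}" k])
qed

lemma distributed_lborel_no_atom:
  fixes X :: "'a \<Rightarrow> real"
  assumes "distributed M lborel X f"
  shows "prob {w \<in> space M. X w = x} = 0"
proof -
  have X: "X \<in> borel_measurable M" using distributed_measurable[OF assms] by simp
  have "emeasure M (X -` {x} \<inter> space M) = (\<integral>\<^sup>+y. f y * indicator {x} y \<partial>lborel)"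
    by (rule distributed_emeasure[OF assms]) simp
  also have "\<dots> = (\<integral>\<^sup>+y. 0 \<partial>(lborel :: real measure))"
    using AE_lborel_singleton[of x] by (intro nn_integral_cong_AE) (auto elim!: eventually_mono)
  finally have "emeasure M {w \<in> space M. X w = x} = 0"
    by (simp add: vimage_def Int_def conj_commute)
  then show ?thesis by (simp add: measure_def)
qed

text \<open>The density combines with the oscillation to \<open>exp (x * (\<i> * s - 1))\<close>,
  whose antiderivative tends to 0 at infinity because the real part of the exponent is
  \<open>- x\<close>.\<close>

lemma exponential_char:
  assumes X: "distributed M lborel X (exponential_density 1)"
  shows "expectation (\<lambda>w. iexp (X w * s)) = 1 / (1 - \<i> * of_real s)"
proof -
  let ?f = "\<lambda>x. indicator {0..} x *\<^sub>R exp (of_real x * (\<i> * of_real s - 1)) :: complex"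
  have nz: "\<i> * of_real s - 1 \<noteq> 0" by (auto simp: complex_eq_iff)
  have X_meas [measurable]: "X \<in> borel_measurable M" using distributed_measurable[OF X] by simp
  have "expectation (\<lambda>w. iexp (X w * s)) = (\<integral>x. iexp (x * s) \<partial>distr M lborel X)"
    by (subst integral_distr) auto
  also have "\<dots> = (LINT x|lborel. exponential_density 1 x *\<^sub>R iexp (x * s))"
    unfolding distributed_distr_eq_density[OF X]
    by (rule integral_density) (auto simp: exponential_density_def)
  also have "\<dots> = (LINT x|lborel. ?f x)"
    by (rule Bochner_Integration.integral_cong)
       (auto simp: exponential_density_def indicator_def scaleR_conv_of_real exp_of_real[symmetric]
          exp_add[symmetric] algebra_simps simp del: exp_of_real)
  also have "\<dots> = 0 / (\<i> * of_real s - 1) - exp (of_real 0 * (\<i> * of_real s - 1)) / (\<i> * of_real s - 1)"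
  proof -
    let ?c = "\<i> * of_real s - 1 :: complex"
    have "integrable lborel (\<lambda>x. indicator {0..} x *\<^sub>R exp (- x) :: real)"
      using has_bochner_integral_I0i_power_exp_m'[of 0]
      by (auto simp: has_bochner_integral_iff mult.commute)
    then have int: "integrable lborel ?f"
      by (rule Bochner_Integration.integrable_bound) (auto simp: indicator_def)
    have "((\<lambda>y. LINT x|lborel. indicator {..y} x *\<^sub>R ?f x) \<longlongrightarrow> (LINT x|lborel. ?f x)) at_top"
      by (rule tendsto_integral_at_top[OF _ int]) simp
    moreover have "\<forall>\<^sub>F y in at_top. (LINT x|lborel. indicator {..y} x *\<^sub>R ?f x) = exp (of_real y * ?c) / ?c - exp (of_real 0 * ?c) / ?c"
      using eventually_ge_at_top[of 0]
    proof eventually_elim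
      fix y :: real assume y: "0 \<le> y"
      have "(LINT x|lborel. indicator {..y} x *\<^sub>R ?f x) = (LINT x|lborel. indicator {0..y} x *\<^sub>R exp (of_real x * ?c))"
        by (rule Bochner_Integration.integral_cong) (auto simp: indicator_def)
      also have "\<dots> = exp (of_real y * ?c) / ?c - exp (of_real 0 * ?c) / ?c"
      proof (rule integral_FTC_Icc[OF y])
        fix x :: real
        have "((\<lambda>z. exp (z * ?c) / ?c) has_field_derivative exp (of_real x * ?c)) (at (of_real x))"
          using nz by (auto intro!: derivative_eq_intros)
        then show "((\<lambda>x. exp (of_real x * ?c) / ?c) has_vector_derivative exp (of_real x * ?c)) (at x within {0..y})"
          by (rule has_vector_derivative_real_field)
      qed (intro continuous_intros)
      finally show "(LINT x|lborel. indicator {..y} x *\<^sub>R ?f x) = exp (of_real y * ?c) / ?c - exp (of_real 0 * ?c) / ?c" .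
    qed
    ultimately have "((\<lambda>y. exp (of_real y * ?c) / ?c - exp (of_real 0 * ?c) / ?c) \<longlongrightarrow> (LINT x|lborel. ?f x)) at_top"
      by (rule Lim_transform_eventually)
    moreover have "((\<lambda>y. exp (of_real y * ?c)) \<longlongrightarrow> 0) at_top"
    proof (rule tendsto_norm_zero_cancel)
      have "((\<lambda>y. exp (- y)) \<longlongrightarrow> (0::real)) at_top"
        by (intro filterlim_compose[OF exp_at_bot] filterlim_uminus_at_bot_at_top)
      then show "((\<lambda>y. norm (exp (of_real y * ?c))) \<longlongrightarrow> 0) at_top" by simp
    qed
    then have "((\<lambda>y. exp (of_real y * ?c) / ?c - exp (of_real 0 * ?c) / ?c) \<longlongrightarrow> 0 / ?c - exp (of_real 0 * ?c) / ?c) at_top"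
      using nz by (intro tendsto_intros) auto
    ultimately show ?thesis
      by (rule tendsto_unique[OF trivial_limit_at_top_linorder])
  qed
  also have "\<dots> = 1 / (1 - \<i> * of_real s)"
    using nz by (simp add: field_simps)
  finally show ?thesis .
qed

section \<open>Independence from characteristic functions\<close>

lemma indep_event_of_char:
  fixes X :: "'a \<Rightarrow> real"
  assumes [measurable]: "X \<in> borel_measurable M" "A \<in> events"
    and char: "\<And>\<omega>::real. expectation (\<lambda>w. indicator A w *\<^sub>R iexp (\<omega> * X w)) =
      of_real (prob A) * expectation (\<lambda>w. iexp (\<omega> * X w))"
    and B [measurable]: "B \<in> sets borel"
  shows "prob (A \<inter> (X -` B \<inter> space M)) = prob A * prob (X -` B \<inter> space M)"
proof (cases "prob A = 0")
  case True
  have "prob (A \<inter> (X -` B \<inter> space M)) \<le> prob A" by (intro finite_measure_mono) auto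
  then show ?thesis using True measure_nonneg[of M "A \<inter> (X -` B \<inter> space M)"] by simp
next
  case False
  then have pos: "0 < prob A" by (simp add: zero_less_measure_iff)
  \<comment> \<open>The conditional probability given \<open>A\<close>. By \<open>char\<close>,
    \<open>X\<close> has the same characteristic function under \<open>D\<close> as under
    \<open>M\<close>, so Levy's uniqueness theorem equates its laws.\<close>
  define D where "D = density M (\<lambda>w. ennreal (indicator A w / prob A))"
  have D_emeasure: "emeasure D C = ennreal (prob (A \<inter> C) / prob A)" if [measurable]: "C \<in> events" for C
  proof -
    have "emeasure D C = (\<integral>\<^sup>+w. ennreal (indicator (A \<inter> C) w / prob A) \<partial>M)"
      unfolding D_def by (subst emeasure_density) (auto intro!: nn_integral_cong simp: indicator_def)
    also have "\<dots> = (\<integral>\<^sup>+w. ennreal (1 / prob A) * indicator (A \<inter> C) w \<partial>M)"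
      by (intro nn_integral_cong) (auto simp: indicator_def)
    also have "\<dots> = ennreal (1 / prob A) * emeasure M (A \<inter> C)"
      by (simp add: nn_integral_cmult_indicator)
    also have "\<dots> = ennreal (prob (A \<inter> C) / prob A)"
      using pos by (simp add: emeasure_eq_measure ennreal_mult[symmetric])
    finally show ?thesis .
  qed
  have sets_D [simp, measurable_cong]: "sets D = sets M" and space_D [simp]: "space D = space M"
    by (simp_all add: D_def)
  interpret D: prob_space D
  proof
    show "emeasure D (space D) = 1"
      using pos D_emeasure[OF sets.top] sets.sets_into_space[OF \<open>A \<in> events\<close>] by (simp add: Int_absorb2)
  qed
  have X_D: "X \<in> borel_measurable D" by measurable
  have "distr D borel X = distr M borel X"
  proof (rule Levy_uniqueness)
    show "real_distribution (distr D borel X)" by (rule D.real_distribution_distr[OF X_D])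
    show "real_distribution (distr M borel X)" by (rule real_distribution_distr) simp
    show "char (distr D borel X) = char (distr M borel X)"
    proof
      fix \<omega>
      have "char (distr D borel X) \<omega> = (\<integral>w. iexp (\<omega> * X w) \<partial>D)"
        unfolding char_def using X_D by (subst integral_distr) auto
      also have "\<dots> = expectation (\<lambda>w. (indicator A w / prob A) *\<^sub>R iexp (\<omega> * X w))"
        unfolding D_def by (subst integral_density) auto
      also have "\<dots> = expectation (\<lambda>w. (1 / prob A) *\<^sub>R (indicator A w *\<^sub>R iexp (\<omega> * X w)))"
        by (simp add: divide_inverse mult.commute)
      also have "\<dots> = (1 / prob A) *\<^sub>R expectation (\<lambda>w. indicator A w *\<^sub>R iexp (\<omega> * X w))"
        by (rule integral_scaleR_right)
      also have "\<dots> = expectation (\<lambda>w. iexp (\<omega> * X w))"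
        unfolding char using pos by (simp add: scaleR_conv_of_real)
      also have "\<dots> = char (distr M borel X) \<omega>"
        unfolding char_def by (subst integral_distr) auto
      finally show "char (distr D borel X) \<omega> = char (distr M borel X) \<omega>" .
    qed
  qed
  then have "emeasure (distr D borel X) B = emeasure (distr M borel X) B" by simp
  then have "emeasure D (X -` B \<inter> space M) = emeasure M (X -` B \<inter> space M)"
    using X_D by (simp add: emeasure_distr)
  then have "prob (A \<inter> (X -` B \<inter> space M)) / prob A = prob (X -` B \<inter> space M)"
    using pos by (simp add: D_emeasure emeasure_eq_measure)
  then show ?thesis using pos by (simp add: field_simps)
qed

text \<open>The events \<open>a < Y\<close> are stable under intersection and generate all events of
  \<open>Y\<close>, so it suffices to treat them one at a time.\<close>

lemma indep_set_of_char:
  fixes X :: "'a \<Rightarrow> real" and Y :: "'a \<Rightarrow> ereal"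
  assumes X [measurable]: "X \<in> borel_measurable M" and Y [measurable]: "Y \<in> borel_measurable M"
    and char: "\<And>a \<omega>. expectation (\<lambda>w. indicator {w \<in> space M. a < Y w} w *\<^sub>R iexp (\<omega> * X w)) =
      of_real (prob {w \<in> space M. a < Y w}) * expectation (\<lambda>w. iexp (\<omega> * X w))"
  shows "indep_set (sets (vimage_algebra (space M) Y borel)) (sets (vimage_algebra (space M) X borel))"
proof -
  let ?G = "{Y -` A \<inter> space M | A. A \<in> range greaterThan}" and ?H = "{X -` B \<inter> space M | B. B \<in> sets borel}"
  have "indep_set (sigma_sets (space M) ?G) (sigma_sets (space M) ?H)"
  proof (rule indep_set_sigma_sets)
    show "indep_set ?G ?H"
      unfolding indep_sets2_eq
    proof (intro conjI ballI)
      show "?G \<subseteq> events" "?H \<subseteq> events" by auto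
      fix a b assume "a \<in> ?G" "b \<in> ?H"
      then obtain c B where ab: "a = Y -` {c<..} \<inter> space M" "b = X -` B \<inter> space M" "B \<in> sets borel" by auto
      have a: "a = {w \<in> space M. c < Y w}" unfolding ab by auto
      show "prob (a \<inter> b) = prob a * prob b"
        unfolding ab(2) a by (rule indep_event_of_char[OF X _ char ab(3)]) measurable
    qed
    show "Int_stable ?G"
    proof (rule Int_stableI, safe)
      fix a b :: ereal
      have "Y -` {a<..} \<inter> space M \<inter> (Y -` {b<..} \<inter> space M) = Y -` {max a b<..} \<inter> space M" by auto
      then show "\<exists>A. Y -` {a<..} \<inter> space M \<inter> (Y -` {b<..} \<inter> space M) = Y -` A \<inter> space M \<and> A \<in> range greaterThan"
        by blast
    qed
    show "Int_stable ?H"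
    proof (rule Int_stableI, safe)
      fix A B :: "real set" assume "A \<in> sets borel" "B \<in> sets borel"
      then show "\<exists>C. X -` A \<inter> space M \<inter> (X -` B \<inter> space M) = X -` C \<inter> space M \<and> C \<in> sets borel"
        by (intro exI[of _ "A \<inter> B"]) auto
    qed
  qed
  moreover have "sigma_sets (space M) ?G = sigma_sets (space M) {Y -` A \<inter> space M | A. A \<in> sets borel}"
  proof -
    have "sets (borel :: ereal measure) = sigma_sets UNIV (range greaterThan)"
      unfolding borel_Ioi by (rule sets_measure_of) simp
    then have "{Y -` A \<inter> space M | A. A \<in> sets borel} = sigma_sets (space M) ?G"
      using sigma_sets_vimage_commute[of Y "space M" UNIV "range greaterThan"] by simp
    moreover have "?G \<subseteq> Pow (space M)" by auto
    ultimately show ?thesis by (simp only: sigma_sets_sigma_sets_eq)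
  qed
  ultimately show ?thesis by (simp add: sets_vimage_algebra)
qed

end

section \<open>Interference above a fixed threshold\<close>

text \<open>Finiteness keeps the inequality strict; the bound by \<open>top\<close> covers the empty
  set, whose infimum is \<open>top\<close>.\<close>

lemma less_INF_finite:
  fixes a :: "'b::{complete_linorder}"
  assumes "finite A" "a < top" "\<And>x. x \<in> A \<Longrightarrow> a < f x"
  shows "a < (INF x\<in>A. f x)"
  using assms by (induction A rule: finite_induct) (auto simp: inf_min)

locale network_model = prob_space M for M :: "'w measure" +
  fixes lamPH lamw \<beta> \<kappa> K RD :: real and Nmax :: nat
    and \<Psi> :: "nat \<Rightarrow> 'w \<Rightarrow> nat set" and pos :: "nat \<Rightarrow> 'w \<Rightarrow> real \<times> real" and h :: "nat \<Rightarrow> 'w \<Rightarrow> real"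
  assumes params: "lamPH > 0" "lamw > 0" "\<beta> > 0" "\<kappa> > 0" "0 \<le> K" "RD > 0"
    and poisson: "\<And>N. N \<le> Nmax \<Longrightarrow> poisson_process M (intensity lamPH lamw RD N) (\<Psi> N) pos"
    and decomposition: "\<And>w. w \<in> space M \<Longrightarrow> disjoint_family_on (\<lambda>N. \<Psi> N w) {..Nmax}"
    and processes_indep: "indep_sets (\<lambda>N. process_events M (\<Psi> N) pos) {..Nmax}"
    and gains_exponential: "\<And>n. distributed M lborel (h n) (exponential_density 1)"
    and gains_indep: "indep_vars (\<lambda>_. borel) h UNIV"
    and gains_indep_processes:
      "indep_set
         (sets (vimage_algebra (space M) (\<lambda>w n. h n w) (Pi\<^sub>M UNIV (\<lambda>_. borel))))
         (sets (vimage_algebra (space M)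
            (\<lambda>w. (\<lambda>N\<in>{..Nmax}. \<lambda>n. n \<in> \<Psi> N w, \<lambda>n. pos n w))
            (Pi\<^sub>M {..Nmax} (\<lambda>_. Pi\<^sub>M UNIV (\<lambda>_. count_space UNIV)) \<Otimes>\<^sub>M Pi\<^sub>M UNIV (\<lambda>_. borel))))"
begin

abbreviation config_algebra :: "((nat \<Rightarrow> nat \<Rightarrow> bool) \<times> (nat \<Rightarrow> real \<times> real)) measure" where
  "config_algebra \<equiv> Pi\<^sub>M {..Nmax} (\<lambda>_. Pi\<^sub>M UNIV (\<lambda>_. count_space UNIV)) \<Otimes>\<^sub>M Pi\<^sub>M UNIV (\<lambda>_. borel)"

abbreviation joint_algebra ::
    "((nat \<Rightarrow> real) \<times> (nat \<Rightarrow> nat \<Rightarrow> bool) \<times> (nat \<Rightarrow> real \<times> real)) measure" where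
  "joint_algebra \<equiv> Pi\<^sub>M UNIV (\<lambda>_. borel) \<Otimes>\<^sub>M config_algebra"

abbreviation \<Lambda> :: "nat \<Rightarrow> (real \<times> real) measure" where
  "\<Lambda> \<equiv> intensity lamPH lamw RD"

text \<open>Labels and positions as one random element, in exactly the form whose independence of
  the gains is assumed.\<close>

definition config :: "'w \<Rightarrow> (nat \<Rightarrow> nat \<Rightarrow> bool) \<times> (nat \<Rightarrow> real \<times> real)" where
  "config w = (\<lambda>N\<in>{..Nmax}. \<lambda>n. n \<in> \<Psi> N w, \<lambda>n. pos n w)"

lemma pos_measurable [measurable]: "pos n \<in> borel_measurable M"
  using poisson[of 0] by (simp add: poisson_process_def)

lemma gain_measurable [measurable]: "h n \<in> borel_measurable M"
  using distributed_measurable[OF gains_exponential[of n]] by simp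

lemma label_measurable:
  assumes "N \<le> Nmax" shows "Measurable.pred M (\<lambda>w. n \<in> \<Psi> N w)"
  using poisson[OF assms] by (simp add: poisson_process_def pred_def)

lemma finite_labels: "N \<le> Nmax \<Longrightarrow> w \<in> space M \<Longrightarrow> finite (\<Psi> N w)"
  using poisson[of N] by (simp add: poisson_process_def)

lemma config_measurable: "config \<in> measurable M config_algebra"
  unfolding config_def
proof (intro measurable_Pair measurable_restrict)
  fix N assume "N \<in> {..Nmax}"
  then show "(\<lambda>w n. n \<in> \<Psi> N w) \<in> measurable M (Pi\<^sub>M UNIV (\<lambda>_. count_space UNIV))"
    using label_measurable by (intro measurable_PiM_single') (auto simp: pred_def)
next
  show "(\<lambda>w n. pos n w) \<in> measurable M (Pi\<^sub>M UNIV (\<lambda>_. borel))"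
    by (intro measurable_PiM_single') auto
qed

lemma gains_measurable: "(\<lambda>w n. h n w) \<in> measurable M (Pi\<^sub>M UNIV (\<lambda>_. borel))"
  by (intro measurable_PiM_single') auto

lemma config_expectation:
  fixes f :: "(nat \<Rightarrow> real) \<Rightarrow> (nat \<Rightarrow> nat \<Rightarrow> bool) \<times> (nat \<Rightarrow> real \<times> real) \<Rightarrow> 'd::{banach, second_countable_topology}"
  assumes "(\<lambda>(\<eta>, c). f \<eta> c) \<in> borel_measurable joint_algebra"
    and "\<And>\<eta> c. norm (f \<eta> c) \<le> B"
  shows "expectation (\<lambda>w. f (\<lambda>n. h n w) (config w)) =
    expectation (\<lambda>v. expectation (\<lambda>w. f (\<lambda>n. h n w) (config v)))"
  by (rule indep_expectation[OF gains_indep_processes[folded config_def] gains_measurable config_measurable assms])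

lemma label_component_measurable:
  assumes "N \<le> Nmax"
  shows "(\<lambda>p. fst (snd p) N n) \<in> measurable joint_algebra (count_space UNIV)"
proof -
  have "(\<lambda>p. fst (snd p) N) \<in> measurable joint_algebra (Pi\<^sub>M UNIV (\<lambda>_. count_space UNIV))"
    by (rule measurable_compose[OF _ measurable_component_singleton[of N "{..Nmax}"]])
       (use assms in \<open>auto intro!: measurable_compose[OF measurable_snd measurable_fst]\<close>)
  then show ?thesis
    by (rule measurable_compose[OF _ measurable_component_singleton]) simp
qed

lemma gain_component_measurable:
  "(\<lambda>p. fst p n) \<in> borel_measurable joint_algebra"
  by (rule measurable_compose[OF measurable_fst measurable_component_singleton]) simp

lemma pos_component_measurable:
  "(\<lambda>p. snd (snd p) n) \<in> borel_measurable joint_algebra"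
  by (rule measurable_compose[OF measurable_compose[OF measurable_snd measurable_snd] measurable_component_singleton]) simp

section \<open>Averaging out the gains\<close>

lemma truncated_prod_eventually:
  fixes c :: "nat \<Rightarrow> nat \<Rightarrow> complex"
  assumes w: "w \<in> space M"
  shows "\<forall>\<^sub>F m in sequentially. (\<Prod>n<m. \<Prod>N\<le>Nmax. if n \<in> \<Psi> N w then c N n else 1) =
    (\<Prod>N\<le>Nmax. \<Prod>n\<in>\<Psi> N w. c N n)"
proof -
  have "finite (\<Union>N\<le>Nmax. \<Psi> N w)" using finite_labels[OF _ w] by auto
  then obtain m0 where m0: "\<And>N n. N \<le> Nmax \<Longrightarrow> n \<in> \<Psi> N w \<Longrightarrow> n < m0"
    by (auto simp: finite_nat_set_iff_bounded)
  show ?thesis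
    using eventually_ge_at_top[of m0]
  proof eventually_elim
    fix m assume m: "m0 \<le> m"
    have "(\<Prod>n<m. \<Prod>N\<le>Nmax. if n \<in> \<Psi> N w then c N n else 1) =
        (\<Prod>N\<le>Nmax. \<Prod>n<m. if n \<in> \<Psi> N w then c N n else 1)"
      by (rule prod.swap)
    also have "\<dots> = (\<Prod>N\<le>Nmax. \<Prod>n\<in>\<Psi> N w. c N n)"
    proof (rule prod.cong[OF refl])
      fix N assume "N \<in> {..Nmax}"
      then have "\<Psi> N w \<subseteq> {..<m}" using m0 m by (auto intro: less_le_trans)
      then show "(\<Prod>n<m. if n \<in> \<Psi> N w then c N n else 1) = (\<Prod>n\<in>\<Psi> N w. c N n)"
        by (simp add: prod.inter_restrict[symmetric] Int_absorb1)
    qed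
    finally show "(\<Prod>n<m. \<Prod>N\<le>Nmax. if n \<in> \<Psi> N w then c N n else 1) =
        (\<Prod>N\<le>Nmax. \<Prod>n\<in>\<Psi> N w. c N n)" .
  qed
qed

lemma norm_prod_if_le_1:
  fixes c :: "'i \<Rightarrow> complex"
  assumes "\<And>i. i \<in> A \<Longrightarrow> norm (c i) \<le> 1"
  shows "norm (\<Prod>i\<in>A. if P i then c i else 1) \<le> 1"
  unfolding prod_norm[symmetric] by (rule prod_le_1) (use assms in auto)

text \<open>Products over random label sets become products over all labels below \<open>m\<close>,
  with factor 1 for absent ones. These are measurable functions of finitely many coordinates and
  eventually exact, since each realization has finitely many labels.\<close>

lemma truncated_prod_expectation_tendsto:
  fixes x :: "nat \<Rightarrow> nat \<Rightarrow> 'w \<Rightarrow> complex"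
  assumes meas: "\<And>N n. x N n \<in> borel_measurable M" and norm: "\<And>N n w. norm (x N n w) \<le> 1"
  shows "(\<lambda>m. expectation (\<lambda>w. \<Prod>n<m. \<Prod>N\<le>Nmax. if n \<in> \<Psi> N w then x N n w else 1)) \<longlonglongrightarrow>
    expectation (\<lambda>w. \<Prod>N\<le>Nmax. \<Prod>n\<in>\<Psi> N w. x N n w)"
proof (rule integral_dominated_convergence[where w="\<lambda>_. 1"])
  let ?f = "\<lambda>m w. \<Prod>n<m. \<Prod>N\<le>Nmax. if n \<in> \<Psi> N w then x N n w else 1"
  show f_meas: "?f m \<in> borel_measurable M" for m
    using meas label_measurable by (intro borel_measurable_prod measurable_If) (auto simp: pred_def)
  have lim: "(\<lambda>m. ?f m w) \<longlonglongrightarrow> (\<Prod>N\<le>Nmax. \<Prod>n\<in>\<Psi> N w. x N n w)" if "w \<in> space M" for w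
    by (rule tendsto_eventually[OF truncated_prod_eventually[OF that]])
  then show "AE w in M. (\<lambda>m. ?f m w) \<longlonglongrightarrow> (\<Prod>N\<le>Nmax. \<Prod>n\<in>\<Psi> N w. x N n w)" by simp
  show "(\<lambda>w. \<Prod>N\<le>Nmax. \<Prod>n\<in>\<Psi> N w. x N n w) \<in> borel_measurable M"
    by (rule borel_measurable_LIMSEQ_metric[OF f_meas lim])
  have "norm (?f m w) \<le> 1" for m w
    unfolding prod_norm[symmetric, of _ "{..<m}"]
    using norm_prod_if_le_1[of "{..Nmax}", OF norm] by (intro prod_le_1) auto
  then show "AE w in M. norm (?f m w) \<le> 1" for m by simp
qed simp

text \<open>\<open>u N y x\<close> is the factor of a point at \<open>x\<close> with gain
  \<open>y\<close>, and \<open>v N x\<close> its mean over the gain. Freezing the configuration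
  allows each \<open>u\<close> to be replaced by \<open>v\<close>; the generating functional
  evaluates the rest.\<close>

lemma gains_average:
  fixes u :: "nat \<Rightarrow> real \<Rightarrow> real \<times> real \<Rightarrow> complex" and v :: "nat \<Rightarrow> real \<times> real \<Rightarrow> complex"
  assumes u_meas: "\<And>N. (\<lambda>p. u N (fst p) (snd p)) \<in> borel_measurable (borel \<Otimes>\<^sub>M borel)"
    and u_norm: "\<And>N y x. norm (u N y x) \<le> 1"
    and v_meas: "\<And>N. v N \<in> borel_measurable borel"
    and v_norm: "\<And>N x. norm (v N x) \<le> 1"
    and uv: "\<And>N n x. expectation (\<lambda>w. u N (h n w) x) = v N x"
  shows "expectation (\<lambda>w. \<Prod>N\<le>Nmax. \<Prod>n\<in>\<Psi> N w. u N (h n w) (pos n w)) =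
    exp (- (\<Sum>N\<le>Nmax. \<integral>x. 1 - v N x \<partial>\<Lambda> N))"
proof -
  define F where "F m \<eta> c = (\<Prod>n<m. \<Prod>N\<le>Nmax. if fst c N n then u N (\<eta> n) (snd c n) else 1)"
    for m :: nat and \<eta> :: "nat \<Rightarrow> real" and c :: "(nat \<Rightarrow> nat \<Rightarrow> bool) \<times> (nat \<Rightarrow> real \<times> real)"
  have F_config: "F m (\<lambda>n. h n w) (config v) =
      (\<Prod>n<m. \<Prod>N\<le>Nmax. if n \<in> \<Psi> N v then u N (h n w) (pos n v) else 1)" for m w v
    unfolding F_def config_def by (intro prod.cong refl) simp
  have term_meas: "(\<lambda>p. if fst (snd p) N n then u N (fst p n) (snd (snd p) n) else 1)
      \<in> borel_measurable joint_algebra" if "N \<le> Nmax" for N n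
  proof (rule measurable_If)
    show "(\<lambda>p. u N (fst p n) (snd (snd p) n)) \<in> borel_measurable joint_algebra"
      using measurable_compose[OF measurable_Pair[OF gain_component_measurable pos_component_measurable] u_meas]
      by simp
    show "{p \<in> space joint_algebra. fst (snd p) N n}
        \<in> sets joint_algebra"
      using label_component_measurable[OF that] by (simp add: pred_def)
  qed simp
  have F_meas: "(\<lambda>(\<eta>, c). F m \<eta> c) \<in> borel_measurable joint_algebra" for m
    unfolding F_def case_prod_unfold by (intro borel_measurable_prod term_meas) simp
  have F_norm: "norm (F m \<eta> c) \<le> 1" for m \<eta> c
    unfolding F_def prod_norm[symmetric]
    by (intro prod_le_1 conjI norm_ge_zero prod_nonneg) (use u_norm in \<open>auto intro!: prod_le_1\<close>)
  \<comment> \<open>A label lies in at most one \<open>\<Psi> N\<close>, so its gain occurs in a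
    single nontrivial factor. Were it to occur in two, the mean of their product would not be the
    product of the means.\<close>
  have single: "(\<Prod>N\<le>Nmax. if n \<in> \<Psi> N w then c N else 1) =
      (if \<exists>N\<le>Nmax. n \<in> \<Psi> N w then c (THE N. N \<le> Nmax \<and> n \<in> \<Psi> N w) else 1)"
    if w: "w \<in> space M" for n w and c :: "nat \<Rightarrow> complex"
  proof (cases "\<exists>N\<le>Nmax. n \<in> \<Psi> N w")
    case True
    then obtain N0 where N0: "N0 \<le> Nmax" "n \<in> \<Psi> N0 w" by blast
    have uniq: "N = N0" if "N \<le> Nmax" "n \<in> \<Psi> N w" for N
      using decomposition[OF w] that N0 unfolding disjoint_family_on_def by blast
    have "(THE N. N \<le> Nmax \<and> n \<in> \<Psi> N w) = N0" using N0 uniq by blast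
    moreover have "(\<Prod>N\<le>Nmax. if n \<in> \<Psi> N w then c N else 1) = (\<Prod>N\<le>Nmax. if N = N0 then c N else 1)"
    proof (rule prod.cong[OF refl])
      fix N assume "N \<in> {..Nmax}"
      then have "n \<in> \<Psi> N w \<longleftrightarrow> N = N0" using N0 uniq[of N] by auto
      then show "(if n \<in> \<Psi> N w then c N else 1) = (if N = N0 then c N else 1)" by simp
    qed
    ultimately show ?thesis using True N0 by simp
  next
    case False
    then show ?thesis by (auto intro!: prod.neutral)
  qed
  have cond: "expectation (\<lambda>w. F m (\<lambda>n. h n w) (config \<omega>)) =
      (\<Prod>n<m. \<Prod>N\<le>Nmax. if n \<in> \<Psi> N \<omega> then v N (pos n \<omega>) else 1)"
    if \<omega>: "\<omega> \<in> space M" for m \<omega>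
  proof -
    define G where "G n y = (\<Prod>N\<le>Nmax. if n \<in> \<Psi> N \<omega> then u N y (pos n \<omega>) else 1)" for n y
    have u_y: "(\<lambda>y. u N y x) \<in> borel_measurable borel" for N x
    proof -
      have "(\<lambda>y. (y, x)) \<in> measurable borel (borel \<Otimes>\<^sub>M borel)" by measurable
      from measurable_compose[OF this u_meas] show ?thesis by simp
    qed
    have G_meas: "G n \<in> borel_measurable borel" for n
      unfolding G_def by (intro borel_measurable_prod measurable_If u_y) auto
    have G_norm: "norm (G n y) \<le> 1" for n y
      unfolding G_def by (rule norm_prod_if_le_1) (rule u_norm)
    have "indep_vars (\<lambda>_. borel) (\<lambda>n w. G n (h n w)) UNIV"
      using gains_indep by (rule indep_vars_compose2) (rule G_meas)
    then have indep: "indep_vars (\<lambda>_. borel) (\<lambda>n w. G n (h n w)) {..<m}"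
      by (rule indep_vars_subset) simp
    have "expectation (\<lambda>w. F m (\<lambda>n. h n w) (config \<omega>)) = expectation (\<lambda>w. \<Prod>n<m. G n (h n w))"
      unfolding F_config G_def ..
    also have "\<dots> = (\<Prod>n<m. expectation (\<lambda>w. G n (h n w)))"
    proof (rule indep_vars_lebesgue_integral[OF _ indep])
      fix n
      have "(\<lambda>w. G n (h n w)) \<in> borel_measurable M" by (rule measurable_compose[OF gain_measurable G_meas])
      then show "integrable M (\<lambda>w. G n (h n w))"
        by (intro integrable_const_bound[where B=1] AE_I2 G_norm)
    qed simp
    also have "\<dots> = (\<Prod>n<m. \<Prod>N\<le>Nmax. if n \<in> \<Psi> N \<omega> then v N (pos n \<omega>) else 1)"
      unfolding G_def single[OF \<omega>]
    proof (intro prod.cong refl)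
      fix n
      show "expectation (\<lambda>w. if \<exists>N\<le>Nmax. n \<in> \<Psi> N \<omega>
            then u (THE N. N \<le> Nmax \<and> n \<in> \<Psi> N \<omega>) (h n w) (pos n \<omega>) else 1) =
          (if \<exists>N\<le>Nmax. n \<in> \<Psi> N \<omega> then v (THE N. N \<le> Nmax \<and> n \<in> \<Psi> N \<omega>) (pos n \<omega>) else 1)"
        by (cases "\<exists>N\<le>Nmax. n \<in> \<Psi> N \<omega>") (simp_all only: uv if_True if_False, simp add: prob_space)
    qed
    finally show ?thesis .
  qed
  have u_lim: "(\<lambda>m. expectation (\<lambda>w. F m (\<lambda>n. h n w) (config w))) \<longlonglongrightarrow>
      expectation (\<lambda>w. \<Prod>N\<le>Nmax. \<Prod>n\<in>\<Psi> N w. u N (h n w) (pos n w))"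
  proof -
    have "(\<lambda>w. u N (h n w) (pos n w)) \<in> borel_measurable M" for N n
      using measurable_compose[OF measurable_Pair[OF gain_measurable pos_measurable] u_meas] by simp
    from truncated_prod_expectation_tendsto[where x="\<lambda>N n w. u N (h n w) (pos n w)", OF this u_norm]
    show ?thesis unfolding F_config .
  qed
  have "expectation (\<lambda>w. F m (\<lambda>n. h n w) (config w)) =
      expectation (\<lambda>w. \<Prod>n<m. \<Prod>N\<le>Nmax. if n \<in> \<Psi> N w then v N (pos n w) else 1)" for m
    unfolding config_expectation[OF F_meas F_norm]
    by (rule Bochner_Integration.integral_cong[OF refl cond])
  moreover have "(\<lambda>m. expectation (\<lambda>w. \<Prod>n<m. \<Prod>N\<le>Nmax. if n \<in> \<Psi> N w then v N (pos n w) else 1)) \<longlonglongrightarrow>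
      expectation (\<lambda>w. \<Prod>N\<le>Nmax. \<Prod>n\<in>\<Psi> N w. v N (pos n w))"
    by (rule truncated_prod_expectation_tendsto[where x="\<lambda>N n w. v N (pos n w)",
          OF measurable_compose[OF pos_measurable v_meas] v_norm])
  ultimately have "expectation (\<lambda>w. \<Prod>N\<le>Nmax. \<Prod>n\<in>\<Psi> N w. u N (h n w) (pos n w)) =
      expectation (\<lambda>w. \<Prod>N\<le>Nmax. \<Prod>n\<in>\<Psi> N w. v N (pos n w))"
    using u_lim by (simp add: LIMSEQ_unique)
  also have "\<dots> = exp (- (\<Sum>N\<le>Nmax. \<integral>x. 1 - v N x \<partial>\<Lambda> N))"
    by (rule poisson_processes_pgf(2)[where \<Lambda>=\<Lambda>])
       (use poisson processes_indep v_meas v_norm in auto)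
  finally show ?thesis .
qed

section \<open>Interference as a function of a deterministic threshold\<close>

abbreviation loss :: "nat \<Rightarrow> nat \<Rightarrow> 'w \<Rightarrow> ereal" where
  "loss N n w \<equiv> path_loss \<kappa> \<beta> K N (norm (pos n w))"

abbreviation att :: "nat \<Rightarrow> nat \<Rightarrow> 'w \<Rightarrow> real" where
  "att N n w \<equiv> attenuation \<kappa> \<beta> K N (norm (pos n w))"

abbreviation L :: "'w \<Rightarrow> ereal" where
  "L \<equiv> min_path_loss \<kappa> \<beta> K Nmax \<Psi> pos"

text \<open>The threshold is a free argument, so that for deterministic \<open>t\<close> its law can
  be computed; \<open>t = L w\<close> gives the interference of the model. The set \<open>S\<close>
  is either all of \<open>{..Nmax}\<close> or a single number of walls.\<close>

definition interference_above :: "nat set \<Rightarrow> ereal \<Rightarrow> 'w \<Rightarrow> real" where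
  "interference_above S t w = (\<Sum>N\<in>S. \<Sum>n\<in>\<Psi> N w. h n w * att N n w * of_bool (t < loss N n w))"

lemma interference_from_eq: "interference_from \<kappa> \<beta> K Nmax \<Psi> pos h N w = interference_above {N} (L w) w"
  by (simp add: interference_from_def interference_above_def attenuation_def divide_ereal_def)

lemma interference_eq: "interference \<kappa> \<beta> K Nmax \<Psi> pos h w = interference_above {..Nmax} (L w) w"
  by (simp add: interference_def interference_from_def interference_above_def attenuation_def divide_ereal_def)

lemma path_loss_nonneg: "0 \<le> path_loss \<kappa> \<beta> K N r"
  using params by (simp add: path_loss_def divide_ereal_def)

lemma L_nonneg: "0 \<le> L w"
  unfolding min_path_loss_def by (intro INF_greatest path_loss_nonneg)

text \<open>Makes the indicator of \<open>a < L\<close> a product over points. The value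
  \<open>a = \<infinity>\<close> is excluded because without transmitters the right side holds
  vacuously.\<close>

lemma L_greater_iff:
  assumes "w \<in> space M" "a < \<infinity>"
  shows "a < L w \<longleftrightarrow> (\<forall>N\<le>Nmax. \<forall>n\<in>\<Psi> N w. a < loss N n w)"
proof
  assume "a < L w"
  then show "\<forall>N\<le>Nmax. \<forall>n\<in>\<Psi> N w. a < loss N n w"
    unfolding min_path_loss_def by (auto dest!: less_INF_D)
next
  assume *: "\<forall>N\<le>Nmax. \<forall>n\<in>\<Psi> N w. a < loss N n w"
  show "a < L w"
    unfolding min_path_loss_def
    using * assms(2) finite_labels[OF _ assms(1)] by (intro less_INF_finite) (auto simp: top_ereal_def)
qed

lemma L_measurable [measurable]: "L \<in> borel_measurable M"
proof -
  \<comment> \<open>The random index set is replaced by all labels, absent ones having infinite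
    loss, so that measurability of a countable infimum applies.\<close>
  have inner: "(INF n\<in>\<Psi> N w. loss N n w) = (INF n. if n \<in> \<Psi> N w then loss N n w else \<infinity>)" for N w
  proof (intro antisym INF_greatest)
    fix n
    show "(INF n\<in>\<Psi> N w. loss N n w) \<le> (if n \<in> \<Psi> N w then loss N n w else \<infinity>)"
      by (auto intro: INF_lower)
  next
    fix n assume "n \<in> \<Psi> N w"
    then show "(INF n. if n \<in> \<Psi> N w then loss N n w else \<infinity>) \<le> loss N n w"
      by (intro INF_lower2[of n]) auto
  qed
  have "(\<lambda>w. INF n. if n \<in> \<Psi> N w then loss N n w else \<infinity>) \<in> borel_measurable M" if "N \<le> Nmax" for N
  proof (rule borel_measurable_INF)
    show "(\<lambda>w. if n \<in> \<Psi> N w then loss N n w else \<infinity>) \<in> borel_measurable M" for n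
      using label_measurable[OF that, of n] by (intro measurable_If) (auto simp: pred_def)
  qed simp
  then have "(\<lambda>w. INF N\<in>{..Nmax}. INF n. if n \<in> \<Psi> N w then loss N n w else \<infinity>) \<in> borel_measurable M"
    by (rule borel_measurable_INF[OF countable_finite[OF finite_atMost]]) (simp only: atMost_iff)
  then show ?thesis unfolding min_path_loss_def inner .
qed

text \<open>Exhibits the interference as an eventually constant sequence of linear combinations of
  gains whose coefficients depend on the configuration only. Measurability and absence of atoms both
  rest on this form.\<close>

lemma truncated_interference_eventually:
  assumes S: "S \<subseteq> {..Nmax}" and w: "w \<in> space M"
  shows "\<forall>\<^sub>F m in sequentially.
    (\<Sum>n<m. h n w * (\<Sum>N\<in>S. if n \<in> \<Psi> N w then att N n w * of_bool (t < loss N n w) else 0)) =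
    interference_above S t w"
proof -
  have "finite (\<Union>N\<le>Nmax. \<Psi> N w)" using finite_labels[OF _ w] by auto
  then obtain m0 where m0: "\<And>N n. N \<le> Nmax \<Longrightarrow> n \<in> \<Psi> N w \<Longrightarrow> n < m0"
    by (auto simp: finite_nat_set_iff_bounded)
  show ?thesis
    using eventually_ge_at_top[of m0]
  proof eventually_elim
    fix m assume m: "m0 \<le> m"
    have "(\<Sum>n<m. h n w * (\<Sum>N\<in>S. if n \<in> \<Psi> N w then att N n w * of_bool (t < loss N n w) else 0)) =
        (\<Sum>N\<in>S. \<Sum>n<m. h n w * (if n \<in> \<Psi> N w then att N n w * of_bool (t < loss N n w) else 0))"
      unfolding sum_distrib_left by (rule sum.swap)
    also have "\<dots> = interference_above S t w"
      unfolding interference_above_def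
    proof (rule sum.cong[OF refl])
      fix N assume "N \<in> S"
      then have "N \<le> Nmax" using S by auto
      then have sub: "\<Psi> N w \<subseteq> {..<m}" using m0 m by (auto intro: less_le_trans)
      have "(\<Sum>n<m. h n w * (if n \<in> \<Psi> N w then att N n w * of_bool (t < loss N n w) else 0)) =
          (\<Sum>n<m. if n \<in> \<Psi> N w then h n w * att N n w * of_bool (t < loss N n w) else 0)"
        by (intro sum.cong) auto
      also have "\<dots> = (\<Sum>n\<in>{..<m} \<inter> \<Psi> N w. h n w * att N n w * of_bool (t < loss N n w))"
        by (rule sum.inter_restrict[symmetric]) simp
      finally show "(\<Sum>n<m. h n w * (if n \<in> \<Psi> N w then att N n w * of_bool (t < loss N n w) else 0)) =
          (\<Sum>n\<in>\<Psi> N w. h n w * att N n w * of_bool (t < loss N n w))"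
        using sub by (simp add: Int_absorb1)
    qed
    finally show "(\<Sum>n<m. h n w * (\<Sum>N\<in>S. if n \<in> \<Psi> N w then att N n w * of_bool (t < loss N n w) else 0)) =
        interference_above S t w" .
  qed
qed

lemma interference_above_measurable:
  assumes S: "S \<subseteq> {..Nmax}" and T [measurable]: "T \<in> borel_measurable M"
  shows "(\<lambda>w. interference_above S (T w) w) \<in> borel_measurable M"
proof (rule borel_measurable_LIMSEQ_metric[OF _ tendsto_eventually[OF truncated_interference_eventually[OF S]]])
  fix m
  have "(\<lambda>w. if n \<in> \<Psi> N w then att N n w * of_bool (T w < loss N n w) else 0) \<in> borel_measurable M"
    if "N \<in> S" for N n
    using label_measurable[of N n] S that by (intro measurable_If) (auto simp: pred_def)
  then show "(\<lambda>w. \<Sum>n<m. h n w * (\<Sum>N\<in>S. if n \<in> \<Psi> N w then att N n w * of_bool (T w < loss N n w) else 0))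
      \<in> borel_measurable M"
    by (intro borel_measurable_sum borel_measurable_times gain_measurable)
qed

lemma gain_factor_expectation:
  "expectation (\<lambda>w. if t < path_loss \<kappa> \<beta> K N (norm x) then iexp (\<omega> * (h n w * attenuation \<kappa> \<beta> K N (norm x))) else 1) =
    gain_factor \<kappa> \<beta> K N \<omega> t x"
proof (cases "t < path_loss \<kappa> \<beta> K N (norm x)")
  case True
  have "expectation (\<lambda>w. iexp (h n w * (\<omega> * attenuation \<kappa> \<beta> K N (norm x)))) = gain_factor \<kappa> \<beta> K N \<omega> t x"
    unfolding exponential_char[OF gains_exponential] gain_factor_def using True by simp
  then show ?thesis using True by (simp add: mult_ac)
qed (simp add: gain_factor_def prob_space)

text \<open>Indicator and exponential are both products over points, so the whole integrand is one:
  a point with loss at most \<open>a\<close> contributes 0, and points of the processes outside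
  \<open>S\<close> enter only through the indicator.\<close>

lemma indicator_char_eq_exp:
  assumes S: "S \<subseteq> {..Nmax}" and a: "a < \<infinity>"
  shows "expectation (\<lambda>w. indicator {w \<in> space M. a < L w} w *\<^sub>R iexp (\<omega> * interference_above S t w)) =
    exp (- (\<Sum>N\<le>Nmax. \<integral>x. 1 - (if a < path_loss \<kappa> \<beta> K N (norm x)
      then if N \<in> S then gain_factor \<kappa> \<beta> K N \<omega> t x else 1 else 0) \<partial>\<Lambda> N))"
proof -
  define u where "u N y x = (if a < path_loss \<kappa> \<beta> K N (norm x)
      then if N \<in> S then if t < path_loss \<kappa> \<beta> K N (norm x) then iexp (\<omega> * (y * attenuation \<kappa> \<beta> K N (norm x))) else 1
        else 1 else (0 :: complex))" for N y and x :: "real \<times> real"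
  define v where "v N x = (if a < path_loss \<kappa> \<beta> K N (norm x)
      then if N \<in> S then gain_factor \<kappa> \<beta> K N \<omega> t x else 1 else 0)" for N and x :: "real \<times> real"
  have prod_eq: "(\<Prod>N\<le>Nmax. \<Prod>n\<in>\<Psi> N w. u N (h n w) (pos n w)) =
      indicator {w \<in> space M. a < L w} w *\<^sub>R iexp (\<omega> * interference_above S t w)" if w: "w \<in> space M" for w
  proof (cases "a < L w")
    case True
    then have gt: "a < loss N n w" if "N \<le> Nmax" "n \<in> \<Psi> N w" for N n
      using that L_greater_iff[OF w a] by blast
    have "(\<Prod>N\<le>Nmax. \<Prod>n\<in>\<Psi> N w. u N (h n w) (pos n w)) =
        (\<Prod>N\<le>Nmax. \<Prod>n\<in>\<Psi> N w. iexp (if N \<in> S then \<omega> * (h n w * att N n w * of_bool (t < loss N n w)) else 0))"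
      using gt by (intro prod.cong refl) (auto simp: u_def)
    also have "\<dots> = (\<Prod>N\<le>Nmax. iexp (\<Sum>n\<in>\<Psi> N w. if N \<in> S then \<omega> * (h n w * att N n w * of_bool (t < loss N n w)) else 0))"
      using finite_labels[OF _ w] by (intro prod.cong refl) (simp add: exp_sum sum_distrib_left)
    also have "\<dots> = iexp (\<Sum>N\<le>Nmax. \<Sum>n\<in>\<Psi> N w. if N \<in> S then \<omega> * (h n w * att N n w * of_bool (t < loss N n w)) else 0)"
      by (simp add: exp_sum sum_distrib_left)
    also have "(\<Sum>N\<le>Nmax. \<Sum>n\<in>\<Psi> N w. if N \<in> S then \<omega> * (h n w * att N n w * of_bool (t < loss N n w)) else 0) =
        (\<Sum>N\<le>Nmax. if N \<in> S then \<Sum>n\<in>\<Psi> N w. \<omega> * (h n w * att N n w * of_bool (t < loss N n w)) else 0)"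
      by (intro sum.cong) auto
    also have "\<dots> = (\<Sum>N\<in>{..Nmax} \<inter> S. \<Sum>n\<in>\<Psi> N w. \<omega> * (h n w * att N n w * of_bool (t < loss N n w)))"
      by (rule sum.inter_restrict[symmetric]) simp
    also have "\<dots> = \<omega> * interference_above S t w"
      using S by (simp add: Int_absorb1 interference_above_def sum_distrib_left)
    finally show ?thesis using True w by simp
  next
    case False
    then obtain N n where Nn: "N \<le> Nmax" "n \<in> \<Psi> N w" "\<not> a < loss N n w"
      using L_greater_iff[OF w a] by blast
    have "(\<Prod>n\<in>\<Psi> N w. u N (h n w) (pos n w)) = 0"
      using Nn finite_labels[OF Nn(1) w] by (intro prod_zero) (auto simp: u_def)
    then have "(\<Prod>N\<le>Nmax. \<Prod>n\<in>\<Psi> N w. u N (h n w) (pos n w)) = 0"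
      using Nn(1) by (intro prod_zero) auto
    then show ?thesis using False by simp
  qed
  have "expectation (\<lambda>w. indicator {w \<in> space M. a < L w} w *\<^sub>R iexp (\<omega> * interference_above S t w)) =
      expectation (\<lambda>w. \<Prod>N\<le>Nmax. \<Prod>n\<in>\<Psi> N w. u N (h n w) (pos n w))"
    by (rule Bochner_Integration.integral_cong[OF refl prod_eq[symmetric]])
  also have "\<dots> = exp (- (\<Sum>N\<le>Nmax. \<integral>x. 1 - v N x \<partial>\<Lambda> N))"
  proof (rule gains_average)
    show "(\<lambda>p. u N (fst p) (snd p)) \<in> borel_measurable (borel \<Otimes>\<^sub>M borel)" for N
      unfolding u_def by measurable
    show "v N \<in> borel_measurable borel" for N
      unfolding v_def using gain_factor_measurable by measurable
    show "norm (u N y x) \<le> 1" for N y x by (simp add: u_def del: of_real_mult)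
    show "norm (v N x) \<le> 1" for N x by (simp add: v_def norm_gain_factor_le)
    show "expectation (\<lambda>w. u N (h n w) x) = v N x" for N n x
      unfolding u_def v_def using gain_factor_expectation[of t N x \<omega> n] by (simp add: prob_space)
  qed
  finally show ?thesis unfolding v_def .
qed

definition interference_char :: "nat set \<Rightarrow> ereal \<Rightarrow> real \<Rightarrow> complex" where
  "interference_char S t \<omega> =
    exp (- (\<Sum>N\<in>S. \<integral>x. 1 - gain_factor \<kappa> \<beta> K N \<omega> t x \<partial>\<Lambda> N))"

lemma finite_intensity:
  assumes "N \<le> Nmax" shows "finite_measure (\<Lambda> N)"
  using poisson[OF assms] by (simp add: poisson_process_def)

text \<open>As \<open>a < t\<close>, a point with loss at most \<open>a\<close> is not above
  \<open>t\<close>. Hence the integrand splits into \<open>p\<close>, which concerns the indicator,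
  and \<open>q\<close>, which concerns the interference; the sum in the exponent becomes a
  product.\<close>

lemma indicator_char_factor:
  assumes S: "S \<subseteq> {..Nmax}" and a: "a < t"
  shows "expectation (\<lambda>w. indicator {w \<in> space M. a < L w} w *\<^sub>R iexp (\<omega> * interference_above S t w)) =
    of_real (prob {w \<in> space M. a < L w}) * interference_char S t \<omega>"
proof -
  have a': "a < \<infinity>" using a by (rule less_le_trans) simp
  define p where "p N x = 1 - (if a < path_loss \<kappa> \<beta> K N (norm x) then 1 else 0 :: complex)" for N and x :: "real \<times> real"
  define q where "q N x = (if N \<in> S then 1 - gain_factor \<kappa> \<beta> K N \<omega> t x else 0)" for N and x :: "real \<times> real"
  have pq: "1 - (if a < path_loss \<kappa> \<beta> K N (norm x)
      then if N \<in> S then gain_factor \<kappa> \<beta> K N \<omega> t x else 1 else 0) = p N x + q N x" for N x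
    using a by (auto simp: p_def q_def gain_factor_def)
  have int: "integrable (\<Lambda> N) (p N)" "integrable (\<Lambda> N) (q N)"
    if "N \<le> Nmax" for N
  proof -
    interpret finite_measure "\<Lambda> N" by (rule finite_intensity[OF that])
    have "p N \<in> borel_measurable borel" unfolding p_def by measurable
    then show "integrable (\<Lambda> N) (p N)"
      by (intro integrable_const_bound[where B=1]) (auto simp: p_def cong: measurable_cong_sets)
    have "q N \<in> borel_measurable borel" unfolding q_def using gain_factor_measurable by measurable
    moreover have "norm (q N x) \<le> 2" for x
      using norm_triangle_ineq4[of 1 "gain_factor \<kappa> \<beta> K N \<omega> t x"] norm_gain_factor_le[of \<kappa> \<beta> K N \<omega> t x]
      by (auto simp: q_def)
    ultimately show "integrable (\<Lambda> N) (q N)"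
      by (intro integrable_const_bound[where B=2]) (auto cong: measurable_cong_sets)
  qed
  have sum_q: "(\<Sum>N\<le>Nmax. \<integral>x. q N x \<partial>\<Lambda> N) =
      (\<Sum>N\<in>S. \<integral>x. 1 - gain_factor \<kappa> \<beta> K N \<omega> t x \<partial>\<Lambda> N)"
  proof -
    have "(\<Sum>N\<le>Nmax. \<integral>x. q N x \<partial>\<Lambda> N) =
        (\<Sum>N\<le>Nmax. if N \<in> S then \<integral>x. 1 - gain_factor \<kappa> \<beta> K N \<omega> t x \<partial>\<Lambda> N else 0)"
      by (intro sum.cong) (auto simp: q_def)
    also have "\<dots> = (\<Sum>N\<in>{..Nmax} \<inter> S. \<integral>x. 1 - gain_factor \<kappa> \<beta> K N \<omega> t x \<partial>\<Lambda> N)"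
      by (rule sum.inter_restrict[symmetric]) simp
    finally show ?thesis using S by (simp add: Int_absorb1)
  qed
  have prob_eq: "of_real (prob {w \<in> space M. a < L w}) =
      exp (- (\<Sum>N\<le>Nmax. \<integral>x. p N x \<partial>\<Lambda> N))"
  proof -
    \<comment> \<open>The case \<open>S = {}\<close>, in which the interference is 0 and only the
      indicator remains.\<close>
    have "of_real (prob {w \<in> space M. a < L w}) =
        expectation (\<lambda>w. indicator {w \<in> space M. a < L w} w *\<^sub>R (1 :: complex))"
      by (subst integral_scaleR_left)
         (auto simp: emeasure_eq_measure scaleR_conv_of_real Bochner_Integration.integral_indicator intro!: arg_cong[where f=prob])
    also have "\<dots> = expectation (\<lambda>w. indicator {w \<in> space M. a < L w} w *\<^sub>R iexp (\<omega> * interference_above {} t w))"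
      by (simp add: interference_above_def)
    also have "\<dots> = exp (- (\<Sum>N\<le>Nmax. \<integral>x. p N x \<partial>\<Lambda> N))"
      by (subst indicator_char_eq_exp[OF _ a']) (simp_all add: p_def[abs_def] cong: if_cong)
    finally show ?thesis .
  qed
  have "expectation (\<lambda>w. indicator {w \<in> space M. a < L w} w *\<^sub>R iexp (\<omega> * interference_above S t w)) =
      exp (- (\<Sum>N\<le>Nmax. \<integral>x. p N x + q N x \<partial>\<Lambda> N))"
    unfolding indicator_char_eq_exp[OF S a'] pq ..
  also have "(\<Sum>N\<le>Nmax. \<integral>x. p N x + q N x \<partial>\<Lambda> N) =
      (\<Sum>N\<le>Nmax. \<integral>x. p N x \<partial>\<Lambda> N) + (\<Sum>N\<le>Nmax. \<integral>x. q N x \<partial>\<Lambda> N)"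
    unfolding sum.distrib[symmetric] using int by (intro sum.cong refl Bochner_Integration.integral_add) auto
  finally show ?thesis
    unfolding prob_eq interference_char_def sum_q by (simp add: exp_add[symmetric])
qed

lemma interference_char_eq:
  assumes S: "S \<subseteq> {..Nmax}" and t: "0 \<le> t"
  shows "expectation (\<lambda>w. iexp (\<omega> * interference_above S t w)) = interference_char S t \<omega>"
proof -
  have "{w \<in> space M. -\<infinity> < L w} = space M"
    using L_nonneg less_le_trans[of "-\<infinity>" 0] by auto
  moreover have "-\<infinity> < t" using t by (rule less_le_trans[rotated]) simp
  moreover have "expectation (\<lambda>w. indicator (space M) w *\<^sub>R iexp (\<omega> * interference_above S t w)) =
      expectation (\<lambda>w. iexp (\<omega> * interference_above S t w))"
    by (rule Bochner_Integration.integral_cong) auto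
  ultimately show ?thesis
    using indicator_char_factor[OF S, of "-\<infinity>" t \<omega>] by (simp add: prob_space)
qed

text \<open>
  The events \<open>a < min L t\<close> are empty for \<open>a \<ge> t\<close> and only involve points of path loss below \<open>t\<close> otherwise.
\<close>

lemma indep_min_path_loss_interference:
  assumes S: "S \<subseteq> {..Nmax}" and t: "0 \<le> t"
  shows "indep_set (sets (vimage_algebra (space M) (\<lambda>w. min (L w) t) borel))
    (sets (vimage_algebra (space M) (interference_above S t) borel))"
proof (rule indep_set_of_char)
  show "interference_above S t \<in> borel_measurable M"
    by (rule interference_above_measurable[OF S]) simp
  show "(\<lambda>w. min (L w) t) \<in> borel_measurable M" by measurable
  fix a \<omega>
  show "expectation (\<lambda>w. indicator {w \<in> space M. a < min (L w) t} w *\<^sub>R iexp (\<omega> * interference_above S t w)) =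
      of_real (prob {w \<in> space M. a < min (L w) t}) * expectation (\<lambda>w. iexp (\<omega> * interference_above S t w))"
  proof (cases "a < t")
    case True
    then show ?thesis
      using indicator_char_factor[OF S True] interference_char_eq[OF S t] by simp
  qed simp
qed

end

section \<open>Conditioning on the minimum path loss\<close>

text \<open>
  The grid value has to lie strictly above \<open>s\<close>: then \<open>L < r\<close> wherever the grid value of \<open>L\<close> is a finite
  \<open>r\<close>, so that \<open>L = min L r\<close> there.
\<close>

definition dyadic_above :: "nat \<Rightarrow> ereal \<Rightarrow> ereal" where
  "dyadic_above m s = (if s < ereal (real m)
     then ereal ((of_int \<lfloor>2 ^ m * real_of_ereal s\<rfloor> + 1) / 2 ^ m) else \<infinity>)"

definition dyadic_levels :: "nat \<Rightarrow> ereal set" where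
  "dyadic_levels m = insert \<infinity> ((\<lambda>k. ereal (real k / 2 ^ m)) ` {..2 ^ m * m})"

lemma finite_dyadic_levels: "finite (dyadic_levels m)"
  by (simp add: dyadic_levels_def)

lemma dyadic_levels_nonneg: "r \<in> dyadic_levels m \<Longrightarrow> 0 \<le> r"
  by (auto simp: dyadic_levels_def)

lemma dyadic_above_measurable [measurable]: "dyadic_above m \<in> borel_measurable borel"
  unfolding dyadic_above_def by measurable

lemma dyadic_above_in_levels:
  assumes "0 \<le> s" shows "dyadic_above m s \<in> dyadic_levels m"
proof (cases "s < ereal (real m)")
  case True
  then obtain x where x: "s = ereal x" "0 \<le> x" "x < real m" using assms by (cases s) auto
  define k where "k = nat (\<lfloor>2 ^ m * x\<rfloor> + 1)"
  have "0 \<le> \<lfloor>2 ^ m * x\<rfloor>" using x by simp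
  then have k: "real k = of_int \<lfloor>2 ^ m * x\<rfloor> + 1" by (simp add: k_def)
  \<comment> \<open>Since \<open>2 ^ m * m\<close> is an integer strictly above
    \<open>2 ^ m * x\<close>, it still bounds the floor plus 1.\<close>
  have "2 ^ m * x < 2 ^ m * real m" using x by simp
  then have "real k < 2 ^ m * real m + 1" using k of_int_floor_le[of "2 ^ m * x"] by linarith
  then have "real k < real (2 ^ m * m + 1)" by simp
  then have "k < 2 ^ m * m + 1" by (simp only: of_nat_less_iff)
  then have "k \<in> {..2 ^ m * m}" by simp
  moreover have "dyadic_above m s = ereal (real k / 2 ^ m)" using True x k by (simp add: dyadic_above_def)
  ultimately show ?thesis by (auto simp: dyadic_levels_def)
qed (simp add: dyadic_above_def dyadic_levels_def)

lemma dyadic_above_greater: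
  assumes "0 \<le> s" "s \<noteq> \<infinity>" shows "s < dyadic_above m s"
proof (cases "s < ereal (real m)")
  case True
  then obtain x where x: "s = ereal x" using assms by (cases s) auto
  have "2 ^ m * x < of_int \<lfloor>2 ^ m * x\<rfloor> + 1" by linarith
  then have "x < (of_int \<lfloor>2 ^ m * x\<rfloor> + 1) / 2 ^ m" by (simp add: field_simps)
  then show ?thesis using True x by (simp add: dyadic_above_def)
qed (use assms in \<open>auto simp: dyadic_above_def\<close>)

lemma dyadic_above_infinity [simp]: "dyadic_above m \<infinity> = \<infinity>"
  by (simp add: dyadic_above_def)

lemma dyadic_above_ge: "0 \<le> s \<Longrightarrow> s \<le> dyadic_above m s"
  by (cases "s = \<infinity>") (auto intro: less_imp_le dyadic_above_greater)

lemma dyadic_above_tendsto: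
  assumes "0 \<le> s" shows "(\<lambda>m. dyadic_above m s) \<longlonglongrightarrow> s"
proof (cases "s = \<infinity>")
  case False
  then obtain x where x: "s = ereal x" "0 \<le> x" using assms by (cases s) auto
  define y where "y m = (of_int \<lfloor>2 ^ m * x\<rfloor> + 1) / (2 ^ m :: real)" for m :: nat
  have bounds: "x \<le> y m" "y m \<le> x + (1/2) ^ m" for m
  proof -
    have "2 ^ m * x \<le> of_int \<lfloor>2 ^ m * x\<rfloor> + 1" by linarith
    then show "x \<le> y m" by (simp add: y_def field_simps)
    have "of_int \<lfloor>2 ^ m * x\<rfloor> + 1 \<le> 2 ^ m * x + 1" by linarith
    then show "y m \<le> x + (1/2) ^ m" by (simp add: y_def field_simps power_divide)
  qed
  have "(\<lambda>m. x + (1/2) ^ m) \<longlonglongrightarrow> x + 0"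
    by (intro tendsto_intros LIMSEQ_power_zero) auto
  then have "y \<longlonglongrightarrow> x"
    by (intro tendsto_sandwich[of "\<lambda>_. x" y sequentially "\<lambda>m. x + (1/2) ^ m"]) (use bounds in auto)
  then have "(\<lambda>m. ereal (y m)) \<longlonglongrightarrow> s" unfolding x by simp
  moreover have "\<forall>\<^sub>F m in sequentially. ereal (y m) = dyadic_above m s"
  proof -
    obtain m0 :: nat where "x < real m0" using reals_Archimedean2 by blast
    show ?thesis
      using eventually_ge_at_top[of m0]
    proof eventually_elim
      fix m assume "m0 \<le> m"
      then have "x < real m" using \<open>x < real m0\<close> by linarith
      then show "ereal (y m) = dyadic_above m s" by (simp add: dyadic_above_def y_def x)
    qed
  qed
  ultimately show ?thesis by (rule Lim_transform_eventually)
qed simp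

context network_model
begin

text \<open>Approximation from above suits the strict comparison: if \<open>s < l\<close>, the grid
  value eventually falls below \<open>l\<close>; if not, it never does. From below it would wrongly
  count the nearest transmitter, whose loss equals \<open>L\<close>.\<close>

lemma interference_above_dyadic_eventually:
  assumes S: "S \<subseteq> {..Nmax}" and w: "w \<in> space M" and s: "0 \<le> s"
  shows "\<forall>\<^sub>F m in sequentially. interference_above S (dyadic_above m s) w = interference_above S s w"
proof -
  have "\<forall>\<^sub>F m in sequentially. (dyadic_above m s < l) = (s < l)" for l
  proof (cases "s < l")
    case True
    from order_tendstoD(2)[OF dyadic_above_tendsto[OF s] True] True show ?thesis
      by (auto elim: eventually_mono)
  next
    case False
    then have "\<not> dyadic_above m s < l" for m using dyadic_above_ge[OF s, of m] by auto
    then show ?thesis using False by simp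
  qed
  then have "\<forall>\<^sub>F m in sequentially. \<forall>N\<in>S. \<forall>n\<in>\<Psi> N w. (dyadic_above m s < loss N n w) = (s < loss N n w)"
    using finite_labels[OF _ w] S finite_subset[OF S] by (intro eventually_ball_finite ballI) auto
  then show ?thesis
    unfolding interference_above_def by eventually_elim (intro sum.cong, auto)
qed

lemma abs_expectation_le:
  fixes f :: "'w \<Rightarrow> real"
  assumes [measurable]: "f \<in> borel_measurable M" and bound: "\<And>w. \<bar>f w\<bar> \<le> B"
  shows "\<bar>expectation f\<bar> \<le> B"
proof -
  have "integrable M f" by (rule integrable_const_bound[where B=B]) (use bound in auto)
  then have "expectation (\<lambda>w. \<bar>f w\<bar>) \<le> expectation (\<lambda>w. B)"
    using bound by (intro integral_mono) auto
  also have "\<dots> = B" by (simp add: prob_space)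
  finally show ?thesis by (rule order_trans[OF integral_abs_bound])
qed

lemma independent_level_expectation:
  fixes g :: "real \<Rightarrow> real"
  assumes S: "S \<subseteq> {..Nmax}" and g [measurable]: "g \<in> borel_measurable borel" and g_bound: "\<And>x. \<bar>g x\<bar> \<le> B"
    and r: "0 \<le> r" and A [measurable]: "A \<in> sets borel"
  shows "expectation (\<lambda>w. indicator A (min (L w) r) * g (interference_above S r w)) =
    expectation (\<lambda>w. indicator A (min (L w) r)) * expectation (\<lambda>w. g (interference_above S r w))"
proof -
  have [measurable]: "interference_above S r \<in> borel_measurable M"
    by (rule interference_above_measurable[OF S]) simp
  have "expectation (\<lambda>w. indicator A (min (L w) r) * g (interference_above S r w)) =
      expectation (\<lambda>v. expectation (\<lambda>w. indicator A (min (L w) r) * g (interference_above S r v)))"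
  proof (rule indep_expectation[OF indep_min_path_loss_interference[OF S r], where f="\<lambda>x y. indicator A x * g y" and B=B])
    show "norm (indicator A x * g y) \<le> B" for x y
      using g_bound[of y] order_trans[OF abs_ge_zero g_bound[of y]] by (auto simp: indicator_def)
  qed measurable
  then show ?thesis by simp
qed

text \<open>On each grid level independence replaces the interference by its mean \<open>Q\<close>;
  both sides then converge as the grid is refined. Measurability of \<open>Q\<close> is proved along
  the way, as a limit of functions with finitely many values.\<close>

lemma conditional_interference_expectation:
  fixes g :: "real \<Rightarrow> real"
  assumes S: "S \<subseteq> {..Nmax}" and g [measurable]: "g \<in> borel_measurable borel" and g_bound: "\<And>x. \<bar>g x\<bar> \<le> B"
  defines "Q s \<equiv> expectation (\<lambda>w. g (interference_above S s w))"
  shows "(\<lambda>s. if 0 \<le> s then Q s else 0) \<in> borel_measurable borel"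
    and "A \<in> sets borel \<Longrightarrow> expectation (\<lambda>w. indicator A (L w) * g (interference_above S (L w) w)) =
      expectation (\<lambda>w. indicator A (L w) * Q (L w))"
proof -
  define Qm where "Qm m s = (\<Sum>r\<in>dyadic_levels m. of_bool (dyadic_above m s = r) * Q r)" for m s
  have I_meas [measurable]: "(\<lambda>w. interference_above S (T w) w) \<in> borel_measurable M" if "T \<in> borel_measurable M" for T
    by (rule interference_above_measurable[OF S that])
  have B_nonneg: "0 \<le> B" by (rule order_trans[OF abs_ge_zero g_bound])
  have Qm_eq: "Qm m s = Q (dyadic_above m s)" if "0 \<le> s" for m s
  proof -
    have "Qm m s = (\<Sum>r\<in>dyadic_levels m. if dyadic_above m s = r then Q r else 0)"
      unfolding Qm_def by (intro sum.cong) auto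
    then show ?thesis
      using dyadic_above_in_levels[OF that] finite_dyadic_levels by (simp add: sum.delta')
  qed
  have Qm_meas [measurable]: "Qm m \<in> borel_measurable borel" for m
    unfolding Qm_def by measurable
  have Q_bound: "\<bar>Q s\<bar> \<le> B" for s
    unfolding Q_def by (rule abs_expectation_le) (use g_bound in auto)
  have Q_lim: "(\<lambda>m. Qm m s) \<longlonglongrightarrow> Q s" if s: "0 \<le> s" for s
    unfolding Qm_eq[OF s] unfolding Q_def
  proof (rule integral_dominated_convergence[where w="\<lambda>_. B"])
    show "AE w in M. (\<lambda>m. g (interference_above S (dyadic_above m s) w)) \<longlonglongrightarrow> g (interference_above S s w)"
    proof (rule AE_I2)
      fix w assume "w \<in> space M"
      from interference_above_dyadic_eventually[OF S this s]
      show "(\<lambda>m. g (interference_above S (dyadic_above m s) w)) \<longlonglongrightarrow> g (interference_above S s w)"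
        by (intro tendsto_eventually) (auto elim: eventually_mono)
    qed
  qed (use g_bound in auto)
  show "(\<lambda>s. if 0 \<le> s then Q s else 0) \<in> borel_measurable borel"
  proof (rule borel_measurable_LIMSEQ_metric)
    show "(\<lambda>s. if 0 \<le> s then Qm m s else 0) \<in> borel_measurable borel" for m by measurable
    show "(\<lambda>m. if 0 \<le> s then Qm m s else 0) \<longlonglongrightarrow> (if 0 \<le> s then Q s else 0)" for s
      using Q_lim by simp
  qed
  assume A [measurable]: "A \<in> sets borel"
  have level: "expectation (\<lambda>w. indicator A (L w) * g (interference_above S (dyadic_above m (L w)) w)) =
      expectation (\<lambda>w. indicator A (L w) * Qm m (L w))" for m
  proof -
    \<comment> \<open>On \<open>C r\<close> the grid value is \<open>r\<close>. Evaluated at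
      \<open>min (L w) r\<close> it gives an event independent of the interference above
      \<open>r\<close>.\<close>
    define C where "C r = A \<inter> dyadic_above m -` {r}" for r
    have C_meas [measurable]: "C r \<in> sets borel" for r
      unfolding C_def using measurable_sets[OF dyadic_above_measurable, of "{r}" m] by auto
    \<comment> \<open>If \<open>L w \<ge> r\<close> with \<open>r\<close> finite, the grid values of
      \<open>L w\<close> and of \<open>r\<close> both exceed \<open>r\<close>, so both sides are 0.
      If \<open>r = \<infinity>\<close>, then \<open>min\<close> changes nothing.\<close>
    have C_min: "indicator (C r) (min (L w) r) = (indicator A (L w) * of_bool (dyadic_above m (L w) = r) :: real)"
      if r: "0 \<le> r" for r w
    proof (cases "L w < r")
      case True
      then show ?thesis by (auto simp: C_def indicator_def min_def)
    next
      case False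
      then have min_r: "min (L w) r = r" by (auto simp: min_def)
      show ?thesis
      proof (cases "r = \<infinity>")
        case True
        then show ?thesis using False by (auto simp: C_def indicator_def)
      next
        case r_fin: False
        have "r < dyadic_above m (L w)"
          using False r_fin dyadic_above_greater[OF L_nonneg, of w m] by (cases "L w = \<infinity>") (auto simp: not_less)
        moreover have "dyadic_above m r \<noteq> r" using dyadic_above_greater[OF r r_fin, of m] by auto
        ultimately show ?thesis unfolding min_r by (auto simp: C_def indicator_def not_le)
      qed
    qed
    have int: "integrable M (\<lambda>w. indicator (C r) (min (L w) r) * g (interference_above S r w))"
        "integrable M (\<lambda>w. indicator (C r) (min (L w) r) :: real)" for r
      by (rule integrable_const_bound[where B=B]; use g_bound in \<open>auto simp: indicator_def intro: order_trans[OF abs_ge_zero]\<close>)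
         (rule integrable_const_bound[where B=1]; auto simp: indicator_def)
    have "expectation (\<lambda>w. indicator A (L w) * g (interference_above S (dyadic_above m (L w)) w)) =
        expectation (\<lambda>w. \<Sum>r\<in>dyadic_levels m. indicator (C r) (min (L w) r) * g (interference_above S r w))"
    proof (rule Bochner_Integration.integral_cong[OF refl])
      fix w
      have "(\<Sum>r\<in>dyadic_levels m. indicator (C r) (min (L w) r) * g (interference_above S r w)) =
          (\<Sum>r\<in>dyadic_levels m. if dyadic_above m (L w) = r then indicator A (L w) * g (interference_above S r w) else 0)"
        by (intro sum.cong) (auto simp: C_min dyadic_levels_nonneg)
      also have "\<dots> = indicator A (L w) * g (interference_above S (dyadic_above m (L w)) w)"
        using dyadic_above_in_levels[OF L_nonneg] finite_dyadic_levels by (simp add: sum.delta')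
      finally show "indicator A (L w) * g (interference_above S (dyadic_above m (L w)) w) =
        (\<Sum>r\<in>dyadic_levels m. indicator (C r) (min (L w) r) * g (interference_above S r w))" ..
    qed
    also have "\<dots> = (\<Sum>r\<in>dyadic_levels m. expectation (\<lambda>w. indicator (C r) (min (L w) r) * g (interference_above S r w)))"
      by (rule Bochner_Integration.integral_sum) (rule int)
    also have "\<dots> = (\<Sum>r\<in>dyadic_levels m. expectation (\<lambda>w. indicator (C r) (min (L w) r) * Q r))"
      using independent_level_expectation[OF S g g_bound dyadic_levels_nonneg C_meas]
      by (intro sum.cong refl) (simp add: Q_def)
    also have "\<dots> = expectation (\<lambda>w. \<Sum>r\<in>dyadic_levels m. indicator (C r) (min (L w) r) * Q r)"
      by (rule Bochner_Integration.integral_sum[symmetric]) (intro integrable_mult_left int)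
    also have "\<dots> = expectation (\<lambda>w. indicator A (L w) * Qm m (L w))"
      unfolding Qm_def sum_distrib_left
      by (intro Bochner_Integration.integral_cong sum.cong refl) (simp add: C_min dyadic_levels_nonneg mult.assoc)
    finally show ?thesis .
  qed
  have "(\<lambda>m. expectation (\<lambda>w. indicator A (L w) * g (interference_above S (dyadic_above m (L w)) w))) \<longlonglongrightarrow>
      expectation (\<lambda>w. indicator A (L w) * g (interference_above S (L w) w))"
  proof (rule integral_dominated_convergence[where w="\<lambda>_. \<bar>B\<bar>"])
    show "AE w in M. (\<lambda>m. indicator A (L w) * g (interference_above S (dyadic_above m (L w)) w)) \<longlonglongrightarrow>
        indicator A (L w) * g (interference_above S (L w) w)"
    proof (rule AE_I2)
      fix w assume "w \<in> space M"
      from interference_above_dyadic_eventually[OF S this L_nonneg[of w]]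
      have "\<forall>\<^sub>F m in sequentially. indicator A (L w) * g (interference_above S (dyadic_above m (L w)) w) =
          indicator A (L w) * g (interference_above S (L w) w)"
        by eventually_elim simp
      then show "(\<lambda>m. indicator A (L w) * g (interference_above S (dyadic_above m (L w)) w)) \<longlonglongrightarrow>
        indicator A (L w) * g (interference_above S (L w) w)"
        by (rule tendsto_eventually)
    qed
    show "AE w in M. norm (indicator A (L w) * g (interference_above S (dyadic_above m (L w)) w)) \<le> \<bar>B\<bar>" for m
      using g_bound by (intro AE_I2) (auto simp: indicator_def intro: order_trans[OF _ abs_ge_self])
  qed auto
  moreover have "(\<lambda>m. expectation (\<lambda>w. indicator A (L w) * Qm m (L w))) \<longlonglongrightarrow>
      expectation (\<lambda>w. indicator A (L w) * (if 0 \<le> L w then Q (L w) else 0))"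
  proof (rule integral_dominated_convergence[where w="\<lambda>_. \<bar>B\<bar>"])
    have [measurable]: "(\<lambda>s. if 0 \<le> s then Q s else 0) \<in> borel_measurable borel" by fact
    show "(\<lambda>w. indicator A (L w) * (if 0 \<le> L w then Q (L w) else 0)) \<in> borel_measurable M"
      by (intro borel_measurable_times measurable_compose[OF L_measurable]) auto
    show "AE w in M. (\<lambda>m. indicator A (L w) * Qm m (L w)) \<longlonglongrightarrow> indicator A (L w) * (if 0 \<le> L w then Q (L w) else 0)"
      using Q_lim L_nonneg by (intro AE_I2 tendsto_mult tendsto_const) auto
    show "AE w in M. norm (indicator A (L w) * Qm m (L w)) \<le> \<bar>B\<bar>" for m
      using Q_bound L_nonneg by (intro AE_I2) (auto simp: Qm_eq indicator_def intro: order_trans[OF _ abs_ge_self])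
  qed auto
  ultimately show "expectation (\<lambda>w. indicator A (L w) * g (interference_above S (L w) w)) =
      expectation (\<lambda>w. indicator A (L w) * Q (L w))"
    unfolding level using L_nonneg LIMSEQ_unique by auto
qed

end

context network_model
begin

section \<open>Conditional expectations given the minimum path loss\<close>

lemma sigma_gen_subalgebra: "subalgebra M (sigma_gen M L)"
  unfolding subalgebra_def sigma_gen_def
  using measurable_sets[OF L_measurable] by (auto simp: sets_vimage_algebra2)

lemma real_cond_exp_interference:
  fixes g :: "real \<Rightarrow> real"
  assumes S: "S \<subseteq> {..Nmax}" and g [measurable]: "g \<in> borel_measurable borel" and g_bound: "\<And>x. \<bar>g x\<bar> \<le> B"
    and f: "\<And>w. w \<in> space M \<Longrightarrow> f w = g (interference_above S (L w) w)"
  shows "AE w in M. real_cond_exp M (sigma_gen M L) f w = expectation (\<lambda>v. g (interference_above S (L w) v))"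
proof -
  interpret finite_measure_subalgebra M "sigma_gen M L"
    by unfold_locales (rule sigma_gen_subalgebra)
  define Q where "Q s = expectation (\<lambda>v. g (interference_above S s v))" for s
  have Q_meas [measurable]: "(\<lambda>s. if 0 \<le> s then Q s else 0) \<in> borel_measurable borel"
    unfolding Q_def by (rule conditional_interference_expectation(1)[OF S g g_bound])
  have B_nonneg: "0 \<le> B" by (rule order_trans[OF abs_ge_zero g_bound])
  have I_meas [measurable]: "(\<lambda>w. interference_above S (T w) w) \<in> borel_measurable M" if "T \<in> borel_measurable M" for T
    by (rule interference_above_measurable[OF S that])
  have f_meas: "f \<in> borel_measurable M"
    by (subst measurable_cong[OF f]) auto
  have Q_bound: "\<bar>Q s\<bar> \<le> B" for s
    unfolding Q_def by (rule abs_expectation_le) (use g_bound in auto)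
  \<comment> \<open>Measurability is available for \<open>Q\<close> cut off on negative arguments;
    as \<open>L\<close> is nonnegative, the cutoff does not alter the values.\<close>
  define q where "q w = (if 0 \<le> L w then Q (L w) else 0)" for w
  have L_gen: "L \<in> measurable (sigma_gen M L) borel"
    unfolding sigma_gen_def by (rule measurable_vimage_algebra1) simp
  have q_gen: "q \<in> borel_measurable (sigma_gen M L)"
    unfolding q_def by (rule measurable_compose[OF L_gen Q_meas])
  have q_meas: "q \<in> borel_measurable M"
    unfolding q_def by (rule measurable_compose[OF L_measurable Q_meas])
  have "AE w in M. real_cond_exp M (sigma_gen M L) f w = q w"
  proof (rule real_cond_exp_charact[OF _ _ _ q_gen])
    show "integrable M f"
      by (rule integrable_const_bound[where B=B]) (use f_meas f g_bound in auto)
    show "integrable M q"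
      by (rule integrable_const_bound[where B=B]) (use q_meas Q_bound B_nonneg in \<open>auto simp: q_def\<close>)
    fix A assume "A \<in> sets (sigma_gen M L)"
    then obtain C where C: "C \<in> sets borel" "A = L -` C \<inter> space M"
      by (auto simp: sigma_gen_def sets_vimage_algebra2)
    have "(\<integral>w\<in>A. f w \<partial>M) = expectation (\<lambda>w. indicator C (L w) * g (interference_above S (L w) w))"
      unfolding set_lebesgue_integral_def
      by (intro Bochner_Integration.integral_cong refl) (auto simp: C f indicator_def)
    also have "\<dots> = expectation (\<lambda>w. indicator C (L w) * Q (L w))"
      unfolding Q_def by (rule conditional_interference_expectation(2)[OF S g g_bound C(1)])
    also have "\<dots> = (\<integral>w\<in>A. q w \<partial>M)"
      unfolding set_lebesgue_integral_def q_def
      by (intro Bochner_Integration.integral_cong refl) (auto simp: C indicator_def L_nonneg)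
    finally show "(\<integral>w\<in>A. f w \<partial>M) = (\<integral>w\<in>A. q w \<partial>M)" .
  qed
  then show ?thesis
    by eventually_elim (simp add: q_def L_nonneg Q_def)
qed

text \<open>A loss of 0 occurs only at the origin, which the intensities do not charge. Positivity
  is required both by the formula for \<open>Phi\<close> and by the Lipschitz bound.\<close>

lemma AE_L_positive: "AE w in M. 0 < L w"
proof -
  have zero: "(\<integral>x. 1 - (if 0 < path_loss \<kappa> \<beta> K N (norm x) then 1 else 0 :: complex) \<partial>\<Lambda> N) = 0" for N
  proof -
    define k where "k r = 1 - (if 0 < path_loss \<kappa> \<beta> K N r then 1 else 0 :: complex)" for r
    have [measurable]: "k \<in> borel_measurable borel" unfolding k_def by measurable
    have k0: "k r = 0" if "0 < r" for r
    proof -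
      have "0 < \<kappa> * r powr \<beta>" using params that by simp
      then have "0 < path_loss \<kappa> \<beta> K N r"
        using params by (cases "K ^ N = 0") (auto simp: path_loss_def divide_ereal_def zero_ereal_def[symmetric])
      then show ?thesis by (simp add: k_def)
    qed
    \<comment> \<open>For \<open>r > 0\<close> the factor \<open>k r\<close> vanishes, at
      \<open>r = 0\<close> the power of \<open>r\<close> does.\<close>
    have integrand: "indicator {0..RD} r *\<^sub>R (of_real (r ^ (N + i + 1)) * k r) = 0" for r i
      using k0[of r] by (cases "0 < r") (auto simp: indicator_def)
    have k_norm: "norm (k r) \<le> 1" for r by (simp add: k_def)
    have "(\<lambda>i. 0) sums (\<integral>x. k (norm x) \<partial>\<Lambda> N)"
      using intensity_radial_integral_sums(2)[of k lamPH lamw RD N, OF _ k_norm, unfolded integrand] params by simp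
    then have "(\<integral>x. k (norm x) \<partial>\<Lambda> N) = 0"
      using sums_zero sums_unique2 by blast
    then show ?thesis by (simp add: k_def)
  qed
  have "complex_of_real (prob {w \<in> space M. 0 < L w}) =
      expectation (\<lambda>w. indicator {w \<in> space M. 0 < L w} w *\<^sub>R iexp (0 * interference_above {} 0 w))"
    by (simp add: scaleR_conv_of_real emeasure_eq_measure integral_complex_of_real)
  also have "\<dots> = exp (- (\<Sum>N\<le>Nmax. 0))"
    by (subst indicator_char_eq_exp) (simp_all add: zero cong: if_cong)
  finally have "prob {w \<in> space M. 0 < L w} = 1" by simp
  then show ?thesis by (subst (asm) prob_Collect_eq_1) auto
qed

text \<open>For a frozen configuration the truncated interference is a linear combination of
  independent exponential gains. These have no atoms, and averaging over configurations and removing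
  the truncation preserves the value 0.\<close>

lemma interference_no_atom:
  assumes S: "S \<subseteq> {..Nmax}" and z: "z \<noteq> 0"
  shows "prob {w \<in> space M. interference_above S t w = z} = 0"
proof -
  define coef where "coef c n = (\<Sum>N\<in>S. if fst c N n then attenuation \<kappa> \<beta> K N (norm (snd c n)) *
      of_bool (t < path_loss \<kappa> \<beta> K N (norm (snd c n))) else 0)"
    for c :: "(nat \<Rightarrow> nat \<Rightarrow> bool) \<times> (nat \<Rightarrow> real \<times> real)" and n
  define F where "F m \<eta> c = (of_bool ((\<Sum>n<m. \<eta> n * coef c n) = z) :: real)" for m and \<eta> :: "nat \<Rightarrow> real" and c
  have coef_config: "coef (config w) n = (\<Sum>N\<in>S. if n \<in> \<Psi> N w then att N n w * of_bool (t < loss N n w) else 0)" for w n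
    unfolding coef_def config_def using S by (intro sum.cong refl) auto
  have F_meas: "(\<lambda>(\<eta>, c). F m \<eta> c) \<in> borel_measurable joint_algebra" for m
  proof -
    have "(\<lambda>p. coef (snd p) n) \<in> borel_measurable joint_algebra" for n
      unfolding coef_def
    proof (intro borel_measurable_sum measurable_If)
      fix N assume N: "N \<in> S"
      show "(\<lambda>p. attenuation \<kappa> \<beta> K N (norm (snd (snd p) n)) * of_bool (t < path_loss \<kappa> \<beta> K N (norm (snd (snd p) n))))
          \<in> borel_measurable joint_algebra"
        by (rule measurable_compose[OF pos_component_measurable[of n],
              of "\<lambda>x. attenuation \<kappa> \<beta> K N (norm x) * of_bool (t < path_loss \<kappa> \<beta> K N (norm x))"]) measurable
      show "{p \<in> space joint_algebra. fst (snd p) N n}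
          \<in> sets joint_algebra"
        using label_component_measurable[of N n] N S by (auto simp: pred_def)
    qed simp
    then have "(\<lambda>p. \<Sum>n<m. fst p n * coef (snd p) n) \<in> borel_measurable joint_algebra"
      by (intro borel_measurable_sum borel_measurable_times gain_component_measurable)
    then show ?thesis
      unfolding F_def case_prod_unfold by measurable
  qed
  have F_norm: "norm (F m \<eta> c) \<le> 1" for m \<eta> c by (simp add: F_def)
  have "expectation (\<lambda>w. F m (\<lambda>n. h n w) (config w)) = 0" for m
  proof -
    have "expectation (\<lambda>w. F m (\<lambda>n. h n w) c) = 0" for c
    proof -
      have "expectation (\<lambda>w. F m (\<lambda>n. h n w) c) = prob {w \<in> space M. (\<Sum>n<m. h n w * coef c n) = z}"
        unfolding F_def by (rule expectation_of_bool)
      also have "\<dots> = 0"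
        by (rule indep_linear_combination_no_atom[OF gains_indep distributed_lborel_no_atom[OF gains_exponential] z])
      finally show ?thesis .
    qed
    then show ?thesis unfolding config_expectation[OF F_meas F_norm] by simp
  qed
  moreover have "(\<lambda>m. expectation (\<lambda>w. F m (\<lambda>n. h n w) (config w))) \<longlonglongrightarrow>
      expectation (\<lambda>w. of_bool (interference_above S t w = z))"
  proof (rule integral_dominated_convergence[where w="\<lambda>_. 1"])
    have [measurable]: "interference_above S t \<in> borel_measurable M"
      by (rule interference_above_measurable[OF S]) simp
    show "(\<lambda>w. of_bool (interference_above S t w = z) :: real) \<in> borel_measurable M" by measurable
    show "(\<lambda>w. F m (\<lambda>n. h n w) (config w)) \<in> borel_measurable M" for m
      using measurable_compose[OF measurable_Pair[OF gains_measurable config_measurable] F_meas] by simp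
    show "AE w in M. (\<lambda>m. F m (\<lambda>n. h n w) (config w)) \<longlonglongrightarrow> of_bool (interference_above S t w = z)"
    proof (rule AE_I2)
      fix w assume "w \<in> space M"
      from truncated_interference_eventually[OF S this, of t]
      have "\<forall>\<^sub>F m in sequentially. F m (\<lambda>n. h n w) (config w) = of_bool (interference_above S t w = z)"
        by eventually_elim (simp add: F_def coef_config)
      then show "(\<lambda>m. F m (\<lambda>n. h n w) (config w)) \<longlonglongrightarrow> of_bool (interference_above S t w = z)"
        by (rule tendsto_eventually)
    qed
  qed (use F_norm in auto)
  ultimately have "expectation (\<lambda>w. of_bool (interference_above S t w = z)) = (0 :: real)"
    by (simp add: LIMSEQ_const_iff)
  then show ?thesis by (simp add: expectation_of_bool)
qed

text \<open>Above \<open>t\<close> the attenuation is at most \<open>1 / t\<close>, so each factor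
  differs from 1 by at most the modulus of \<open>\<omega>\<close> divided by \<open>t\<close>.
  Integrating against the finite intensities gives the constant; the real part of the exponent has
  the right sign because the factors lie in the unit disc.\<close>

lemma interference_char_lipschitz:
  assumes S: "S \<subseteq> {..Nmax}" and t: "0 < t"
  obtains C where "\<And>\<omega>. norm (interference_char S (ereal t) \<omega> - 1) \<le> C * \<bar>\<omega>\<bar>"
proof
  fix \<omega> :: real
  let ?g = "\<lambda>N. gain_factor \<kappa> \<beta> K N \<omega> (ereal t)"
  let ?u = "\<Sum>N\<in>S. \<integral>x. 1 - ?g N x \<partial>\<Lambda> N"
  have g_le: "norm (1 - ?g N x) \<le> \<bar>\<omega>\<bar> / t" for N x
  proof (cases "ereal t < path_loss \<kappa> \<beta> K N (norm x)")
    case True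
    have "0 \<le> attenuation \<kappa> \<beta> K N (norm x) \<and> attenuation \<kappa> \<beta> K N (norm x) \<le> 1 / t"
      using True t by (cases "path_loss \<kappa> \<beta> K N (norm x)") (auto simp: attenuation_def frac_le inverse_eq_divide)
    then have "\<bar>\<omega> * attenuation \<kappa> \<beta> K N (norm x)\<bar> \<le> \<bar>\<omega>\<bar> * (1 / t)"
      unfolding abs_mult by (intro mult_left_mono) auto
    moreover have "norm (1 - ?g N x) \<le> \<bar>\<omega> * attenuation \<kappa> \<beta> K N (norm x)\<bar>"
      unfolding norm_minus_commute[of 1] using norm_inverse_one_minus_imaginary(3) True
      by (simp add: gain_factor_def del: of_real_mult)
    ultimately show ?thesis by simp
  qed (use t in \<open>simp add: gain_factor_def\<close>)
  have int: "integrable (\<Lambda> N) (\<lambda>x. 1 - ?g N x)"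
    and norm_le: "norm (\<integral>x. 1 - ?g N x \<partial>\<Lambda> N) \<le> measure (\<Lambda> N) UNIV / t * \<bar>\<omega>\<bar>"
    and Re_ge: "0 \<le> Re (\<integral>x. 1 - ?g N x \<partial>\<Lambda> N)" if "N \<in> S" for N
  proof -
    interpret finite_measure "\<Lambda> N" using that S by (intro finite_intensity) auto
    have space: "space (\<Lambda> N) = UNIV" by (simp add: intensity_def)
    show int: "integrable (\<Lambda> N) (\<lambda>x. 1 - ?g N x)"
      by (rule integrable_const_bound[where B="\<bar>\<omega>\<bar> / t"])
         (use g_le gain_factor_measurable in \<open>auto cong: measurable_cong_sets\<close>)
    have "norm (\<integral>x. 1 - ?g N x \<partial>\<Lambda> N) \<le> (\<integral>x. norm (1 - ?g N x) \<partial>\<Lambda> N)"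
      by (rule integral_norm_bound)
    also have "\<dots> \<le> (\<integral>x. \<bar>\<omega>\<bar> / t \<partial>\<Lambda> N)"
      by (intro integral_mono integrable_norm int integrable_const g_le)
    finally show "norm (\<integral>x. 1 - ?g N x \<partial>\<Lambda> N) \<le> measure (\<Lambda> N) UNIV / t * \<bar>\<omega>\<bar>"
      by (simp add: space mult.commute)
    have "0 \<le> (\<integral>x. Re (1 - ?g N x) \<partial>\<Lambda> N)"
    proof (rule Bochner_Integration.integral_nonneg)
      fix x
      show "0 \<le> Re (1 - ?g N x)"
        using complex_Re_le_cmod[of "?g N x"] norm_gain_factor_le[of \<kappa> \<beta> K N \<omega> "ereal t" x] by simp
    qed
    then show "0 \<le> Re (\<integral>x. 1 - ?g N x \<partial>\<Lambda> N)"
      using integral_Re[OF int] by simp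
  qed
  have "norm (interference_char S (ereal t) \<omega> - 1) \<le> norm ?u"
    unfolding interference_char_def by (rule norm_exp_minus_one_le) (use Re_ge in \<open>simp add: sum_nonneg\<close>)
  also have "\<dots> \<le> (\<Sum>N\<in>S. measure (\<Lambda> N) UNIV / t * \<bar>\<omega>\<bar>)"
    by (rule sum_norm_le) (rule norm_le)
  finally show "norm (interference_char S (ereal t) \<omega> - 1) \<le> (\<Sum>N\<in>S. measure (\<Lambda> N) UNIV / t) * \<bar>\<omega>\<bar>"
    by (simp add: sum_distrib_right)
qed

lemma prod_Phi_eq:
  assumes "0 < t" "S \<subseteq> {..Nmax}"
  shows "(\<Prod>N\<in>S. Phi lamPH lamw \<kappa> \<beta> K RD N \<omega> t) = interference_char S (ereal t) \<omega>"
proof -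
  have "(\<Prod>N\<in>S. Phi lamPH lamw \<kappa> \<beta> K RD N \<omega> t) =
      (\<Prod>N\<in>S. exp (- (\<integral>x. 1 - gain_factor \<kappa> \<beta> K N \<omega> (ereal t) x \<partial>\<Lambda> N)))"
    using params assms by (intro prod.cong refl Phi_eq_exp_integral) auto
  also have "\<dots> = interference_char S (ereal t) \<omega>"
    unfolding interference_char_def using finite_subset[OF assms(2)]
    by (simp add: exp_sum[symmetric] sum_negf)
  finally show ?thesis .
qed

text \<open>Given \<open>L w = L0\<close>, the conditional distribution function is that of the
  interference above the deterministic threshold \<open>L0\<close>, and to this variable the
  inversion formula is applied.\<close>

lemma conditional_cdf:
  assumes z: "z \<noteq> 0"
  shows "AE w in M. \<forall>L0. L w = ereal L0 \<longrightarrow>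
    ((\<lambda>\<omega>. 1 / (pi * \<omega>) * Im (exp (- \<i> * of_real \<omega> * of_real z) * (\<Prod>N\<le>Nmax. Phi lamPH lamw \<kappa> \<beta> K RD N \<omega> L0)))
      has_integral (1 / 2 - cond_cdf M (interference \<kappa> \<beta> K Nmax \<Psi> pos h) L z w)) {0<..}"
    (is "AE w in M. \<forall>L0. _ \<longrightarrow> ?P w L0")
proof -
  have "AE w in M. cond_cdf M (interference \<kappa> \<beta> K Nmax \<Psi> pos h) L z w =
      expectation (\<lambda>v. of_bool (interference_above {..Nmax} (L w) v \<le> z))"
    unfolding cond_cdf_def
    by (rule real_cond_exp_interference[where B=1]) (auto simp: interference_eq indicator_def)
  with AE_L_positive show ?thesis
  proof eventually_elim
    case (elim w)
    show ?case
    proof (intro allI impI)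
      fix L0 assume L0: "L w = ereal L0"
      with elim(1) have pos: "0 < L0" by simp
      let ?X = "interference_above {..Nmax} (ereal L0)"
      have X [measurable]: "?X \<in> borel_measurable M"
        by (rule interference_above_measurable) auto
      obtain C where C: "\<And>\<omega>. norm (interference_char {..Nmax} (ereal L0) \<omega> - 1) \<le> C * \<bar>\<omega>\<bar>"
        using interference_char_lipschitz[OF order_refl pos] by blast
      have char: "expectation (\<lambda>v. iexp (\<omega> * ?X v)) = (\<Prod>N\<le>Nmax. Phi lamPH lamw \<kappa> \<beta> K RD N \<omega> L0)" for \<omega>
        using interference_char_eq[OF order_refl, of "ereal L0" \<omega>] prod_Phi_eq[OF pos order_refl, of \<omega>] pos by simp
      have lip: "norm (expectation (\<lambda>v. iexp (\<omega> * ?X v)) - 1) \<le> C * \<bar>\<omega>\<bar>" for \<omega>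
        using C[of \<omega>] interference_char_eq[OF order_refl, of "ereal L0" \<omega>] pos by simp
      have cdf': "cond_cdf M (interference \<kappa> \<beta> K Nmax \<Psi> pos h) L z w = prob {v \<in> space M. ?X v \<le> z}"
        using elim(2) L0 by (simp add: expectation_of_bool)
      show "?P w L0"
        unfolding cdf' char[symmetric]
        by (rule gil_pelaez[OF X lip interference_no_atom[OF order_refl z]])
    qed
  qed
qed

lemma conditional_char:
  assumes N: "N \<le> Nmax"
  shows "AE w in M. \<forall>L0. L w = ereal L0 \<longrightarrow>
    cond_char M (interference_from \<kappa> \<beta> K Nmax \<Psi> pos h N) L \<omega> w = Phi lamPH lamw \<kappa> \<beta> K RD N \<omega> L0"
proof -
  have S: "{N} \<subseteq> {..Nmax}" using N by simp
  have "AE w in M. real_cond_exp M (sigma_gen M L) (\<lambda>w. Re (iexp (\<omega> * interference_from \<kappa> \<beta> K Nmax \<Psi> pos h N w))) w =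
      expectation (\<lambda>v. cos (\<omega> * interference_above {N} (L w) v))"
    by (rule real_cond_exp_interference[OF S, where B=1]) (auto simp: interference_from_eq Re_exp)
  moreover have "AE w in M. real_cond_exp M (sigma_gen M L) (\<lambda>w. Im (iexp (\<omega> * interference_from \<kappa> \<beta> K Nmax \<Psi> pos h N w))) w =
      expectation (\<lambda>v. sin (\<omega> * interference_above {N} (L w) v))"
    by (rule real_cond_exp_interference[OF S, where B=1]) (auto simp: interference_from_eq Im_exp)
  ultimately show ?thesis
    using AE_L_positive
  proof eventually_elim
    case (elim w)
    show ?case
    proof (intro allI impI)
      fix L0 assume L0: "L w = ereal L0"
      with elim(3) have pos: "0 < L0" by simp
      have X [measurable]: "interference_above {N} (ereal L0) \<in> borel_measurable M"
        by (rule interference_above_measurable[OF S]) simp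
      have int: "integrable M (\<lambda>v. iexp (\<omega> * interference_above {N} (ereal L0) v))"
        by (rule integrable_const_bound[where B=1]) auto
      have "cond_char M (interference_from \<kappa> \<beta> K Nmax \<Psi> pos h N) L \<omega> w =
          expectation (\<lambda>v. iexp (\<omega> * interference_above {N} (ereal L0) v))"
        unfolding cond_char_def elim(1,2) L0
        using integral_Re[OF int] integral_Im[OF int] by (simp add: complex_eq_iff Re_exp Im_exp)
      also have "\<dots> = Phi lamPH lamw \<kappa> \<beta> K RD N \<omega> L0"
        using interference_char_eq[OF S, of "ereal L0" \<omega>] prod_Phi_eq[OF pos S, of \<omega>] pos by simp
      finally show "cond_char M (interference_from \<kappa> \<beta> K Nmax \<Psi> pos h N) L \<omega> w = Phi lamPH lamw \<kappa> \<beta> K RD N \<omega> L0" .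
    qed
  qed
qed

end

theorem proposition2:
  fixes M :: "'w measure"
    and lamPH lamw \<beta> \<kappa> K RD :: real
    and Nmax :: nat
    and \<Psi> :: "nat \<Rightarrow> 'w \<Rightarrow> nat set"
    and pos :: "nat \<Rightarrow> 'w \<Rightarrow> real \<times> real"
    and h :: "nat \<Rightarrow> 'w \<Rightarrow> real"
  defines "L \<equiv> min_path_loss \<kappa> \<beta> K Nmax \<Psi> pos"
  assumes "prob_space M"
    and "lamPH > 0" "lamw > 0" "\<beta> > 0" "\<kappa> > 0" "0 \<le> K" "K < 1" "RD > 0"
    and poisson: "\<And>N. N \<le> Nmax \<Longrightarrow> poisson_process M (intensity lamPH lamw RD N) (\<Psi> N) pos"
    and decomposition: "\<And>w. w \<in> space M \<Longrightarrow> disjoint_family_on (\<lambda>N. \<Psi> N w) {..Nmax}"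
    and processes_indep:
      "prob_space.indep_sets M (\<lambda>N. process_events M (\<Psi> N) pos) {..Nmax}"
    and gains_exponential: "\<And>n. distributed M lborel (h n) (exponential_density 1)"
    and gains_indep: "prob_space.indep_vars M (\<lambda>_. borel) h UNIV"
    and gains_indep_processes:
      "prob_space.indep_set M
         (sets (vimage_algebra (space M) (\<lambda>w n. h n w) (Pi\<^sub>M UNIV (\<lambda>_. borel))))
         (sets (vimage_algebra (space M)
            (\<lambda>w. (\<lambda>N\<in>{..Nmax}. \<lambda>n. n \<in> \<Psi> N w, \<lambda>n. pos n w))
            (Pi\<^sub>M {..Nmax} (\<lambda>_. Pi\<^sub>M UNIV (\<lambda>_. count_space UNIV)) \<Otimes>\<^sub>M Pi\<^sub>M UNIV (\<lambda>_. borel))))"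
  shows
    "(\<forall>z. z \<noteq> 0 \<longrightarrow>
       (AE w in M. \<forall>L0. L w = ereal L0 \<longrightarrow>
          (\<lambda>\<omega>. 1 / (pi * \<omega>) *
             Im (exp (- \<i> * of_real \<omega> * of_real z) *
                 (\<Prod>N\<le>Nmax. Phi lamPH lamw \<kappa> \<beta> K RD N \<omega> L0))) integrable_on {0<..} \<and>
          cond_cdf M (interference \<kappa> \<beta> K Nmax \<Psi> pos h) L z w =
            1 / 2 - integral {0<..} (\<lambda>\<omega>. 1 / (pi * \<omega>) *
              Im (exp (- \<i> * of_real \<omega> * of_real z) *
                  (\<Prod>N\<le>Nmax. Phi lamPH lamw \<kappa> \<beta> K RD N \<omega> L0))))) \<and>
     (\<forall>N\<le>Nmax. \<forall>\<omega>. AE w in M. \<forall>L0. L w = ereal L0 \<longrightarrow>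
           cond_char M (interference_from \<kappa> \<beta> K Nmax \<Psi> pos h N) L \<omega> w =
             Phi lamPH lamw \<kappa> \<beta> K RD N \<omega> L0)"
proof -
  interpret prob_space M by fact
  interpret network_model M lamPH lamw \<beta> \<kappa> K RD Nmax \<Psi> pos h
    by unfold_locales (fact assms)+
  show ?thesis
    unfolding L_def
  proof (intro conjI allI impI)
    fix z :: real assume "z \<noteq> 0"
    from conditional_cdf[OF this]
    show "AE w in M. \<forall>L0. min_path_loss \<kappa> \<beta> K Nmax \<Psi> pos w = ereal L0 \<longrightarrow>
          (\<lambda>\<omega>. 1 / (pi * \<omega>) *
             Im (exp (- \<i> * of_real \<omega> * of_real z) *
                 (\<Prod>N\<le>Nmax. Phi lamPH lamw \<kappa> \<beta> K RD N \<omega> L0))) integrable_on {0<..} \<and>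
          cond_cdf M (interference \<kappa> \<beta> K Nmax \<Psi> pos h) (min_path_loss \<kappa> \<beta> K Nmax \<Psi> pos) z w =
            1 / 2 - integral {0<..} (\<lambda>\<omega>. 1 / (pi * \<omega>) *
              Im (exp (- \<i> * of_real \<omega> * of_real z) *
                  (\<Prod>N\<le>Nmax. Phi lamPH lamw \<kappa> \<beta> K RD N \<omega> L0)))"
    proof eventually_elim
      case (elim w)
      show ?case
      proof (intro allI impI)
        fix L0 assume "min_path_loss \<kappa> \<beta> K Nmax \<Psi> pos w = ereal L0"
        from elim[rule_format, OF this]
        show "(\<lambda>\<omega>. 1 / (pi * \<omega>) *
             Im (exp (- \<i> * of_real \<omega> * of_real z) *
                 (\<Prod>N\<le>Nmax. Phi lamPH lamw \<kappa> \<beta> K RD N \<omega> L0))) integrable_on {0<..} \<and>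
          cond_cdf M (interference \<kappa> \<beta> K Nmax \<Psi> pos h) (min_path_loss \<kappa> \<beta> K Nmax \<Psi> pos) z w =
            1 / 2 - integral {0<..} (\<lambda>\<omega>. 1 / (pi * \<omega>) *
              Im (exp (- \<i> * of_real \<omega> * of_real z) *
                  (\<Prod>N\<le>Nmax. Phi lamPH lamw \<kappa> \<beta> K RD N \<omega> L0)))"
          by (simp only: has_integral_integrable integral_unique diff_diff_eq2 add_diff_cancel_left' simp_thms)
      qed
    qed
  next
    fix N \<omega> assume "N \<le> Nmax"
    then show "AE w in M. \<forall>L0. min_path_loss \<kappa> \<beta> K Nmax \<Psi> pos w = ereal L0 \<longrightarrow>
        cond_char M (interference_from \<kappa> \<beta> K Nmax \<Psi> pos h N) (min_path_loss \<kappa> \<beta> K Nmax \<Psi> pos) \<omega> w =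
          Phi lamPH lamw \<kappa> \<beta> K RD N \<omega> L0"
      by (rule conditional_char)
  qed
qed

end
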